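(* Let $F$ be a field of characteristic $2$, let $s\ge 2$, and let $S=\{\varphi_1,\dots,\varphi_s\}$ be a tight set of quadratic $2$-fold Pfister forms over $F$ whose image generates a subgroup of order $2^s$ in $I_q^2F/I_q^3F$. Then the anisotropic part of $\Sigma_S$ satisfies $\dim\big((\Sigma_S)_{\mathrm{an}}\big)\le 2^{s+1}$.
   Context: $[a,b]$ denotes the quadratic form $ax^2+xy+by^2$. $I_q^1F$ is the group of Witt classes of even-dimensional nonsingular quadratic forms over $F$ under orthogonal sum. Quadratic Pfister forms: $\langle\langle\alpha]]=[1,\alpha]$ and $\langle\langle\beta_1,\dots,\beta_{n-1},\alpha]]=\langle 1,\beta_1\rangle\otimes\cdots\otimes\langle 1,\beta_{n-1}\rangle\otimes[1,\alpha]$, $\beta_i\in F^\times$, $\alpha\in F$, where $\langle 1,\beta\rangle$ is the diagonal symmetric bilinear form. $I_q^nF$ is the subgroup of $I_q^1F$ generated by scalar multiples of quadratic $n$-fold Pfister forms. For a Witt class $\Sigma$, $\Sigma_{\mathrm{an}}$ is its unique anisotropic representative. A set of quadratic $n$-fold Pfister forms is tight if every element of the subgroup it generates in $I_q^nF/I_q^{n+1}F$ is represented by a quadratic $n$-fold Pfister form (unique up to isometry). For a finite tight set $S$ of more than one form, $\Sigma_S\in I_q^nF$ is the sum in $I_q^nF$ of the unique $n$-fold Pfister representatives of all the elements of the subgroup generated by the image of $S$ in $I_q^nF/I_q^{n+1}F$. *)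

theory Defs
  imports "Jordan_Normal_Form.Matrix" "HOL-Algebra.Generated_Groups"
begin

text \<open>
  A quadratic form of dimension n over F is encoded by its coefficient matrix: the upper triangular
  n x n matrix A stands for the form \<open>\<Sum>i\<le>j. A(i,j) x(i) x(j)\<close> on F^n. In every
  characteristic this is a bijection between upper triangular matrices and quadratic forms on F^n;
  symmetric matrices would not do in characteristic 2.
\<close>

definition quadratic_form :: "'a::field mat \<Rightarrow> bool" where
  "quadratic_form A \<longleftrightarrow> square_mat A \<and> upper_triangular A"

definition qdim :: "'a::field mat \<Rightarrow> nat" where
  "qdim A = dim_row A"

definition qeval :: "'a::field mat \<Rightarrow> 'a vec \<Rightarrow> 'a" where
  "qeval A x = x \<bullet> (A *\<^sub>v x)"

definition polar :: "'a::field mat \<Rightarrow> 'a vec \<Rightarrow> 'a vec \<Rightarrow> 'a" where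
  "polar A x y = qeval A (x + y) - qeval A x - qeval A y"

definition nonsingular :: "'a::field mat \<Rightarrow> bool" where
  "nonsingular A \<longleftrightarrow>
     (\<forall>x\<in>carrier_vec (qdim A). (\<forall>y\<in>carrier_vec (qdim A). polar A x y = 0) \<longrightarrow> x = 0\<^sub>v (qdim A))"

definition anisotropic :: "'a::field mat \<Rightarrow> bool" where
  "anisotropic A \<longleftrightarrow> (\<forall>x\<in>carrier_vec (qdim A). x \<noteq> 0\<^sub>v (qdim A) \<longrightarrow> qeval A x \<noteq> 0)"

definition isometric :: "'a::field mat \<Rightarrow> 'a mat \<Rightarrow> bool" (infix \<open>\<simeq>\<^sub>q\<close> 50) where
  "A \<simeq>\<^sub>q B \<longleftrightarrow> qdim A = qdim B \<and>
     (\<exists>P\<in>carrier_mat (qdim A) (qdim A). invertible_mat P \<and>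
        (\<forall>x\<in>carrier_vec (qdim A). qeval B (P *\<^sub>v x) = qeval A x))"

definition orth_sum :: "'a::field mat \<Rightarrow> 'a mat \<Rightarrow> 'a mat" (infixl \<open>\<bottom>\<^sub>q\<close> 65) where
  "A \<bottom>\<^sub>q B = four_block_mat A (0\<^sub>m (dim_row A) (dim_col B)) (0\<^sub>m (dim_row B) (dim_col A)) B"

text \<open>The binary form [a,b], that is, \<open>a x^2 + x y + b y^2\<close>.\<close>

definition binary_form :: "'a::field \<Rightarrow> 'a \<Rightarrow> 'a mat" where
  "binary_form a b = mat_of_rows_list 2 [[a, 1], [0, b]]"

primrec hyperbolic :: "nat \<Rightarrow> 'a::field mat" where
  "hyperbolic 0 = 0\<^sub>m 0 0"
| "hyperbolic (Suc n) = binary_form 0 0 \<bottom>\<^sub>q hyperbolic n"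

lemma qeval_orth_sum:
  assumes "A \<in> carrier_mat m m" "B \<in> carrier_mat n n" "x \<in> carrier_vec m" "y \<in> carrier_vec n"
  shows "qeval (A \<bottom>\<^sub>q B) (x @\<^sub>v y) = qeval A x + qeval B y"
proof -
  have "(A \<bottom>\<^sub>q B) *\<^sub>v (x @\<^sub>v y) = (A *\<^sub>v x) @\<^sub>v (B *\<^sub>v y)"
    using assms unfolding orth_sum_def
    by (subst four_block_mat_mult_vec[of _ m m _ n _ n]) auto
  then show ?thesis
    using assms unfolding qeval_def by (simp add: scalar_prod_append[of _ m _ n])
qed

lemma qeval_binary_form:
  "qeval (binary_form a b) (vec_of_list [x, y]) = a * x ^ 2 + x * y + b * y ^ 2"
  by (simp add: qeval_def binary_form_def mat_of_rows_list_def scalar_prod_def vec_of_list_index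
      atLeast0_lessThan_Suc numeral_2_eq_2 algebra_simps)

text \<open>The tensor product of the diagonal bilinear form \<open>\<langle>1,b\<rangle>\<close> with a quadratic form q takes
  \<open>v \<otimes> w\<close> to \<open>\<langle>1,b\<rangle>(v,v) q(w)\<close>; hence it is the orthogonal sum of q and b q.\<close>

definition bilinear_tensor :: "'a::field \<Rightarrow> 'a mat \<Rightarrow> 'a mat" where
  "bilinear_tensor b A = A \<bottom>\<^sub>q (b \<cdot>\<^sub>m A)"

text \<open>Pfister forms in the convention of characteristic 2; in other characteristics \<open>[1,a]\<close>
  is singular when \<open>4 a = 1\<close>.\<close>

primrec pfister_form :: "'a::field list \<Rightarrow> 'a \<Rightarrow> 'a mat" where
  "pfister_form [] a = binary_form 1 a"
| "pfister_form (b # bs) a = bilinear_tensor b (pfister_form bs a)"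

definition is_pfister :: "nat \<Rightarrow> 'a::field mat \<Rightarrow> bool" where
  "is_pfister n A \<longleftrightarrow> quadratic_form A \<and>
     (\<exists>bs a. Suc (length bs) = n \<and> 0 \<notin> set bs \<and> A \<simeq>\<^sub>q pfister_form bs a)"

definition even_nonsingular_forms :: "'a::field mat set" where
  "even_nonsingular_forms = {A. quadratic_form A \<and> even (qdim A) \<and> nonsingular A}"

definition witt_rel :: "('a::field mat \<times> 'a mat) set" where
  "witt_rel = {(A, B). A \<in> even_nonsingular_forms \<and> B \<in> even_nonsingular_forms \<and>
     (\<exists>m n. A \<bottom>\<^sub>q hyperbolic m \<simeq>\<^sub>q B \<bottom>\<^sub>q hyperbolic n)}"

definition witt_class :: "'a::field mat \<Rightarrow> 'a mat set" where
  "witt_class A = witt_rel `` {A}"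

text \<open>The group \<open>I_q^1 F\<close>, written multiplicatively as is usual for the group records used here:
  its multiplication is induced by the orthogonal sum.\<close>

definition witt_group :: "'a::field mat set monoid" where
  "witt_group =
     \<lparr>carrier = even_nonsingular_forms // witt_rel,
      mult = (\<lambda>v w. \<Union>A\<in>v. \<Union>B\<in>w. witt_class (A \<bottom>\<^sub>q B)),
      one = witt_class (0\<^sub>m 0 0)\<rparr>"

text \<open>The subgroup \<open>I_q^n F\<close> (for n at least 1) as a set, as a group, and the quotient
  \<open>I_q^n F / I_q^(n+1) F\<close>.\<close>

definition Iq :: "nat \<Rightarrow> 'a::field mat set set" where
  "Iq n = generate witt_group {witt_class (c \<cdot>\<^sub>m A) | c A. c \<noteq> 0 \<and> is_pfister n A}"

definition Iq_group :: "nat \<Rightarrow> 'a::field mat set monoid" where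
  "Iq_group n = witt_group\<lparr>carrier := Iq n\<rparr>"

definition Iq_quot :: "nat \<Rightarrow> 'a::field mat set set monoid" where
  "Iq_quot n = Iq_group n Mod Iq (Suc n)"

definition Iq_proj :: "nat \<Rightarrow> 'a::field mat set \<Rightarrow> 'a mat set set" where
  "Iq_proj n w = Iq (Suc n) #>\<^bsub>Iq_group n\<^esub> w"

definition image_subgroup :: "nat \<Rightarrow> 'a::field mat set \<Rightarrow> 'a mat set set set" where
  "image_subgroup n S = generate (Iq_quot n) ((\<lambda>A. Iq_proj n (witt_class A)) ` S)"

definition tight :: "nat \<Rightarrow> 'a::field mat set \<Rightarrow> bool" where
  "tight n S \<longleftrightarrow> (\<forall>A\<in>S. is_pfister n A) \<and>
     (\<forall>X\<in>image_subgroup n S. \<exists>A. is_pfister n A \<and> Iq_proj n (witt_class A) = X)"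

text \<open>The Witt class of the n-fold Pfister form, unique up to isometry, that represents X.\<close>

definition pfister_rep :: "nat \<Rightarrow> 'a::field mat set set \<Rightarrow> 'a mat set" where
  "pfister_rep n X = (THE w. \<exists>A. is_pfister n A \<and> w = witt_class A \<and> Iq_proj n w = X)"

definition Sigma_sum :: "nat \<Rightarrow> 'a::field mat set \<Rightarrow> 'a mat set" where
  "Sigma_sum n S = finprod (Iq_group n) (pfister_rep n) (image_subgroup n S)"

text \<open>The anisotropic representative of a Witt class is unique only up to isometry, so one
  of the isometric matrices is chosen.\<close>

definition anisotropic_part :: "'a::field mat set \<Rightarrow> 'a mat" where
  "anisotropic_part w = (SOME A. A \<in> w \<and> anisotropic A)"

end

theory Submission
  imports Defs "Jordan_Normal_Form.Determinant" "HOL-Library.Function_Algebras"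
begin

text \<open>
  The key point is that three 2-fold Pfister forms whose sum lies in \<open>I_q^3 F\<close> satisfy
  \<open>\<phi>1 + \<phi>2 = d \<phi>3\<close> in the Witt group for some scalar d. Pairing each element x of the subgroup G
  generated by S with \<open>x + g\<close>, for a fixed nonzero g, the Pfister representatives of each of the
  \<open>2^(s-1)\<close> pairs therefore add up to a form of dimension 4, which gives the bound \<open>4 * 2^(s-1)\<close>.

  The key point needs that classes in \<open>I_q^3 F\<close> have trivial Clifford invariant. In characteristic 2
  this says that a form of dimension 2n in such a class has a graded Clifford module of dimension
  \<open>2^n\<close>: the explicit modules of multiples of 3-fold Pfister forms can be tensored without signs,
  and a hyperbolic plane with basis e, f is split off by passing to the kernel of e. Counting
  dimensions in such modules produces isotropic vectors.
\<close>


section \<open>Linear maps between coordinate spaces\<close>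

text \<open>The plain dimension count reaches dimension 6 and stops at 8, the dimension of 3-fold
  Pfister forms, which may be anisotropic. The key point concerns dimension 10:
  \<open>\<phi>1 + \<phi>2\<close> has a 6-dimensional representative, because both summands
  represent 1, and this is compared with \<open>d \<phi>3\<close> for a value d of it. The common
  value yields one plane and leaves dimension 8, just out of reach. A second isotropic direction has
  to come from a finer count, in which the even Clifford algebra of \<open>d \<phi>3\<close>
  supplies a second grading and cuts the module of dimension 32 into quarters. Planes are cancelled
  in two settings. For forms, totally isotropic subspaces play the role of Witt cancellation: a
  class is trivial exactly when a representative has a Lagrangian. For modules, passing to a kernel
  destroys the tensor structure; this is why explicit models on tensor sites
  (\<open>cliffordian\<close>, stable under sums) and abstract modules (\<open>has_module\<close>,
  stable under cancellation) are kept apart.\<close>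

definition lin :: "nat \<Rightarrow> nat \<Rightarrow> ('a::field vec \<Rightarrow> 'a vec) \<Rightarrow> bool" where
  "lin m n f \<longleftrightarrow> (\<forall>x\<in>carrier_vec m. f x \<in> carrier_vec n) \<and>
     (\<forall>x\<in>carrier_vec m. \<forall>y\<in>carrier_vec m. f (x + y) = f x + f y) \<and>
     (\<forall>c. \<forall>x\<in>carrier_vec m. f (c \<cdot>\<^sub>v x) = c \<cdot>\<^sub>v f x)"

lemma linI:
  assumes "\<And>x. x \<in> carrier_vec m \<Longrightarrow> f x \<in> carrier_vec n"
    and "\<And>x y. x \<in> carrier_vec m \<Longrightarrow> y \<in> carrier_vec m \<Longrightarrow> f (x + y) = f x + f y"
    and "\<And>c x. x \<in> carrier_vec m \<Longrightarrow> f (c \<cdot>\<^sub>v x) = c \<cdot>\<^sub>v f x"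
  shows "lin m n f"
  using assms unfolding lin_def by blast

lemma lin_carrier: "lin m n f \<Longrightarrow> x \<in> carrier_vec m \<Longrightarrow> f x \<in> carrier_vec n"
  and lin_add: "lin m n f \<Longrightarrow> x \<in> carrier_vec m \<Longrightarrow> y \<in> carrier_vec m \<Longrightarrow> f (x + y) = f x + f y"
  and lin_smult: "lin m n f \<Longrightarrow> x \<in> carrier_vec m \<Longrightarrow> f (c \<cdot>\<^sub>v x) = c \<cdot>\<^sub>v f x"
  unfolding lin_def by blast+

lemma smult_zero_vec: "v \<in> carrier_vec n \<Longrightarrow> (0::'a::field) \<cdot>\<^sub>v v = 0\<^sub>v n"
  by auto

lemma lin_zero: assumes "lin m n f" shows "f (0\<^sub>v m) = 0\<^sub>v n"
proof -
  have "f (0\<^sub>v m) = f (0 \<cdot>\<^sub>v 0\<^sub>v m)" by (simp only: smult_zero_vec[OF zero_carrier_vec])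
  also have "\<dots> = 0 \<cdot>\<^sub>v f (0\<^sub>v m)" by (rule lin_smult[OF assms]) simp
  also have "\<dots> = 0\<^sub>v n" using lin_carrier[OF assms, of "0\<^sub>v m"] by (auto simp: smult_zero_vec)
  finally show ?thesis .
qed

lemma lin_comp: "lin m n f \<Longrightarrow> lin n k g \<Longrightarrow> lin m k (\<lambda>x. g (f x))"
  unfolding lin_def by simp

lemma lin_mat: "M \<in> carrier_mat n m \<Longrightarrow> lin m n (\<lambda>x. M *\<^sub>v x)"
  by (rule linI) (auto simp: mult_add_distrib_mat_vec mult_mat_vec)

lemma lin_id: "lin n n (\<lambda>x. x)"
  by (rule linI) auto

lemma lin_sum:
  assumes f: "lin m n f" and g: "lin m n g"
  shows "lin m n (\<lambda>x. f x + g x)"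
proof (rule linI)
  fix x y :: "'a vec" and c assume x: "x \<in> carrier_vec m" and y: "y \<in> carrier_vec m"
  note c = f[THEN lin_carrier, OF x] f[THEN lin_carrier, OF y] g[THEN lin_carrier, OF x] g[THEN lin_carrier, OF y]
  show "f x + g x \<in> carrier_vec n" using c by simp
  show "f (x + y) + g (x + y) = f x + g x + (f y + g y)"
    unfolding lin_add[OF f x y] lin_add[OF g x y] using c by (intro eq_vecI) auto
  show "f (c \<cdot>\<^sub>v x) + g (c \<cdot>\<^sub>v x) = c \<cdot>\<^sub>v (f x + g x)"
    unfolding lin_smult[OF f x] lin_smult[OF g x] using c by (simp add: smult_add_distrib_vec)
qed

lemma lin_const_zero: "lin m n (\<lambda>x. 0\<^sub>v n)"
  by (rule linI) auto

lemma lin_first: "lin (m + n) m (\<lambda>x. vec_first x m)"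
  by (rule linI) (auto simp: vec_first_def)

lemma lin_last: "lin (m + n) n (\<lambda>x. vec_last x n)"
  by (rule linI) (auto simp: vec_last_def)

lemma lin_append: "lin k m f \<Longrightarrow> lin k n g \<Longrightarrow> lin k (m + n) (\<lambda>x. f x @\<^sub>v g x)"
  apply (rule linI)
    apply (meson append_carrier_vec lin_carrier)
   apply (simp add: lin_add)
   apply (rule append_vec_add[symmetric, of _ m _ _ n])
      apply (auto simp: lin_carrier)[4]
  apply (simp add: lin_smult)
  apply (rule eq_vecI)
  by (auto simp: lin_def index_append_vec)

lemma vec_first_append: "x \<in> carrier_vec m \<Longrightarrow> vec_first (x @\<^sub>v y) m = x"
  by (rule eq_vecI) (auto simp: vec_first_def)

lemma vec_last_append: "y \<in> carrier_vec n \<Longrightarrow> vec_last (x @\<^sub>v y) n = y"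
  by (rule eq_vecI) (auto simp: vec_last_def)

lemma append_split:
  assumes "x \<in> carrier_vec (m + n)"
  obtains y z where "y \<in> carrier_vec m" "z \<in> carrier_vec n" "x = y @\<^sub>v z"
proof
  show "x = vec_first x m @\<^sub>v vec_last x n" using assms by simp
qed auto

lemma append_zero: "0\<^sub>v m @\<^sub>v 0\<^sub>v n = 0\<^sub>v (m + n)"
  by (rule eq_vecI) auto

lemma append_eq_zero:
  assumes "x \<in> carrier_vec m" "y \<in> carrier_vec n" "x @\<^sub>v y = 0\<^sub>v (m + n)"
  shows "x = 0\<^sub>v m" "y = 0\<^sub>v n"
  using assms append_vec_eq[of x m "0\<^sub>v m" y "0\<^sub>v n"] append_zero[of m n] by auto

lemma lin_to_mat:
  assumes "lin m n f"
  obtains M where "M \<in> carrier_mat n m" "\<And>x. x \<in> carrier_vec m \<Longrightarrow> f x = M *\<^sub>v x"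
proof -
  define M where "M = mat n m (\<lambda>(i,j). f (unit_vec m j) $ i)"
  have M: "M \<in> carrier_mat n m" by (simp add: M_def)
  \<comment> \<open>Truncating x to its first k entries turns linearity into an induction on k; at
    \<open>k = m\<close> the truncation is x itself.\<close>
  have part: "k \<le> m \<Longrightarrow> f (vec m (\<lambda>i. if i < k then x $ i else 0)) =
      vec n (\<lambda>i. \<Sum>j<k. f (unit_vec m j) $ i * x $ j)" for k x
  proof (induction k)
    case 0
    have "vec m (\<lambda>i. if i < 0 then x $ i else 0) = 0\<^sub>v m" by auto
    then show ?case using lin_zero[OF assms] by auto
  next
    case (Suc k)
    have "vec m (\<lambda>i. if i < Suc k then x $ i else 0) =
        vec m (\<lambda>i. if i < k then x $ i else 0) + (x $ k) \<cdot>\<^sub>v unit_vec m k"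
      using Suc.prems by (intro eq_vecI) (auto simp: unit_vec_def less_Suc_eq)
    then have "f (vec m (\<lambda>i. if i < Suc k then x $ i else 0)) =
       f (vec m (\<lambda>i. if i < k then x $ i else 0)) + (x $ k) \<cdot>\<^sub>v f (unit_vec m k)"
      by (simp add: lin_add[OF assms] lin_smult[OF assms])
    also have "\<dots> = vec n (\<lambda>i. \<Sum>j<Suc k. f (unit_vec m j) $ i * x $ j)"
      using Suc lin_carrier[OF assms, of "unit_vec m k"] by (intro eq_vecI) (auto simp: mult.commute)
    finally show ?case .
  qed
  have "f x = M *\<^sub>v x" if x: "x \<in> carrier_vec m" for x
  proof -
    have "vec m (\<lambda>i. if i < m then x $ i else 0) = x" using x by auto
    then have "f x = vec n (\<lambda>i. \<Sum>j<m. f (unit_vec m j) $ i * x $ j)" using part[of m x] by simp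
    also have "\<dots> = M *\<^sub>v x"
      using x by (intro eq_vecI) (auto simp: M_def scalar_prod_def atLeast0LessThan)
    finally show ?thesis .
  qed
  then show ?thesis using that M by blast
qed

text \<open>Determinants detect kernels of square matrices only, so \<open>M\<close> is padded with
  zero rows. Row \<open>n\<close> of the padded matrix is zero because \<open>n < m\<close>, hence
  its transpose kills \<open>unit_vec m n\<close> and the determinant vanishes.\<close>

lemma wide_mat_kernel:
  fixes M :: "'a::field mat"
  assumes M: "M \<in> carrier_mat n m" and nm: "n < m"
  obtains x where "x \<in> carrier_vec m" "x \<noteq> 0\<^sub>v m" "M *\<^sub>v x = 0\<^sub>v n"
proof -
  define N where "N = mat m m (\<lambda>(i,j). if i < n then M $$ (i,j) else 0)"
  have N: "N \<in> carrier_mat m m" by (simp add: N_def)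
  have "row N n = 0\<^sub>v m" using nm by (intro eq_vecI) (auto simp: N_def)
  then have "transpose_mat N *\<^sub>v unit_vec m n = 0\<^sub>v m"
    using N nm by (intro eq_vecI) (auto simp: N_def)
  then have "det N = 0"
    using det_0_iff_vec_prod_zero_field[of "transpose_mat N" m] N nm det_transpose[OF N]
    by (metis transpose_carrier_mat unit_vec_carrier unit_vec_nonzero)
  then obtain x where x: "x \<in> carrier_vec m" "x \<noteq> 0\<^sub>v m" "N *\<^sub>v x = 0\<^sub>v m"
    using det_0_iff_vec_prod_zero_field[OF N] by auto
  have "M *\<^sub>v x = 0\<^sub>v n"
  proof (rule eq_vecI)
    fix i assume i: "i < dim_vec (0\<^sub>v n)"
    then have "row N i = row M i" using M nm by (intro eq_vecI) (auto simp: N_def)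
    moreover have "(N *\<^sub>v x) $ i = 0" using x(3) i nm by simp
    ultimately show "(M *\<^sub>v x) $ i = 0\<^sub>v n $ i" using i nm M N by simp
  qed (use M in simp)
  then show ?thesis using that x by blast
qed

lemma lin_kernel:
  assumes f: "lin m n f" and nm: "n < m"
  obtains x where "x \<in> carrier_vec m" "x \<noteq> 0\<^sub>v m" "f x = 0\<^sub>v n"
proof -
  obtain M where M: "M \<in> carrier_mat n m" "\<And>x. x \<in> carrier_vec m \<Longrightarrow> f x = M *\<^sub>v x"
    using lin_to_mat[OF f] by blast
  obtain x where "x \<in> carrier_vec m" "x \<noteq> 0\<^sub>v m" "M *\<^sub>v x = 0\<^sub>v n" using wide_mat_kernel[OF M(1) nm] .
  then show ?thesis using that M(2) by auto
qed

text \<open>When the coefficient \<open>a p\<close> of the pivot vanishes, so does \<open>a\<close>, and the junk value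
  of the division by \<open>a p\<close> is multiplied by zero.\<close>

lemma functional_kernel:
  fixes a :: "'a::field vec"
  assumes a: "a \<in> carrier_vec (Suc n)"
  obtains T where "lin n (Suc n) T" "\<And>y. y \<in> carrier_vec n \<Longrightarrow> T y = 0\<^sub>v (Suc n) \<Longrightarrow> y = 0\<^sub>v n"
    "\<And>y. y \<in> carrier_vec n \<Longrightarrow> a \<bullet> T y = 0"
proof -
  obtain p where p: "p \<le> n" "a $ p = 0 \<Longrightarrow> a = 0\<^sub>v (Suc n)"
  proof (cases "a = 0\<^sub>v (Suc n)")
    case True
    then show ?thesis using that[of 0] by auto
  next
    case False
    then obtain i where "i < Suc n" "a $ i \<noteq> 0" using a by (metis eq_vecI carrier_vecD index_zero_vec)
    then show ?thesis using that[of i] by auto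
  qed
  \<comment> \<open>\<open>E\<close> inserts a zero at the pivot position \<open>p\<close>;
    \<open>T\<close> then fills in the one entry that makes \<open>a\<close> vanish, so injectivity
    can be read off the other entries.\<close>
  define E where "E y = vec (Suc n) (\<lambda>i. if i < p then y $ i else if i = p then 0 else y $ (i - 1))"
    for y :: "'a vec"
  have E: "lin n (Suc n) E"
    using p(1) by (intro linI) (auto simp: E_def intro!: eq_vecI)
  define T where "T y = E y + (- (a \<bullet> E y) / a $ p) \<cdot>\<^sub>v unit_vec (Suc n) p" for y
  have T: "lin n (Suc n) T"
  proof (rule linI)
    fix x y :: "'a vec" and c assume x: "x \<in> carrier_vec n" and y: "y \<in> carrier_vec n"
    note c = lin_carrier[OF E x] lin_carrier[OF E y]
    show "T x \<in> carrier_vec (Suc n)" by (simp add: T_def E_def)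
    show "T (x + y) = T x + T y"
      using c a by (intro eq_vecI) (auto simp: T_def lin_add[OF E x y] scalar_prod_add_distrib[of _ "Suc n"]
        add_divide_distrib diff_divide_distrib unit_vec_def)
    show "T (c \<cdot>\<^sub>v x) = c \<cdot>\<^sub>v T x"
      using c a by (intro eq_vecI) (auto simp: T_def lin_smult[OF E x] unit_vec_def algebra_simps)
  qed
  moreover have "y = 0\<^sub>v n" if y: "y \<in> carrier_vec n" "T y = 0\<^sub>v (Suc n)" for y
  proof (rule eq_vecI)
    fix i assume i: "i < dim_vec (0\<^sub>v n)"
    have "T y $ (if i < p then i else Suc i) = 0" using i y by simp
    then show "y $ i = 0\<^sub>v n $ i" using i p(1) by (auto simp: T_def E_def unit_vec_def split: if_splits)
  qed (use y in simp)
  moreover have "a \<bullet> T y = 0" if y: "y \<in> carrier_vec n" for y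
  proof -
    have "a \<bullet> T y = a \<bullet> E y + (- (a \<bullet> E y) / a $ p) * a $ p"
      using a lin_carrier[OF E y] p(1)
      unfolding T_def by (subst scalar_prod_add_distrib[of _ "Suc n"]) auto
    then show ?thesis using p(2) lin_carrier[OF E y] by (cases "a $ p = 0") auto
  qed
  ultimately show ?thesis using that by blast
qed

text \<open>Subspaces of coordinate spaces are handled as images of injective linear maps; this is
  the step of cutting by one equation. The functional is wrapped into vectors of length 1 so that
  \<open>lin\<close> applies to it.\<close>

lemma lin_functional_kernel:
  fixes f :: "'a::field vec \<Rightarrow> 'a"
  assumes f: "lin (Suc n) 1 (\<lambda>x. vec 1 (\<lambda>_. f x))"
  obtains T where "lin n (Suc n) T" "\<And>y. y \<in> carrier_vec n \<Longrightarrow> T y = 0\<^sub>v (Suc n) \<Longrightarrow> y = 0\<^sub>v n"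
    "\<And>y. y \<in> carrier_vec n \<Longrightarrow> f (T y) = 0"
proof -
  obtain M where M: "M \<in> carrier_mat 1 (Suc n)" "\<And>x. x \<in> carrier_vec (Suc n) \<Longrightarrow> vec 1 (\<lambda>_. f x) = M *\<^sub>v x"
    using lin_to_mat[OF f] by blast
  have r: "row M 0 \<in> carrier_vec (Suc n)" using M by (metis carrier_matD(2) row_carrier)
  have eq: "f x = row M 0 \<bullet> x" if "x \<in> carrier_vec (Suc n)" for x
    using M(2)[OF that] M(1) by (metis carrier_matD(1) index_mult_mat_vec index_vec less_one)
  obtain T where T: "lin n (Suc n) T" "\<And>y. y \<in> carrier_vec n \<Longrightarrow> T y = 0\<^sub>v (Suc n) \<Longrightarrow> y = 0\<^sub>v n"
    "\<And>y. y \<in> carrier_vec n \<Longrightarrow> row M 0 \<bullet> T y = 0" using functional_kernel[OF r] by metis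
  show ?thesis by (rule that[OF T(1,2)]) (use eq T(3) lin_carrier[OF T(1)] in auto)
qed

section \<open>Quadratic forms and isometries\<close>

lemma qeval_smult_vec:
  assumes A: "A \<in> carrier_mat n n" and x: "x \<in> carrier_vec n"
  shows "qeval A (c \<cdot>\<^sub>v x) = c\<^sup>2 * qeval A x"
  using assms unfolding qeval_def by (simp add: mult_mat_vec[OF A x] power2_eq_square mult.assoc)

lemma qeval_add: "qeval A (x + y) = qeval A x + qeval A y + polar A x y"
  by (simp add: polar_def)

lemma polar_expand:
  assumes A: "A \<in> carrier_mat n n" and x: "x \<in> carrier_vec n" and y: "y \<in> carrier_vec n"
  shows "polar A x y = x \<bullet> (A *\<^sub>v y) + y \<bullet> (A *\<^sub>v x)"
proof -
  have "A *\<^sub>v x \<in> carrier_vec n" "A *\<^sub>v y \<in> carrier_vec n"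
    using assms mult_mat_vec_carrier[OF A] by blast+
  then show ?thesis using x y
    unfolding polar_def qeval_def mult_add_distrib_mat_vec[OF A x y]
    by (simp add: scalar_prod_add_distrib[of _ n] add_scalar_prod_distrib[of _ n])
qed

lemma polar_commute: "x \<in> carrier_vec n \<Longrightarrow> y \<in> carrier_vec n \<Longrightarrow> polar A x y = polar A y x"
  unfolding polar_def by (subst comm_add_vec[of x n y]) auto

lemma polar_add_right:
  assumes A: "A \<in> carrier_mat n n" and "x \<in> carrier_vec n" "y \<in> carrier_vec n" "z \<in> carrier_vec n"
  shows "polar A x (y + z) = polar A x y + polar A x z"
proof -
  have "A *\<^sub>v x \<in> carrier_vec n" "A *\<^sub>v y \<in> carrier_vec n" "A *\<^sub>v z \<in> carrier_vec n"
    using assms mult_mat_vec_carrier[OF A] by blast+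
  then show ?thesis using assms
    by (simp add: polar_expand[of A n] mult_add_distrib_mat_vec[OF A] scalar_prod_add_distrib[of _ n]
        add_scalar_prod_distrib[of _ n])
qed

lemma polar_smult_right:
  assumes A: "A \<in> carrier_mat n n" and "x \<in> carrier_vec n" "y \<in> carrier_vec n"
  shows "polar A x (c \<cdot>\<^sub>v y) = c * polar A x y"
proof -
  have "A *\<^sub>v x \<in> carrier_vec n" "A *\<^sub>v y \<in> carrier_vec n"
    using assms mult_mat_vec_carrier[OF A] by blast+
  then show ?thesis using assms
    by (simp add: polar_expand[of A n] mult_mat_vec[OF A] algebra_simps)
qed

lemma polar_smult_left:
  assumes A: "A \<in> carrier_mat n n" and "x \<in> carrier_vec n" "y \<in> carrier_vec n"
  shows "polar A (c \<cdot>\<^sub>v y) x = c * polar A y x"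
  using polar_smult_right[OF assms, of c] assms by (metis polar_commute smult_carrier_vec)

lemma lin_polar:
  assumes "A \<in> carrier_mat n n" "x \<in> carrier_vec n"
  shows "lin n 1 (\<lambda>y. vec 1 (\<lambda>_. polar A x y))"
  by (rule linI) (auto simp: polar_add_right[OF assms] polar_smult_right[OF assms])

lemma qeval_zero: "A \<in> carrier_mat n n \<Longrightarrow> qeval A (0\<^sub>v n) = 0"
  by (simp add: qeval_def)

lemma polar_zero_right: "A \<in> carrier_mat n n \<Longrightarrow> x \<in> carrier_vec n \<Longrightarrow> polar A x (0\<^sub>v n) = 0"
  by (simp add: polar_def qeval_zero)

lemma polar_self:
  assumes "A \<in> carrier_mat n n" "x \<in> carrier_vec n"
  shows "polar A x x = 2 * qeval A x"
proof -
  have "x + x = 2 \<cdot>\<^sub>v x" using assms by (intro eq_vecI) auto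
  then show ?thesis using qeval_smult_vec[OF assms, of 2] by (simp add: polar_def)
qed

lemma nonsingularD:
  assumes "nonsingular A" "A \<in> carrier_mat n n" "x \<in> carrier_vec n" "x \<noteq> 0\<^sub>v n"
  obtains y where "y \<in> carrier_vec n" "polar A x y \<noteq> 0"
  using assms unfolding nonsingular_def qdim_def by (metis carrier_matD(1))

lemma quadratic_form_carrier: "quadratic_form A \<Longrightarrow> A \<in> carrier_mat (qdim A) (qdim A)"
  unfolding quadratic_form_def qdim_def square_mat.simps by (metis carrier_matI)

text \<open>Substituting into an upper triangular form gives a matrix that need not be triangular.
  Adding the entry at \<open>(j,i)\<close> to the one at \<open>(i,j)\<close> restores the normal
  form without dividing by 2.\<close>

lemma upper_triangular_representative:
  fixes M :: "'a::field mat"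
  assumes M: "M \<in> carrier_mat n n"
  obtains A where "quadratic_form A" "A \<in> carrier_mat n n"
    "\<And>x. x \<in> carrier_vec n \<Longrightarrow> qeval A x = qeval M x"
proof -
  define A where "A = mat n n (\<lambda>(i,j). if i < j then M $$ (i,j) + M $$ (j,i)
    else if i = j then M $$ (i,i) else 0)"
  have A: "A \<in> carrier_mat n n" by (simp add: A_def)
  have sums: "qeval B x = (\<Sum>i<n. \<Sum>j<n. x $ i * (B $$ (i,j) * x $ j))"
    if "B \<in> carrier_mat n n" "x \<in> carrier_vec n" for B and x :: "'a vec"
    using that by (auto simp: qeval_def scalar_prod_def atLeast0LessThan sum_distrib_left intro!: sum.cong)
  have "qeval A x = qeval M x" if x: "x \<in> carrier_vec n" for x
  proof -
    define g where "g i j = x $ i * (M $$ (i,j) * x $ j)" for i j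
    have "qeval A x = (\<Sum>i<n. \<Sum>j<n. (if i < j then g i j else 0) + (if i < j then g j i else 0)
        + (if i = j then g i j else 0))"
      unfolding sums[OF A x] by (intro sum.cong refl) (auto simp: A_def g_def algebra_simps)
    also have "\<dots> = (\<Sum>i<n. \<Sum>j<n. if i < j then g i j else 0) + (\<Sum>i<n. \<Sum>j<n. if i < j then g j i else 0)
        + (\<Sum>i<n. \<Sum>j<n. if i = j then g i j else 0)"
      by (simp add: sum.distrib)
    also have "(\<Sum>i<n. \<Sum>j<n. if i < j then g j i else 0) = (\<Sum>i<n. \<Sum>j<n. if j < i then g i j else 0)"
      by (rule sum.swap)
    finally have "qeval A x = (\<Sum>i<n. \<Sum>j<n. (if i < j then g i j else 0) + (if j < i then g i j else 0)
        + (if i = j then g i j else 0))"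
      by (simp add: sum.distrib)
    also have "\<dots> = (\<Sum>i<n. \<Sum>j<n. g i j)" by (intro sum.cong refl) auto
    finally show ?thesis by (simp add: sums[OF M x] g_def)
  qed
  moreover have "quadratic_form A"
    by (auto simp: quadratic_form_def A_def square_mat.simps)
  ultimately show ?thesis using that A by blast
qed

lemma pullback_form:
  assumes f: "lin r n f" and A: "A \<in> carrier_mat n n"
  obtains B where "quadratic_form B" "B \<in> carrier_mat r r"
    "\<And>x. x \<in> carrier_vec r \<Longrightarrow> qeval B x = qeval A (f x)"
proof -
  obtain M where M: "M \<in> carrier_mat n r" and fM: "\<And>x. x \<in> carrier_vec r \<Longrightarrow> f x = M *\<^sub>v x"
    using lin_to_mat[OF f] by blast
  have N: "M\<^sup>T * (A * M) \<in> carrier_mat r r" using A M by auto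
  obtain B where B: "quadratic_form B" "B \<in> carrier_mat r r"
    "\<And>x. x \<in> carrier_vec r \<Longrightarrow> qeval B x = qeval (M\<^sup>T * (A * M)) x"
    using upper_triangular_representative[OF N] by blast
  have "qeval (M\<^sup>T * (A * M)) x = qeval A (f x)" if x: "x \<in> carrier_vec r" for x
  proof -
    have "(M\<^sup>T * (A * M)) *\<^sub>v x = M\<^sup>T *\<^sub>v (A *\<^sub>v (M *\<^sub>v x))"
      using A M x by (simp add: assoc_mult_mat_vec[of _ r n _ r] assoc_mult_mat_vec[of _ n n _ r])
    moreover have "x \<bullet> (M\<^sup>T *\<^sub>v (A *\<^sub>v (M *\<^sub>v x))) = (M *\<^sub>v x) \<bullet> (A *\<^sub>v (M *\<^sub>v x))"
    proof -
      define w where "w = A *\<^sub>v (M *\<^sub>v x)"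
      have w: "w \<in> carrier_vec n"
        unfolding w_def by (intro mult_mat_vec_carrier[OF A] mult_mat_vec_carrier[OF M] x)
      show ?thesis unfolding w_def[symmetric]
        using transpose_vec_mult_scalar[of M n r x w] M x w comm_scalar_prod[of x r "M\<^sup>T *\<^sub>v w"]
          comm_scalar_prod[of w n "M *\<^sub>v x"] by auto
    qed
    ultimately show ?thesis unfolding qeval_def fM[OF x] by simp
  qed
  then show ?thesis using that[OF B(1,2)] B(3) by simp
qed

text \<open>Injectivity already gives an invertible matrix, because source and target have the same
  dimension.\<close>

lemma isometricI:
  assumes A: "A \<in> carrier_mat n n" and B: "B \<in> carrier_mat n n" and f: "lin n n f"
    and eq: "\<And>x. x \<in> carrier_vec n \<Longrightarrow> qeval B (f x) = qeval A x"
    and inj: "\<And>x. x \<in> carrier_vec n \<Longrightarrow> f x = 0\<^sub>v n \<Longrightarrow> x = 0\<^sub>v n"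
  shows "A \<simeq>\<^sub>q B"
proof -
  obtain M where M: "M \<in> carrier_mat n n" and fM: "\<And>x. x \<in> carrier_vec n \<Longrightarrow> f x = M *\<^sub>v x"
    using lin_to_mat[OF f] by blast
  have "det M \<noteq> 0" using det_0_iff_vec_prod_zero_field[OF M] inj fM by auto
  then have "invertible_mat M"
    using det_non_zero_imp_unit[OF M, of "()"] M
    by (auto simp: invertible_mat_def inverts_mat_def Units_def ring_mat_def square_mat.simps)
  then show ?thesis using A B M eq fM unfolding isometric_def qdim_def by auto
qed

lemma isometric_polar:
  assumes A: "A \<in> carrier_mat n n" and B: "B \<in> carrier_mat m m" and f: "lin n m f"
    and eq: "\<And>x. x \<in> carrier_vec n \<Longrightarrow> qeval B (f x) = qeval A x"
    and x: "x \<in> carrier_vec n" and y: "y \<in> carrier_vec n"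
  shows "polar B (f x) (f y) = polar A x y"
  unfolding polar_def using eq[of "x + y"] eq[OF x] eq[OF y] lin_add[OF f x y] x y by simp

lemma isometricE:
  assumes "A \<simeq>\<^sub>q B" "A \<in> carrier_mat n n"
  obtains f g where "lin n n f" "lin n n g" "\<And>x. x \<in> carrier_vec n \<Longrightarrow> qeval B (f x) = qeval A x"
    "\<And>x. x \<in> carrier_vec n \<Longrightarrow> qeval A (g x) = qeval B x"
    "\<And>x. x \<in> carrier_vec n \<Longrightarrow> f (g x) = x" "\<And>x. x \<in> carrier_vec n \<Longrightarrow> g (f x) = x"
proof -
  obtain P where P: "P \<in> carrier_mat n n" "invertible_mat P" "\<And>x. x \<in> carrier_vec n \<Longrightarrow> qeval B (P *\<^sub>v x) = qeval A x"
    using assms unfolding isometric_def qdim_def by auto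
  then obtain Q where Q: "P * Q = 1\<^sub>m n" "Q * P = 1\<^sub>m n" "Q \<in> carrier_mat n n"
    unfolding invertible_mat_def inverts_mat_def
    by (metis carrier_matD(1,2) carrier_matI index_mult_mat(2,3) index_one_mat(2,3))
  have 1: "P *\<^sub>v (Q *\<^sub>v x) = x" if "x \<in> carrier_vec n" for x
    using that P Q by (metis assoc_mult_mat_vec one_mult_mat_vec)
  have 2: "Q *\<^sub>v (P *\<^sub>v x) = x" if "x \<in> carrier_vec n" for x
    using that P Q by (metis assoc_mult_mat_vec one_mult_mat_vec)
  show ?thesis
  proof (rule that[OF lin_mat[OF P(1)] lin_mat[OF Q(3)] P(3) _ 1 2])
    show "qeval A (Q *\<^sub>v x) = qeval B x" if "x \<in> carrier_vec n" for x
      using P(3)[OF mult_mat_vec_carrier[OF Q(3) that]] 1[OF that] by simp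
  qed
qed

lemma isometric_refl: "A \<in> carrier_mat n n \<Longrightarrow> A \<simeq>\<^sub>q A"
  by (rule isometricI[OF _ _ lin_id]) auto

lemma isometric_sym:
  assumes "A \<simeq>\<^sub>q B" "A \<in> carrier_mat n n" "B \<in> carrier_mat n n"
  shows "B \<simeq>\<^sub>q A"
proof -
  obtain f g where fg: "lin n n f" "lin n n g" "\<And>x. x \<in> carrier_vec n \<Longrightarrow> qeval B (f x) = qeval A x"
    "\<And>x. x \<in> carrier_vec n \<Longrightarrow> qeval A (g x) = qeval B x"
    "\<And>x. x \<in> carrier_vec n \<Longrightarrow> f (g x) = x" "\<And>x. x \<in> carrier_vec n \<Longrightarrow> g (f x) = x"
    using isometricE[OF assms(1,2)] by metis
  show ?thesis
    using fg(5) lin_zero[OF fg(1)] by (intro isometricI[OF assms(3,2) fg(2,4)]) metis+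
qed

lemma isometric_trans:
  assumes "A \<simeq>\<^sub>q B" "B \<simeq>\<^sub>q C" "A \<in> carrier_mat n n" "B \<in> carrier_mat n n" "C \<in> carrier_mat n n"
  shows "A \<simeq>\<^sub>q C"
proof -
  obtain f g where fg: "lin n n f" "lin n n g" "\<And>x. x \<in> carrier_vec n \<Longrightarrow> qeval B (f x) = qeval A x"
    "\<And>x. x \<in> carrier_vec n \<Longrightarrow> g (f x) = x"
    using isometricE[OF assms(1,3)] by metis
  obtain f' g' where fg': "lin n n f'" "lin n n g'" "\<And>x. x \<in> carrier_vec n \<Longrightarrow> qeval C (f' x) = qeval B x"
    "\<And>x. x \<in> carrier_vec n \<Longrightarrow> g' (f' x) = x"
    using isometricE[OF assms(2,4)] by metis
  show ?thesis
  proof (rule isometricI[OF assms(3,5) lin_comp[OF fg(1) fg'(1)]])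
    fix x :: "'a vec" assume x: "x \<in> carrier_vec n"
    note c = lin_carrier[OF fg(1) x]
    show "qeval C (f' (f x)) = qeval A x" using fg'(3)[OF c] fg(3)[OF x] by simp
    assume "f' (f x) = 0\<^sub>v n"
    then have "f x = 0\<^sub>v n" using fg'(4)[OF c] lin_zero[OF fg'(2)] by simp
    then show "x = 0\<^sub>v n" using fg(4)[OF x] lin_zero[OF fg(2)] by simp
  qed
qed

section \<open>Orthogonal sums and nonsingularity\<close>

lemma orth_sum_carrier [simp, intro]:
  "A \<in> carrier_mat m m \<Longrightarrow> B \<in> carrier_mat n n \<Longrightarrow> A \<bottom>\<^sub>q B \<in> carrier_mat (m + n) (m + n)"
  unfolding orth_sum_def by (intro four_block_carrier_mat) auto

lemma quadratic_form_orth_sum: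
  assumes "quadratic_form A" "quadratic_form B"
  shows "quadratic_form (A \<bottom>\<^sub>q B)"
  using assms unfolding quadratic_form_def orth_sum_def square_mat.simps upper_triangular_def
  by auto

lemma polar_orth_sum:
  assumes "A \<in> carrier_mat m m" "B \<in> carrier_mat n n" "x \<in> carrier_vec m" "y \<in> carrier_vec n"
    "x' \<in> carrier_vec m" "y' \<in> carrier_vec n"
  shows "polar (A \<bottom>\<^sub>q B) (x @\<^sub>v y) (x' @\<^sub>v y') = polar A x x' + polar B y y'"
proof -
  have "(x @\<^sub>v y) + (x' @\<^sub>v y') = (x + x') @\<^sub>v (y + y')"
    by (rule append_vec_add[OF assms(3,5) assms(4,6)])
  then show ?thesis
    using assms by (simp add: polar_def qeval_orth_sum[of _ m _ n])
qed

lemma nonsingularI: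
  assumes "A \<in> carrier_mat n n"
    and "\<And>x. x \<in> carrier_vec n \<Longrightarrow> (\<And>y. y \<in> carrier_vec n \<Longrightarrow> polar A x y = 0) \<Longrightarrow> x = 0\<^sub>v n"
  shows "nonsingular A"
  using assms unfolding nonsingular_def qdim_def by auto

lemma nonsingular_zeroD:
  assumes "nonsingular A" "A \<in> carrier_mat n n" "x \<in> carrier_vec n"
    "\<And>y. y \<in> carrier_vec n \<Longrightarrow> polar A x y = 0"
  shows "x = 0\<^sub>v n"
  using nonsingularD[OF assms(1-3)] assms(4) by metis

lemma nonsingular_orth_sum:
  fixes A :: "'a::field mat"
  assumes A: "A \<in> carrier_mat m m" "nonsingular A" and B: "B \<in> carrier_mat n n" "nonsingular B"
  shows "nonsingular (A \<bottom>\<^sub>q B)"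
proof (rule nonsingularI)
  show "A \<bottom>\<^sub>q B \<in> carrier_mat (m + n) (m + n)" using A B by simp
  fix x assume "x \<in> carrier_vec (m + n)" and 0: "\<And>y. y \<in> carrier_vec (m + n) \<Longrightarrow> polar (A \<bottom>\<^sub>q B) x y = 0"
  then obtain x1 x2 where x: "x1 \<in> carrier_vec m" "x2 \<in> carrier_vec n" "x = x1 @\<^sub>v x2"
    by (metis append_split)
  have "x1 = 0\<^sub>v m"
  proof (rule nonsingular_zeroD[OF A(2,1) x(1)])
    fix y :: "'a vec" assume "y \<in> carrier_vec m"
    then show "polar A x1 y = 0"
      using 0[of "y @\<^sub>v 0\<^sub>v n"] x A B by (simp add: polar_orth_sum[of _ m _ n] polar_zero_right)
  qed
  moreover have "x2 = 0\<^sub>v n"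
  proof (rule nonsingular_zeroD[OF B(2,1) x(2)])
    fix y :: "'a vec" assume "y \<in> carrier_vec n"
    then show "polar B x2 y = 0"
      using 0[of "0\<^sub>v m @\<^sub>v y"] x A B by (simp add: polar_orth_sum[of _ m _ n] polar_zero_right)
  qed
  ultimately show "x = 0\<^sub>v (m + n)" using x append_zero by simp
qed

lemma nonsingular_isometric:
  fixes A :: "'a::field mat"
  assumes "A \<simeq>\<^sub>q B" "A \<in> carrier_mat n n" "B \<in> carrier_mat n n" "nonsingular A"
  shows "nonsingular B"
proof (rule nonsingularI[OF assms(3)])
  fix x assume x: "x \<in> carrier_vec n" and 0: "\<And>y. y \<in> carrier_vec n \<Longrightarrow> polar B x y = 0"
  obtain f g where fg: "lin n n f" "lin n n g" "\<And>x. x \<in> carrier_vec n \<Longrightarrow> qeval B (f x) = qeval A x"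
    "\<And>x. x \<in> carrier_vec n \<Longrightarrow> f (g x) = x"
    using isometricE[OF assms(1,2)] by metis
  have "g x = 0\<^sub>v n"
  proof (rule nonsingular_zeroD[OF assms(4,2) lin_carrier[OF fg(2) x]])
    fix y :: "'a vec" assume y: "y \<in> carrier_vec n"
    have "polar A (g x) y = polar B (f (g x)) (f y)"
      using isometric_polar[OF assms(2,3) fg(1,3) lin_carrier[OF fg(2) x] y] by simp
    then show "polar A (g x) y = 0" using 0 lin_carrier[OF fg(1) y] fg(4)[OF x] by simp
  qed
  then show "x = 0\<^sub>v n" using fg(4)[OF x] lin_zero[OF fg(1)] by simp
qed

lemma orth_sum_cong:
  assumes "A \<simeq>\<^sub>q A'" "B \<simeq>\<^sub>q B'" and A: "A \<in> carrier_mat m m" "A' \<in> carrier_mat m m"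
    and B: "B \<in> carrier_mat n n" "B' \<in> carrier_mat n n"
  shows "A \<bottom>\<^sub>q B \<simeq>\<^sub>q A' \<bottom>\<^sub>q B'"
proof -
  obtain f f' where f: "lin m m f" "lin m m f'" "\<And>x. x \<in> carrier_vec m \<Longrightarrow> qeval A' (f x) = qeval A x"
    "\<And>x. x \<in> carrier_vec m \<Longrightarrow> f' (f x) = x"
    using isometricE[OF assms(1) A(1)] by metis
  obtain g g' where g: "lin n n g" "lin n n g'" "\<And>x. x \<in> carrier_vec n \<Longrightarrow> qeval B' (g x) = qeval B x"
    "\<And>x. x \<in> carrier_vec n \<Longrightarrow> g' (g x) = x"
    using isometricE[OF assms(2) B(1)] by metis
  show ?thesis
  proof (rule isometricI[of _ "m + n"])
    show "lin (m + n) (m + n) (\<lambda>x. f (vec_first x m) @\<^sub>v g (vec_last x n))"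
      by (intro lin_append lin_comp[OF lin_first f(1)] lin_comp[OF lin_last g(1)])
    fix x :: "'a vec" assume "x \<in> carrier_vec (m + n)"
    then obtain y z where x: "y \<in> carrier_vec m" "z \<in> carrier_vec n" "x = y @\<^sub>v z" by (rule append_split)
    note c = lin_carrier[OF f(1) x(1)] lin_carrier[OF g(1) x(2)]
    show "qeval (A' \<bottom>\<^sub>q B') (f (vec_first x m) @\<^sub>v g (vec_last x n)) = qeval (A \<bottom>\<^sub>q B) x"
      using x c A B by (simp add: vec_first_append vec_last_append qeval_orth_sum[of _ m _ n] f(3) g(3))
    assume "f (vec_first x m) @\<^sub>v g (vec_last x n) = 0\<^sub>v (m + n)"
    then have "f y = 0\<^sub>v m" "g z = 0\<^sub>v n"
      using append_eq_zero[OF c] x by (simp_all add: vec_first_append vec_last_append)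
    then have "y = 0\<^sub>v m" "z = 0\<^sub>v n"
      using f(4)[OF x(1)] g(4)[OF x(2)] lin_zero[OF f(2)] lin_zero[OF g(2)] by simp_all
    then show "x = 0\<^sub>v (m + n)" using x append_zero by simp
  qed (use A B in auto)
qed

lemma append_vec_assoc: "(x @\<^sub>v y) @\<^sub>v z = x @\<^sub>v (y @\<^sub>v z)"
  by (rule eq_vecI) auto

lemma orth_sum_assoc:
  assumes A: "A \<in> carrier_mat m m" and B: "B \<in> carrier_mat n n" and C: "C \<in> carrier_mat k k"
  shows "(A \<bottom>\<^sub>q B) \<bottom>\<^sub>q C \<simeq>\<^sub>q A \<bottom>\<^sub>q (B \<bottom>\<^sub>q C)"
proof (rule isometricI[of _ "m + n + k", OF _ _ lin_id])
  fix x :: "'a vec" assume "x \<in> carrier_vec (m + n + k)"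
  then obtain y z w where x: "y \<in> carrier_vec m" "z \<in> carrier_vec n" "w \<in> carrier_vec k" "x = (y @\<^sub>v z) @\<^sub>v w"
    by (metis append_split)
  have "qeval ((A \<bottom>\<^sub>q B) \<bottom>\<^sub>q C) x = qeval A y + qeval B z + qeval C w"
    using x A B C by (simp add: qeval_orth_sum[of _ m _ n] qeval_orth_sum[of _ "m + n" _ k])
  moreover have "qeval (A \<bottom>\<^sub>q (B \<bottom>\<^sub>q C)) x = qeval A y + (qeval B z + qeval C w)"
    using x A B C by (simp add: append_vec_assoc qeval_orth_sum[of _ m _ "n + k"] qeval_orth_sum[of _ n _ k])
  ultimately show "qeval (A \<bottom>\<^sub>q (B \<bottom>\<^sub>q C)) x = qeval ((A \<bottom>\<^sub>q B) \<bottom>\<^sub>q C) x" by (simp add: add.assoc)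
next
  show "A \<bottom>\<^sub>q (B \<bottom>\<^sub>q C) \<in> carrier_mat (m + n + k) (m + n + k)"
    using orth_sum_carrier[OF A orth_sum_carrier[OF B C]] by (simp add: add.assoc)
qed (use A B C in auto)

lemma orth_sum_commute:
  assumes A: "A \<in> carrier_mat m m" and B: "B \<in> carrier_mat n n"
  shows "A \<bottom>\<^sub>q B \<simeq>\<^sub>q B \<bottom>\<^sub>q A"
proof (rule isometricI[of _ "m + n"])
  show "lin (m + n) (m + n) (\<lambda>x. vec_last x n @\<^sub>v vec_first x m)"
    using lin_append[OF lin_last[of m n] lin_first[of m n]] by (simp add: add.commute)
  fix x :: "'a vec" assume "x \<in> carrier_vec (m + n)"
  then obtain y z where x: "y \<in> carrier_vec m" "z \<in> carrier_vec n" "x = y @\<^sub>v z" by (rule append_split)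
  then show "qeval (B \<bottom>\<^sub>q A) (vec_last x n @\<^sub>v vec_first x m) = qeval (A \<bottom>\<^sub>q B) x"
    using A B by (simp add: vec_first_append vec_last_append qeval_orth_sum[of _ m _ n] qeval_orth_sum[of _ n _ m])
  assume "vec_last x n @\<^sub>v vec_first x m = 0\<^sub>v (m + n)"
  then show "x = 0\<^sub>v (m + n)" using x append_eq_zero[of z n y m]
    by (simp add: vec_first_append vec_last_append add.commute append_zero)
next
  show "B \<bottom>\<^sub>q A \<in> carrier_mat (m + n) (m + n)" using A B by (metis orth_sum_carrier add.commute)
qed (use A B in auto)

lemma orth_sum_zero_right: "A \<in> carrier_mat m m \<Longrightarrow> A \<bottom>\<^sub>q 0\<^sub>m 0 0 = A"
  unfolding orth_sum_def by (intro eq_matI) auto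

lemma orth_sum_zero_left: "A \<in> carrier_mat m m \<Longrightarrow> 0\<^sub>m 0 0 \<bottom>\<^sub>q A = A"
  unfolding orth_sum_def by (intro eq_matI) auto

lemma binary_form_carrier [simp]: "binary_form a b \<in> carrier_mat 2 2"
  unfolding binary_form_def by (intro carrier_matI) (auto simp: mat_of_rows_list_def)

lemma quadratic_form_binary: "quadratic_form (binary_form a b)"
  unfolding quadratic_form_def binary_form_def square_mat.simps upper_triangular_def
  by (auto simp: mat_of_rows_list_def less_Suc_eq numeral_2_eq_2)

lemma qeval_binary: "x \<in> carrier_vec 2 \<Longrightarrow>
  qeval (binary_form a b) x = a * (x $ 0)\<^sup>2 + x $ 0 * x $ 1 + b * (x $ 1)\<^sup>2"
  by (auto simp: qeval_def binary_form_def mat_of_rows_list_def scalar_prod_def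
      atLeast0_lessThan_Suc numeral_2_eq_2 algebra_simps)

lemma polar_binary: "x \<in> carrier_vec 2 \<Longrightarrow> y \<in> carrier_vec 2 \<Longrightarrow>
  polar (binary_form a b) x y = 2 * a * x $ 0 * y $ 0 + x $ 0 * y $ 1 + x $ 1 * y $ 0 + 2 * b * x $ 1 * y $ 1"
  by (simp add: polar_def qeval_binary power2_eq_square algebra_simps)

lemma nonsingular_hyperbolic_plane: "nonsingular (binary_form 0 0)"
proof (rule nonsingularI)
  fix x :: "'a vec" assume x: "x \<in> carrier_vec 2" and 0: "\<And>y. y \<in> carrier_vec 2 \<Longrightarrow> polar (binary_form 0 0) x y = 0"
  have "x $ i = 0" if "i < 2" for i
    using 0[of "unit_vec 2 (1 - i)"] x that by (auto simp: polar_binary less_Suc_eq numeral_2_eq_2)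
  then show "x = 0\<^sub>v 2" using x by (intro eq_vecI) auto
qed simp

lemma hyperbolic_carrier [simp]: "hyperbolic n \<in> carrier_mat (2 * n) (2 * n)"
proof (induction n)
  case (Suc n)
  then show ?case using orth_sum_carrier[OF binary_form_carrier Suc, of 0 0] by simp
qed simp

lemma quadratic_form_hyperbolic: "quadratic_form (hyperbolic n)"
proof (induction n)
  case 0
  show ?case by (auto simp: quadratic_form_def square_mat.simps)
next
  case (Suc n)
  then show ?case using quadratic_form_orth_sum[OF quadratic_form_binary Suc] by simp
qed

lemma nonsingular_hyperbolic: "nonsingular (hyperbolic n)"
proof (induction n)
  case 0
  show ?case by (rule nonsingularI[of _ 0]) auto
next
  case (Suc n)
  then show ?case
    using nonsingular_orth_sum[OF binary_form_carrier nonsingular_hyperbolic_plane hyperbolic_carrier Suc] by simp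
qed

lemma qdim_orth_sum [simp]: "qdim (A \<bottom>\<^sub>q B) = qdim A + qdim B"
  by (simp add: qdim_def orth_sum_def)

lemma qdim_hyperbolic [simp]: "qdim (hyperbolic n) = 2 * n"
  using hyperbolic_carrier by (metis carrier_matD(1) qdim_def)

lemma isometric_qdim: "A \<simeq>\<^sub>q B \<Longrightarrow> qdim A = qdim B"
  by (simp add: isometric_def)

text \<open>Requiring both matrices to be upper triangular supplies the carriers, so that symmetry,
  transitivity and congruence hold without side conditions and isometries can be chained by
  calculation.\<close>

definition qiso :: "'a::field mat \<Rightarrow> 'a mat \<Rightarrow> bool" (infix \<open>\<cong>\<^sub>q\<close> 50) where
  "A \<cong>\<^sub>q B \<longleftrightarrow> quadratic_form A \<and> quadratic_form B \<and> A \<simeq>\<^sub>q B"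

lemma qiso_refl: "quadratic_form A \<Longrightarrow> A \<cong>\<^sub>q A"
  unfolding qiso_def using isometric_refl[OF quadratic_form_carrier] by blast

lemma qiso_sym: "A \<cong>\<^sub>q B \<Longrightarrow> B \<cong>\<^sub>q A"
  unfolding qiso_def using isometric_sym quadratic_form_carrier isometric_qdim by metis

lemma qiso_trans [trans]: "A \<cong>\<^sub>q B \<Longrightarrow> B \<cong>\<^sub>q C \<Longrightarrow> A \<cong>\<^sub>q C"
  unfolding qiso_def using isometric_trans quadratic_form_carrier isometric_qdim by metis

lemma qiso_cong:
  assumes "A \<cong>\<^sub>q A'" "B \<cong>\<^sub>q B'"
  shows "A \<bottom>\<^sub>q B \<cong>\<^sub>q A' \<bottom>\<^sub>q B'"
proof -
  have "qdim A = qdim A'" "qdim B = qdim B'" using assms isometric_qdim by (auto simp: qiso_def)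
  then have "A \<bottom>\<^sub>q B \<simeq>\<^sub>q A' \<bottom>\<^sub>q B'"
    using assms orth_sum_cong[of A A' B B' "qdim A" "qdim B"] quadratic_form_carrier[of A] quadratic_form_carrier[of A']
      quadratic_form_carrier[of B] quadratic_form_carrier[of B'] by (simp add: qiso_def)
  then show ?thesis using assms by (simp add: qiso_def quadratic_form_orth_sum)
qed

lemma qiso_commute: "quadratic_form A \<Longrightarrow> quadratic_form B \<Longrightarrow> A \<bottom>\<^sub>q B \<cong>\<^sub>q B \<bottom>\<^sub>q A"
  by (simp add: qiso_def quadratic_form_orth_sum orth_sum_commute[OF quadratic_form_carrier quadratic_form_carrier])

lemma qiso_assoc: "quadratic_form A \<Longrightarrow> quadratic_form B \<Longrightarrow> quadratic_form C \<Longrightarrow>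
    (A \<bottom>\<^sub>q B) \<bottom>\<^sub>q C \<cong>\<^sub>q A \<bottom>\<^sub>q (B \<bottom>\<^sub>q C)"
  by (simp add: qiso_def quadratic_form_orth_sum
      orth_sum_assoc[OF quadratic_form_carrier quadratic_form_carrier quadratic_form_carrier])

lemmas qf_intros = quadratic_form_orth_sum quadratic_form_hyperbolic quadratic_form_binary

lemma hyperbolic_add: "hyperbolic m \<bottom>\<^sub>q hyperbolic n \<cong>\<^sub>q (hyperbolic (m + n) :: 'a::field mat)"
proof (induction m)
  case 0
  show ?case by (simp add: qiso_refl orth_sum_zero_left[OF hyperbolic_carrier] quadratic_form_hyperbolic)
next
  case (Suc m)
  let ?H = "binary_form 0 0 :: 'a mat"
  have 1: "(?H \<bottom>\<^sub>q hyperbolic m) \<bottom>\<^sub>q hyperbolic n \<cong>\<^sub>q ?H \<bottom>\<^sub>q (hyperbolic m \<bottom>\<^sub>q hyperbolic n)"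
    by (intro qiso_assoc qf_intros)
  have 2: "?H \<bottom>\<^sub>q (hyperbolic m \<bottom>\<^sub>q hyperbolic n) \<cong>\<^sub>q ?H \<bottom>\<^sub>q hyperbolic (m + n)"
    by (intro qiso_cong qiso_refl Suc qf_intros)
  show ?case using qiso_trans[OF 1 2] by simp
qed

section \<open>Hyperbolic planes split off along isotropic vectors\<close>

lemma lin_coord: "i < m \<Longrightarrow> v \<in> carrier_vec n \<Longrightarrow> lin m n (\<lambda>x. (x $ i) \<cdot>\<^sub>v v)"
  by (rule linI) (auto simp: add_smult_distrib_vec smult_smult_assoc)

text \<open>An isotropic \<open>v\<close> is completed to a hyperbolic pair, and \<open>B\<close> is
  the form on the orthogonal complement of the pair. The argument is independent of the
  characteristic.\<close>

lemma hyperbolic_splitting: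
  fixes A :: "'a::field mat"
  assumes A: "A \<in> carrier_mat n n" and ns: "nonsingular A"
    and v: "v \<in> carrier_vec n" "v \<noteq> 0\<^sub>v n" "qeval A v = 0"
  obtains r B where "n = 2 + r" "quadratic_form B" "B \<in> carrier_mat r r" "nonsingular B"
    "A \<simeq>\<^sub>q binary_form 0 0 \<bottom>\<^sub>q B"
proof -
  obtain w0 where w0: "w0 \<in> carrier_vec n" "polar A v w0 \<noteq> 0" using nonsingularD[OF ns A v(1,2)] .
  define w1 where "w1 = (1 / polar A v w0) \<cdot>\<^sub>v w0"
  have w1: "w1 \<in> carrier_vec n" "polar A v w1 = 1"
    using w0 v by (auto simp: w1_def polar_smult_right[OF A])
  \<comment> \<open>This multiple of \<open>v\<close> makes the partner isotropic: the value changes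
    by \<open>- qeval A w1 * polar A w1 v\<close>, and the polar value is 1.\<close>
  define w where "w = w1 + (- qeval A w1) \<cdot>\<^sub>v v"
  have w: "w \<in> carrier_vec n" using w1 v by (simp add: w_def)
  have vv: "polar A v v = 0" using polar_self[OF A v(1)] v(3) by simp
  have vw: "polar A v w = 1"
    unfolding w_def using polar_add_right[OF A v(1) w1(1), of "(- qeval A w1) \<cdot>\<^sub>v v"] v w1
      polar_smult_right[OF A v(1) v(1), of "- qeval A w1"] by (simp add: vv)
  have wv: "polar A w v = 1" using vw polar_commute[OF v(1) w] by simp
  have "polar A w1 v = 1" using w1 polar_commute[OF v(1) w1(1), of A] by simp
  then have qw: "qeval A w = 0"
    unfolding w_def qeval_add using qeval_smult_vec[OF A v(1), of "- qeval A w1"]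
      polar_smult_right[OF A w1(1) v(1), of "- qeval A w1"] v(3) by simp
  have ww: "polar A w w = 0" using polar_self[OF A w] qw by simp
  \<comment> \<open>Pairing with \<open>v\<close> and \<open>w\<close> reads off the coefficients
    \<open>t\<close> and \<open>s\<close>. This serves twice: for the independence of
    \<open>v\<close> and \<open>w\<close>, and later for the injectivity of
    \<open>f\<close>.\<close>
  have pair: "s = 0 \<and> t = 0" if "s \<cdot>\<^sub>v v + (t \<cdot>\<^sub>v w + z) = 0\<^sub>v n" "z \<in> carrier_vec n" "polar A v z = 0" "polar A w z = 0" for s t z
  proof -
    have "polar A u (s \<cdot>\<^sub>v v + (t \<cdot>\<^sub>v w + z)) = s * polar A u v + t * polar A u w + polar A u z" if "u \<in> carrier_vec n" for u
      using polar_add_right[OF A that, of "s \<cdot>\<^sub>v v" "t \<cdot>\<^sub>v w + z"] polar_add_right[OF A that, of "t \<cdot>\<^sub>v w" z]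
        polar_smult_right[OF A that v(1), of s] polar_smult_right[OF A that w, of t] v w \<open>z \<in> carrier_vec n\<close> by simp
    from this[OF v(1)] this[OF w] show ?thesis
      using that vv vw wv ww polar_zero_right[OF A v(1)] polar_zero_right[OF A w] by simp
  qed
  have "2 \<le> n"
  proof (rule ccontr)
    assume "\<not> 2 \<le> n"
    then have n2: "n < 2" by simp
    have l: "lin 2 n (\<lambda>x. (x $ 0) \<cdot>\<^sub>v v + ((x $ 1) \<cdot>\<^sub>v w + 0\<^sub>v n))"
      using lin_sum[OF lin_coord[of 0 2, OF _ v(1)] lin_coord[of 1 2, OF _ w]] w by simp
    obtain x where x: "x \<in> carrier_vec 2" "x \<noteq> 0\<^sub>v 2" "(x $ 0) \<cdot>\<^sub>v v + ((x $ 1) \<cdot>\<^sub>v w + 0\<^sub>v n) = 0\<^sub>v n"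
      by (rule lin_kernel[OF l n2])
    have "x $ 0 = 0 \<and> x $ 1 = 0"
      by (rule pair[OF x(3)]) (auto simp: polar_zero_right[OF A] v w)
    then have "x = 0\<^sub>v 2" using x(1) by (intro eq_vecI) (auto simp: less_2_cases_iff)
    then show False using x by simp
  qed
  then obtain r where r: "n = 2 + r" by (metis le_Suc_ex)
  then have n: "n = Suc (Suc r)" by simp
  \<comment> \<open>The complement of \<open>v\<close> and \<open>w\<close> is reached by two
    successive hyperplane cuts, which leave exactly \<open>n - 2\<close> coordinates.\<close>
  obtain T1 where T1: "lin (Suc r) n T1" "\<And>y. y \<in> carrier_vec (Suc r) \<Longrightarrow> T1 y = 0\<^sub>v n \<Longrightarrow> y = 0\<^sub>v (Suc r)"
    "\<And>y. y \<in> carrier_vec (Suc r) \<Longrightarrow> polar A v (T1 y) = 0"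
    using lin_functional_kernel[of "Suc r" "polar A v"] lin_polar[OF A v(1)] unfolding n by blast
  have l2: "lin (Suc r) 1 (\<lambda>y. vec 1 (\<lambda>_. polar A w (T1 y)))"
    by (rule lin_comp[OF T1(1) lin_polar[OF A w]])
  obtain T2 where T2: "lin r (Suc r) T2" "\<And>y. y \<in> carrier_vec r \<Longrightarrow> T2 y = 0\<^sub>v (Suc r) \<Longrightarrow> y = 0\<^sub>v r"
    "\<And>y. y \<in> carrier_vec r \<Longrightarrow> polar A w (T1 (T2 y)) = 0"
    using lin_functional_kernel[OF l2] by blast
  define T where "T y = T1 (T2 y)" for y
  have T: "lin r n T" unfolding T_def by (rule lin_comp[OF T2(1) T1(1)])
  have Tinj: "y = 0\<^sub>v r" if "y \<in> carrier_vec r" "T y = 0\<^sub>v n" for y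
    using that T1(2)[OF lin_carrier[OF T2(1)]] T2(2) by (simp add: T_def)
  have vT: "polar A v (T y) = 0" and wT: "polar A w (T y) = 0" if "y \<in> carrier_vec r" for y
    using T1(3)[OF lin_carrier[OF T2(1) that]] T2(3)[OF that] by (simp_all add: T_def)
  obtain B where B: "quadratic_form B" "B \<in> carrier_mat r r" "\<And>x. x \<in> carrier_vec r \<Longrightarrow> qeval B x = qeval A (T x)"
    using pullback_form[OF T A] by metis
  have HB: "binary_form 0 0 \<bottom>\<^sub>q B \<in> carrier_mat n n"
    unfolding r by (rule orth_sum_carrier[OF binary_form_carrier B(2)])
  define f where "f x = (x $ 0) \<cdot>\<^sub>v v + ((x $ 1) \<cdot>\<^sub>v w + T (vec_last x r))" for x
  have f: "lin n n f"
    unfolding f_def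
    by (intro lin_sum lin_coord v w lin_comp[OF _ T]) (use n lin_last[of 2 r] in auto)
  have iso: "binary_form 0 0 \<bottom>\<^sub>q B \<simeq>\<^sub>q A"
  proof (rule isometricI[OF HB A f])
    fix x :: "'a vec" assume xn: "x \<in> carrier_vec n"
    then obtain y z where x: "y \<in> carrier_vec 2" "z \<in> carrier_vec r" "x = y @\<^sub>v z"
      unfolding r by (rule append_split)
    have Tz: "T z \<in> carrier_vec n" by (rule lin_carrier[OF T x(2)])
    have fx: "f x = (y $ 0) \<cdot>\<^sub>v v + ((y $ 1) \<cdot>\<^sub>v w + T z)"
      using x by (simp add: f_def vec_last_append)
    have "qeval A (f x) = y $ 0 * y $ 1 + qeval A (T z)"
      unfolding fx qeval_add
      using polar_add_right[OF A, of "(y $ 0) \<cdot>\<^sub>v v" "(y $ 1) \<cdot>\<^sub>v w" "T z"]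
        polar_smult_left[OF A Tz v(1)] polar_smult_left[OF A Tz w]
        polar_smult_left[OF A _ v(1), of "(y $ 1) \<cdot>\<^sub>v w"] polar_smult_right[OF A v(1) w]
        v w Tz vT[OF x(2)] wT[OF x(2)] vw qw
      by (simp add: qeval_smult_vec[OF A v(1)] qeval_smult_vec[OF A w])
    then show "qeval A (f x) = qeval (binary_form 0 0 \<bottom>\<^sub>q B) x"
      using x B by (simp add: qeval_orth_sum[of _ 2 _ r] qeval_binary)
    assume "f x = 0\<^sub>v n"
    then have yz: "y $ 0 = 0 \<and> y $ 1 = 0" using pair[of "y $ 0" "y $ 1" "T z"] fx vT[OF x(2)] wT[OF x(2)] Tz by simp
    then have "T z = 0\<^sub>v n" using \<open>f x = 0\<^sub>v n\<close> fx Tz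
      by (simp add: smult_zero_vec[OF v(1)] smult_zero_vec[OF w])
    then have "z = 0\<^sub>v r" using Tinj x(2) by simp
    moreover have "y = 0\<^sub>v 2" using yz x(1) by (intro eq_vecI) (auto simp: less_2_cases_iff)
    ultimately show "x = 0\<^sub>v n" using x(3) append_zero[of 2 r] unfolding r by simp
  qed
  have iso': "A \<simeq>\<^sub>q binary_form 0 0 \<bottom>\<^sub>q B" by (rule isometric_sym[OF iso HB A])
  have nsHB: "nonsingular (binary_form 0 0 \<bottom>\<^sub>q B)" by (rule nonsingular_isometric[OF iso' A HB ns])
  have "nonsingular B"
  proof (rule nonsingularI[OF B(2)])
    fix x assume x: "x \<in> carrier_vec r" and 0: "\<And>y. y \<in> carrier_vec r \<Longrightarrow> polar B x y = 0"
    have "0\<^sub>v 2 @\<^sub>v x = 0\<^sub>v (2 + r)"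
    proof (rule nonsingular_zeroD[OF nsHB])
      fix y :: "'a vec" assume "y \<in> carrier_vec (2 + r)"
      then obtain y1 y2 where "y1 \<in> carrier_vec 2" "y2 \<in> carrier_vec r" "y = y1 @\<^sub>v y2" by (rule append_split)
      then show "polar (binary_form 0 0 \<bottom>\<^sub>q B) (0\<^sub>v 2 @\<^sub>v x) y = 0"
        using x B 0 by (simp add: polar_orth_sum[of _ 2 _ r] polar_binary)
    next
      show "binary_form 0 0 \<bottom>\<^sub>q B \<in> carrier_mat (2 + r) (2 + r)" using HB r by simp
      show "0\<^sub>v 2 @\<^sub>v x \<in> carrier_vec (2 + r)" by (rule append_carrier_vec[OF zero_carrier_vec x])
    qed
    then show "x = 0\<^sub>v r" using append_eq_zero[of "0\<^sub>v 2" 2 x r] x by simp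
  qed
  then show ?thesis using that[OF r B(1,2)] iso' by blast
qed

section \<open>Totally isotropic subspaces and cancellation\<close>

text \<open>The subspace is given by an injective parametrization. The form itself has to vanish on
  it and not only the polar form, which is a weaker condition in characteristic 2.\<close>

definition totally_isotropic :: "nat \<Rightarrow> 'a::field mat \<Rightarrow> bool" where
  "totally_isotropic k A \<longleftrightarrow> (\<exists>f. lin k (qdim A) f \<and>
     (\<forall>x\<in>carrier_vec k. f x = 0\<^sub>v (qdim A) \<longrightarrow> x = 0\<^sub>v k) \<and> (\<forall>x\<in>carrier_vec k. qeval A (f x) = 0))"

lemma totally_isotropicI:
  assumes "lin k (qdim A) f" "\<And>x. x \<in> carrier_vec k \<Longrightarrow> f x = 0\<^sub>v (qdim A) \<Longrightarrow> x = 0\<^sub>v k"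
    "\<And>x. x \<in> carrier_vec k \<Longrightarrow> qeval A (f x) = 0"
  shows "totally_isotropic k A"
  using assms unfolding totally_isotropic_def by blast

lemma totally_isotropicE:
  assumes "totally_isotropic k A"
  obtains f where "lin k (qdim A) f" "\<And>x. x \<in> carrier_vec k \<Longrightarrow> f x = 0\<^sub>v (qdim A) \<Longrightarrow> x = 0\<^sub>v k"
    "\<And>x. x \<in> carrier_vec k \<Longrightarrow> qeval A (f x) = 0"
  using assms unfolding totally_isotropic_def by blast

lemma totally_isotropic_qiso:
  assumes qiso: "A \<cong>\<^sub>q B" and ti: "totally_isotropic k A"
  shows "totally_isotropic k B"
proof -
  have A: "quadratic_form A" and iso: "A \<simeq>\<^sub>q B" using qiso by (auto simp: qiso_def)
  obtain f where f: "lin k (qdim A) f" "\<And>x. x \<in> carrier_vec k \<Longrightarrow> f x = 0\<^sub>v (qdim A) \<Longrightarrow> x = 0\<^sub>v k"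
    "\<And>x. x \<in> carrier_vec k \<Longrightarrow> qeval A (f x) = 0" using totally_isotropicE[OF ti] by metis
  obtain g h where g: "lin (qdim A) (qdim A) g" "lin (qdim A) (qdim A) h"
    "\<And>x. x \<in> carrier_vec (qdim A) \<Longrightarrow> qeval B (g x) = qeval A x"
    "\<And>x. x \<in> carrier_vec (qdim A) \<Longrightarrow> h (g x) = x"
    using isometricE[OF iso quadratic_form_carrier[OF A]] by metis
  show ?thesis
    unfolding totally_isotropic_def isometric_qdim[OF iso, symmetric]
  proof (intro exI conjI ballI impI)
    show "lin k (qdim A) (\<lambda>x. g (f x))" by (rule lin_comp[OF f(1) g(1)])
    fix x :: "'a vec" assume x: "x \<in> carrier_vec k"
    note c = lin_carrier[OF f(1) x]
    show "qeval B (g (f x)) = 0" using g(3)[OF c] f(3)[OF x] by simp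
    assume "g (f x) = 0\<^sub>v (qdim A)"
    then have "f x = 0\<^sub>v (qdim A)" using g(4)[OF c] lin_zero[OF g(2)] by simp
    then show "x = 0\<^sub>v k" by (rule f(2)[OF x])
  qed
qed

lemma totally_isotropic_orth_sum:
  assumes A: "quadratic_form A" "totally_isotropic j A" and B: "quadratic_form B" "totally_isotropic k B"
  shows "totally_isotropic (j + k) (A \<bottom>\<^sub>q B)"
proof -
  obtain f where f: "lin j (qdim A) f" "\<And>x. x \<in> carrier_vec j \<Longrightarrow> f x = 0\<^sub>v (qdim A) \<Longrightarrow> x = 0\<^sub>v j"
    "\<And>x. x \<in> carrier_vec j \<Longrightarrow> qeval A (f x) = 0" using totally_isotropicE[OF A(2)] by metis
  obtain g where g: "lin k (qdim B) g" "\<And>x. x \<in> carrier_vec k \<Longrightarrow> g x = 0\<^sub>v (qdim B) \<Longrightarrow> x = 0\<^sub>v k"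
    "\<And>x. x \<in> carrier_vec k \<Longrightarrow> qeval B (g x) = 0" using totally_isotropicE[OF B(2)] by metis
  show ?thesis
    unfolding totally_isotropic_def qdim_orth_sum
  proof (intro exI conjI ballI impI)
    show "lin (j + k) (qdim A + qdim B) (\<lambda>x. f (vec_first x j) @\<^sub>v g (vec_last x k))"
      by (intro lin_append lin_comp[OF lin_first f(1)] lin_comp[OF lin_last g(1)])
    fix x :: "'a vec" assume "x \<in> carrier_vec (j + k)"
    then obtain y z where x: "y \<in> carrier_vec j" "z \<in> carrier_vec k" "x = y @\<^sub>v z" by (rule append_split)
    note c = lin_carrier[OF f(1) x(1)] lin_carrier[OF g(1) x(2)]
    show "qeval (A \<bottom>\<^sub>q B) (f (vec_first x j) @\<^sub>v g (vec_last x k)) = 0"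
      using x f(3)[OF x(1)] g(3)[OF x(2)]
        qeval_orth_sum[OF quadratic_form_carrier[OF A(1)] quadratic_form_carrier[OF B(1)] c]
      by (simp add: vec_first_append vec_last_append)
    assume "f (vec_first x j) @\<^sub>v g (vec_last x k) = 0\<^sub>v (qdim A + qdim B)"
    then have "y = 0\<^sub>v j" "z = 0\<^sub>v k"
      using append_eq_zero[OF c] x f(2) g(2) by (simp_all add: vec_first_append vec_last_append)
    then show "x = 0\<^sub>v (j + k)" using x append_zero by simp
  qed
qed

lemma totally_isotropic_hyperbolic_plane: "totally_isotropic (Suc 0) (binary_form 0 0)"
proof -
  have d: "qdim (binary_form 0 0 :: 'a mat) = 2" using binary_form_carrier[of 0 0] by (metis carrier_matD(1) qdim_def)
  show ?thesis
    unfolding totally_isotropic_def d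
  proof (intro exI conjI ballI impI)
    show "lin (Suc 0) 2 (\<lambda>x. (x $ 0) \<cdot>\<^sub>v unit_vec 2 0)" by (rule lin_coord) auto
    fix x :: "'a vec" assume x: "x \<in> carrier_vec (Suc 0)"
    show "qeval (binary_form 0 0) ((x $ 0) \<cdot>\<^sub>v unit_vec 2 0) = 0" by (simp add: qeval_binary)
    assume "(x $ 0) \<cdot>\<^sub>v unit_vec 2 0 = 0\<^sub>v 2"
    then have "((x $ 0) \<cdot>\<^sub>v unit_vec 2 0) $ 0 = 0\<^sub>v 2 $ 0" by (rule arg_cong)
    then show "x = 0\<^sub>v (Suc 0)" using x by (intro eq_vecI) auto
  qed
qed

lemma totally_isotropic_hyperbolic: "totally_isotropic n (hyperbolic n)"
proof (induction n)
  case 0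
  show ?case by (rule totally_isotropicI[of _ _ "\<lambda>x. x"]) (auto simp: lin_id qdim_def qeval_def scalar_prod_def)
next
  case (Suc n)
  then show ?case
    using totally_isotropic_orth_sum[OF quadratic_form_binary totally_isotropic_hyperbolic_plane quadratic_form_hyperbolic]
    by simp
qed

text \<open>Intersect the subspace \<open>U\<close> with \<open>p _ $ 1 = 0\<close> and project to
  \<open>A\<close>; values are kept because the plane contributes a product with a zero factor. If
  this projection is not injective, \<open>U\<close> contains a nonzero multiple of the first basis
  vector of the plane. As \<open>U\<close> is totally isotropic, pairing with that vector forces
  \<open>p _ $ 1 = 0\<close> on all of \<open>U\<close>, and then the cut \<open>p _ $ 0 = 0\<close>
  has an injective projection.\<close>

lemma totally_isotropic_cancel_plane:
  fixes A :: "'a::field mat"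
  assumes A: "quadratic_form A" and ti: "totally_isotropic (Suc k) (binary_form 0 0 \<bottom>\<^sub>q A)"
  shows "totally_isotropic k A"
proof -
  let ?H = "binary_form 0 0 :: 'a mat"
  define n where "n = qdim A"
  have Ac: "A \<in> carrier_mat n n" using quadratic_form_carrier[OF A] by (simp add: n_def)
  have d: "qdim (?H \<bottom>\<^sub>q A) = 2 + n"
    using binary_form_carrier[of 0 0] by (metis carrier_matD(1) qdim_def qdim_orth_sum n_def)
  obtain f where f: "lin (Suc k) (2 + n) f" "\<And>x. x \<in> carrier_vec (Suc k) \<Longrightarrow> f x = 0\<^sub>v (2 + n) \<Longrightarrow> x = 0\<^sub>v (Suc k)"
    "\<And>x. x \<in> carrier_vec (Suc k) \<Longrightarrow> qeval (?H \<bottom>\<^sub>q A) (f x) = 0"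
    using totally_isotropicE[OF ti] unfolding d by metis
  define p where "p x = vec_first (f x) 2" for x
  define y where "y x = vec_last (f x) n" for x
  have p: "lin (Suc k) 2 p" and y: "lin (Suc k) n y"
    unfolding p_def y_def by (rule lin_comp[OF f(1) lin_first], rule lin_comp[OF f(1) lin_last])
  have fx: "f x = p x @\<^sub>v y x" if "x \<in> carrier_vec (Suc k)" for x
    using lin_carrier[OF f(1) that] by (simp add: p_def y_def)
  have q: "p x $ 0 * p x $ 1 + qeval A (y x) = 0" if x: "x \<in> carrier_vec (Suc k)" for x
    using f(3)[OF x] qeval_orth_sum[OF binary_form_carrier Ac lin_carrier[OF p x] lin_carrier[OF y x], of 0 0]
      qeval_binary[OF lin_carrier[OF p x], of 0 0] by (simp add: fx[OF x])
  have pol: "p x $ 0 * p z $ 1 + p x $ 1 * p z $ 0 + polar A (y x) (y z) = 0"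
    if x: "x \<in> carrier_vec (Suc k)" and z: "z \<in> carrier_vec (Suc k)" for x z
  proof -
    have xz: "x + z \<in> carrier_vec (Suc k)" using x z by simp
    have "polar (?H \<bottom>\<^sub>q A) (f x) (f z) = 0"
      using f(3)[OF x] f(3)[OF z] f(3)[OF xz] by (simp add: polar_def flip: lin_add[OF f(1) x z])
    then show ?thesis
      using polar_orth_sum[OF binary_form_carrier Ac lin_carrier[OF p x] lin_carrier[OF y x] lin_carrier[OF p z] lin_carrier[OF y z], of 0 0]
        polar_binary[OF lin_carrier[OF p x] lin_carrier[OF p z], of 0 0] by (simp add: fx x z)
  qed
  have coord: "lin (Suc k) 1 (\<lambda>x. vec 1 (\<lambda>_. p x $ i))" if i: "i < 2" for i
  proof (rule linI)
    fix x z :: "'a vec" and c assume x: "x \<in> carrier_vec (Suc k)" and z: "z \<in> carrier_vec (Suc k)"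
    note pc = lin_carrier[OF p x] lin_carrier[OF p z]
    show "vec 1 (\<lambda>_. p (x + z) $ i) = vec 1 (\<lambda>_. p x $ i) + vec 1 (\<lambda>_. p z $ i)"
      unfolding lin_add[OF p x z] using pc i by (intro eq_vecI) auto
    show "vec 1 (\<lambda>_. p (c \<cdot>\<^sub>v x) $ i) = c \<cdot>\<^sub>v vec 1 (\<lambda>_. p x $ i)"
      unfolding lin_smult[OF p x] using pc i by (intro eq_vecI) auto
  qed simp
  have zero: "x = 0\<^sub>v (Suc k)" if x: "x \<in> carrier_vec (Suc k)" and "p x $ 0 = 0" "p x $ 1 = 0" "y x = 0\<^sub>v n" for x
  proof -
    have "p x = 0\<^sub>v 2" using lin_carrier[OF p x] that by (intro eq_vecI) (auto simp: less_2_cases_iff)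
    then show ?thesis using f(2)[OF x] fx[OF x] that(4) append_zero[of 2 n] by metis
  qed
  obtain T where T: "lin k (Suc k) T" "\<And>x. x \<in> carrier_vec k \<Longrightarrow> T x = 0\<^sub>v (Suc k) \<Longrightarrow> x = 0\<^sub>v k"
    "\<And>x. x \<in> carrier_vec k \<Longrightarrow> p (T x) $ 1 = 0"
    using lin_functional_kernel[OF coord[of 1]] by auto
  note Tc = lin_carrier[OF T(1)]
  show ?thesis
  proof (cases "\<forall>x\<in>carrier_vec k. y (T x) = 0\<^sub>v n \<longrightarrow> x = 0\<^sub>v k")
    case True
    show ?thesis
    proof (rule totally_isotropicI, unfold n_def[symmetric])
      show "lin k n (\<lambda>x. y (T x))" by (rule lin_comp[OF T(1) y])
      show "qeval A (y (T x)) = 0" if "x \<in> carrier_vec k" for x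
        using q[OF Tc[OF that]] T(3)[OF that] by simp
    qed (use True in blast)
  next
    case False
    then obtain z where z: "z \<in> carrier_vec k" "y (T z) = 0\<^sub>v n" "z \<noteq> 0\<^sub>v k" by blast
    have s: "p (T z) $ 0 \<noteq> 0"
      using zero[OF Tc[OF z(1)]] T(2)[OF z(1)] T(3)[OF z(1)] z by blast
    have p1: "p x $ 1 = 0" if x: "x \<in> carrier_vec (Suc k)" for x
      using pol[OF x Tc[OF z(1)]] s z(2) T(3)[OF z(1)] polar_zero_right[OF Ac lin_carrier[OF y x]] by simp
    obtain S where S: "lin k (Suc k) S" "\<And>x. x \<in> carrier_vec k \<Longrightarrow> S x = 0\<^sub>v (Suc k) \<Longrightarrow> x = 0\<^sub>v k"
      "\<And>x. x \<in> carrier_vec k \<Longrightarrow> p (S x) $ 0 = 0"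
      using lin_functional_kernel[OF coord[of 0]] by auto
    note Sc = lin_carrier[OF S(1)]
    show ?thesis
    proof (rule totally_isotropicI, unfold n_def[symmetric])
      show "lin k n (\<lambda>x. y (S x))" by (rule lin_comp[OF S(1) y])
      fix x :: "'a vec" assume x: "x \<in> carrier_vec k"
      show "qeval A (y (S x)) = 0" using q[OF Sc[OF x]] S(3)[OF x] by simp
      assume "y (S x) = 0\<^sub>v n"
      then show "x = 0\<^sub>v k" using zero[OF Sc[OF x] S(3)[OF x] p1[OF Sc[OF x]]] S(2)[OF x] by simp
    qed
  qed
qed

lemma qiso_right_commute:
  assumes "quadratic_form A" "quadratic_form B" "quadratic_form C"
  shows "(A \<bottom>\<^sub>q B) \<bottom>\<^sub>q C \<cong>\<^sub>q (A \<bottom>\<^sub>q C) \<bottom>\<^sub>q B"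
proof -
  have "(A \<bottom>\<^sub>q B) \<bottom>\<^sub>q C \<cong>\<^sub>q A \<bottom>\<^sub>q (B \<bottom>\<^sub>q C)" by (intro qiso_assoc assms)
  also have "\<dots> \<cong>\<^sub>q A \<bottom>\<^sub>q (C \<bottom>\<^sub>q B)" by (rule qiso_cong[OF qiso_refl qiso_commute]; fact)
  also have "\<dots> \<cong>\<^sub>q (A \<bottom>\<^sub>q C) \<bottom>\<^sub>q B" by (rule qiso_sym[OF qiso_assoc]; fact)
  finally show ?thesis .
qed

lemma qiso_interchange:
  assumes "quadratic_form A" "quadratic_form B" "quadratic_form C" "quadratic_form D"
  shows "(A \<bottom>\<^sub>q B) \<bottom>\<^sub>q (C \<bottom>\<^sub>q D) \<cong>\<^sub>q (A \<bottom>\<^sub>q C) \<bottom>\<^sub>q (B \<bottom>\<^sub>q D)"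
proof -
  have "(A \<bottom>\<^sub>q B) \<bottom>\<^sub>q (C \<bottom>\<^sub>q D) \<cong>\<^sub>q ((A \<bottom>\<^sub>q B) \<bottom>\<^sub>q C) \<bottom>\<^sub>q D"
    by (rule qiso_sym[OF qiso_assoc]) (intro assms quadratic_form_orth_sum)+
  also have "\<dots> \<cong>\<^sub>q ((A \<bottom>\<^sub>q C) \<bottom>\<^sub>q B) \<bottom>\<^sub>q D"
    by (rule qiso_cong[OF qiso_right_commute qiso_refl]; fact)
  also have "\<dots> \<cong>\<^sub>q (A \<bottom>\<^sub>q C) \<bottom>\<^sub>q (B \<bottom>\<^sub>q D)" by (rule qiso_assoc) (intro assms quadratic_form_orth_sum)+
  finally show ?thesis .
qed

lemma qiso_hyperbolic_add:
  assumes "quadratic_form A"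
  shows "(A \<bottom>\<^sub>q hyperbolic m) \<bottom>\<^sub>q hyperbolic n \<cong>\<^sub>q A \<bottom>\<^sub>q hyperbolic (m + n)"
proof -
  have "A \<bottom>\<^sub>q (hyperbolic m \<bottom>\<^sub>q hyperbolic n) \<cong>\<^sub>q A \<bottom>\<^sub>q hyperbolic (m + n)"
    by (intro qiso_cong qiso_refl hyperbolic_add assms)
  with qiso_assoc[OF assms quadratic_form_hyperbolic quadratic_form_hyperbolic] show ?thesis
    by (rule qiso_trans)
qed

text \<open>The plane is split off along a vector of the subspace. Cancelling it costs one dimension
  of the subspace, so the step can be iterated as often as that dimension allows.\<close>

lemma totally_isotropic_splitting:
  fixes A :: "'a::field mat"
  assumes A: "quadratic_form A" "nonsingular A" and ti: "totally_isotropic (Suc k) A"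
  obtains B where "quadratic_form B" "nonsingular B" "qdim A = 2 + qdim B"
    "A \<cong>\<^sub>q binary_form 0 0 \<bottom>\<^sub>q B" "totally_isotropic k B"
proof -
  obtain f where f: "lin (Suc k) (qdim A) f"
    "\<And>x. x \<in> carrier_vec (Suc k) \<Longrightarrow> f x = 0\<^sub>v (qdim A) \<Longrightarrow> x = 0\<^sub>v (Suc k)"
    "\<And>x. x \<in> carrier_vec (Suc k) \<Longrightarrow> qeval A (f x) = 0" using totally_isotropicE[OF ti] by metis
  let ?u = "unit_vec (Suc k) 0 :: 'a vec"
  have u: "?u \<in> carrier_vec (Suc k)" by simp
  have "f ?u \<noteq> 0\<^sub>v (qdim A)" using f(2)[OF u] unit_vec_nonzero[of 0 "Suc k"] by auto
  then obtain r B where r: "qdim A = 2 + r" "quadratic_form B" "B \<in> carrier_mat r r" "nonsingular B"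
    "A \<simeq>\<^sub>q binary_form 0 0 \<bottom>\<^sub>q B"
    using hyperbolic_splitting[OF quadratic_form_carrier[OF A(1)] A(2), of "f ?u"] lin_carrier[OF f(1) u] f(3)[OF u]
    by metis
  have iso: "A \<cong>\<^sub>q binary_form 0 0 \<bottom>\<^sub>q B" using r A(1) by (simp add: qiso_def qf_intros)
  moreover have "totally_isotropic k B"
    by (rule totally_isotropic_cancel_plane[OF r(2) totally_isotropic_qiso[OF iso ti]])
  ultimately show ?thesis using that[of B] r by (simp add: qdim_def)
qed

lemma hyperbolic_if_lagrangian:
  assumes "quadratic_form A" "nonsingular A" "totally_isotropic n A" "qdim A = 2 * n"
  shows "A \<cong>\<^sub>q hyperbolic n"
  using assms
proof (induction n arbitrary: A)
  case 0
  then have "A \<in> carrier_mat 0 0" using quadratic_form_carrier[of A] by simp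
  then have "A = 0\<^sub>m 0 0" by (intro eq_matI) auto
  then show ?case using 0 by (simp add: qiso_refl)
next
  case (Suc n)
  obtain B where B: "quadratic_form B" "nonsingular B" "qdim A = 2 + qdim B"
    "A \<cong>\<^sub>q binary_form 0 0 \<bottom>\<^sub>q B" "totally_isotropic n B"
    using totally_isotropic_splitting[OF Suc.prems(1-3)] by blast
  then have "B \<cong>\<^sub>q hyperbolic n" using Suc.IH[OF B(1,2,5)] Suc.prems(4) by simp
  then have "binary_form 0 0 \<bottom>\<^sub>q B \<cong>\<^sub>q hyperbolic (Suc n)"
    using qiso_cong[OF qiso_refl[OF quadratic_form_binary]] by simp
  with B(4) show ?case by (rule qiso_trans)
qed

lemma totally_isotropic_cancel:
  assumes A: "quadratic_form A" and ti: "totally_isotropic (m + k) (A \<bottom>\<^sub>q hyperbolic m)"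
  shows "totally_isotropic k A"
proof -
  have 1: "totally_isotropic (m + k) (hyperbolic m \<bottom>\<^sub>q A)"
    by (rule totally_isotropic_qiso[OF qiso_commute ti]) (intro A qf_intros)+
  then show ?thesis
  proof (induction m)
    case 0
    then show ?case using orth_sum_zero_left[OF quadratic_form_carrier[OF A]] by simp
  next
    case (Suc m)
    have "totally_isotropic (Suc (m + k)) (binary_form 0 0 \<bottom>\<^sub>q (hyperbolic m \<bottom>\<^sub>q A))"
      by (rule totally_isotropic_qiso[OF qiso_assoc]) (use Suc.prems in \<open>auto simp: A qf_intros\<close>)
    then show ?case by (rule Suc.IH[OF totally_isotropic_cancel_plane, rotated]) (auto simp: A qf_intros)
  qed
qed

lemma anisotropicD: "anisotropic A \<Longrightarrow> x \<in> carrier_vec (qdim A) \<Longrightarrow> qeval A x = 0 \<Longrightarrow> x = 0\<^sub>v (qdim A)"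
  unfolding anisotropic_def by blast

lemma isotropic_splitting:
  assumes "quadratic_form A" "nonsingular A" "\<not> anisotropic A"
  obtains B where "quadratic_form B" "nonsingular B" "qdim A = 2 + qdim B" "A \<cong>\<^sub>q binary_form 0 0 \<bottom>\<^sub>q B"
proof -
  obtain v where v: "v \<in> carrier_vec (qdim A)" "v \<noteq> 0\<^sub>v (qdim A)" "qeval A v = 0"
    using assms(3) unfolding anisotropic_def by blast
  obtain r B where B: "qdim A = 2 + r" "quadratic_form B" "B \<in> carrier_mat r r" "nonsingular B"
    "A \<simeq>\<^sub>q binary_form 0 0 \<bottom>\<^sub>q B"
    using hyperbolic_splitting[OF quadratic_form_carrier[OF assms(1)] assms(2) v] .
  then show ?thesis using that[of B] assms(1) by (simp add: qdim_def qiso_def qf_intros)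
qed

section \<open>The Witt group\<close>

lemma even_nonsingularD:
  assumes "A \<in> even_nonsingular_forms"
  shows "quadratic_form A" "even (qdim A)" "nonsingular A" "A \<in> carrier_mat (qdim A) (qdim A)"
  using assms quadratic_form_carrier by (auto simp: even_nonsingular_forms_def)

lemma even_nonsingularI:
  "quadratic_form A \<Longrightarrow> even (qdim A) \<Longrightarrow> nonsingular A \<Longrightarrow> A \<in> even_nonsingular_forms"
  by (simp add: even_nonsingular_forms_def)

lemma even_nonsingular_orth_sum:
  assumes "A \<in> even_nonsingular_forms" "B \<in> even_nonsingular_forms"
  shows "A \<bottom>\<^sub>q B \<in> even_nonsingular_forms"
proof (rule even_nonsingularI)
  show "nonsingular (A \<bottom>\<^sub>q B)"
    using nonsingular_orth_sum even_nonsingularD(3,4)[OF assms(1)] even_nonsingularD(3,4)[OF assms(2)] by blast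
qed (use assms in \<open>auto simp: even_nonsingularD quadratic_form_orth_sum\<close>)

lemma even_nonsingular_hyperbolic: "hyperbolic n \<in> even_nonsingular_forms"
  by (rule even_nonsingularI[OF quadratic_form_hyperbolic _ nonsingular_hyperbolic]) simp

lemma even_nonsingular_qiso:
  assumes "A \<cong>\<^sub>q B" "A \<in> even_nonsingular_forms"
  shows "B \<in> even_nonsingular_forms"
proof (rule even_nonsingularI)
  have d: "qdim A = qdim B" using assms(1) isometric_qdim by (auto simp: qiso_def)
  show "even (qdim B)" using even_nonsingularD(2)[OF assms(2)] d by simp
  show "quadratic_form B" using assms(1) by (simp add: qiso_def)
  show "nonsingular B"
    using nonsingular_isometric[of A B "qdim A"] assms even_nonsingularD[OF assms(2)] d
      quadratic_form_carrier[of B] by (simp add: qiso_def)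
qed

lemma witt_relI:
  assumes "A \<in> even_nonsingular_forms" "B \<in> even_nonsingular_forms"
    "A \<bottom>\<^sub>q hyperbolic m \<cong>\<^sub>q B \<bottom>\<^sub>q hyperbolic n"
  shows "(A, B) \<in> witt_rel"
  using assms by (auto simp: witt_rel_def qiso_def)

lemma witt_relE:
  assumes "(A, B) \<in> witt_rel"
  obtains m n where "A \<in> even_nonsingular_forms" "B \<in> even_nonsingular_forms"
    "A \<bottom>\<^sub>q hyperbolic m \<cong>\<^sub>q B \<bottom>\<^sub>q hyperbolic n"
proof -
  obtain m n where *: "A \<in> even_nonsingular_forms" "B \<in> even_nonsingular_forms"
    "A \<bottom>\<^sub>q hyperbolic m \<simeq>\<^sub>q B \<bottom>\<^sub>q hyperbolic n" using assms by (auto simp: witt_rel_def)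
  then show ?thesis
    by (intro that[of m n]) (auto simp: qiso_def even_nonsingularD quadratic_form_orth_sum quadratic_form_hyperbolic)
qed

lemma witt_rel_qiso:
  assumes "A \<cong>\<^sub>q B" "A \<in> even_nonsingular_forms"
  shows "(A, B) \<in> witt_rel"
  by (rule witt_relI[OF assms(2) even_nonsingular_qiso[OF assms] qiso_cong[OF assms(1) qiso_refl[OF quadratic_form_hyperbolic]]])

lemma witt_rel_trans:
  assumes "(A, B) \<in> witt_rel" "(B, C) \<in> witt_rel"
  shows "(A, C) \<in> witt_rel"
proof -
  obtain m n where 1: "A \<in> even_nonsingular_forms" "B \<in> even_nonsingular_forms"
    "A \<bottom>\<^sub>q hyperbolic m \<cong>\<^sub>q B \<bottom>\<^sub>q hyperbolic n" using witt_relE[OF assms(1)] .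
  obtain k l where 2: "C \<in> even_nonsingular_forms"
    "B \<bottom>\<^sub>q hyperbolic k \<cong>\<^sub>q C \<bottom>\<^sub>q hyperbolic l" using witt_relE[OF assms(2)] by blast
  note qf = even_nonsingularD(1)[OF 1(1)] even_nonsingularD(1)[OF 1(2)] even_nonsingularD(1)[OF 2(1)]
  have "A \<bottom>\<^sub>q hyperbolic (m + k) \<cong>\<^sub>q (A \<bottom>\<^sub>q hyperbolic m) \<bottom>\<^sub>q hyperbolic k"
    by (rule qiso_sym[OF qiso_hyperbolic_add[OF qf(1)]])
  also have "\<dots> \<cong>\<^sub>q (B \<bottom>\<^sub>q hyperbolic n) \<bottom>\<^sub>q hyperbolic k"
    by (rule qiso_cong[OF 1(3) qiso_refl[OF quadratic_form_hyperbolic]])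
  also have "\<dots> \<cong>\<^sub>q (B \<bottom>\<^sub>q hyperbolic k) \<bottom>\<^sub>q hyperbolic n"
    by (rule qiso_right_commute[OF qf(2) quadratic_form_hyperbolic quadratic_form_hyperbolic])
  also have "\<dots> \<cong>\<^sub>q (C \<bottom>\<^sub>q hyperbolic l) \<bottom>\<^sub>q hyperbolic n"
    by (rule qiso_cong[OF 2(2) qiso_refl[OF quadratic_form_hyperbolic]])
  also have "\<dots> \<cong>\<^sub>q C \<bottom>\<^sub>q hyperbolic (l + n)" by (rule qiso_hyperbolic_add[OF qf(3)])
  finally show ?thesis by (rule witt_relI[OF 1(1) 2(1)])
qed

lemma witt_rel_sym: "(A, B) \<in> witt_rel \<Longrightarrow> (B, A) \<in> witt_rel"
  by (metis witt_relE witt_relI qiso_sym)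

lemma witt_rel_refl: "A \<in> even_nonsingular_forms \<Longrightarrow> (A, A) \<in> witt_rel"
  by (rule witt_rel_qiso[OF qiso_refl[OF even_nonsingularD(1)]])

lemma equiv_witt_rel: "equiv even_nonsingular_forms witt_rel"
proof (rule equivI)
  show "witt_rel \<subseteq> even_nonsingular_forms \<times> even_nonsingular_forms" by (auto simp: witt_rel_def)
  show "refl_on even_nonsingular_forms witt_rel"
    by (auto simp: refl_on_def witt_rel_refl)
  show "sym witt_rel" by (auto intro: symI witt_rel_sym)
  show "trans witt_rel" by (auto intro: transI witt_rel_trans)
qed

lemma witt_rel_cong:
  assumes "(A, A') \<in> witt_rel" "(B, B') \<in> witt_rel"
  shows "(A \<bottom>\<^sub>q B, A' \<bottom>\<^sub>q B') \<in> witt_rel"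
proof -
  obtain m n where 1: "A \<in> even_nonsingular_forms" "A' \<in> even_nonsingular_forms"
    "A \<bottom>\<^sub>q hyperbolic m \<cong>\<^sub>q A' \<bottom>\<^sub>q hyperbolic n" using witt_relE[OF assms(1)] .
  obtain k l where 2: "B \<in> even_nonsingular_forms" "B' \<in> even_nonsingular_forms"
    "B \<bottom>\<^sub>q hyperbolic k \<cong>\<^sub>q B' \<bottom>\<^sub>q hyperbolic l" using witt_relE[OF assms(2)] .
  note h = quadratic_form_hyperbolic
  have merge: "(X \<bottom>\<^sub>q Y) \<bottom>\<^sub>q hyperbolic (i + j) \<cong>\<^sub>q (X \<bottom>\<^sub>q hyperbolic i) \<bottom>\<^sub>q (Y \<bottom>\<^sub>q hyperbolic j)"
    if "quadratic_form X" "quadratic_form Y" for X Y :: "'a mat" and i j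
  proof -
    have "(X \<bottom>\<^sub>q Y) \<bottom>\<^sub>q hyperbolic (i + j) \<cong>\<^sub>q (X \<bottom>\<^sub>q Y) \<bottom>\<^sub>q (hyperbolic i \<bottom>\<^sub>q hyperbolic j)"
      by (rule qiso_cong[OF qiso_refl[OF quadratic_form_orth_sum[OF that]] qiso_sym[OF hyperbolic_add]])
    also have "\<dots> \<cong>\<^sub>q (X \<bottom>\<^sub>q hyperbolic i) \<bottom>\<^sub>q (Y \<bottom>\<^sub>q hyperbolic j)"
      by (rule qiso_interchange[OF that h h])
    finally show ?thesis .
  qed
  note d = 1(1,2)[THEN even_nonsingularD(1)] 2(1,2)[THEN even_nonsingularD(1)]
  have "(A \<bottom>\<^sub>q B) \<bottom>\<^sub>q hyperbolic (m + k) \<cong>\<^sub>q (A' \<bottom>\<^sub>q B') \<bottom>\<^sub>q hyperbolic (n + l)"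
    using qiso_trans[OF merge[OF d(1,3)] qiso_trans[OF qiso_cong[OF 1(3) 2(3)] qiso_sym[OF merge[OF d(2,4)]]]] .
  then show ?thesis
    by (rule witt_relI[OF even_nonsingular_orth_sum[OF 1(1) 2(1)] even_nonsingular_orth_sum[OF 1(2) 2(2)]])
qed

lemma witt_class_eq:
  "A \<in> even_nonsingular_forms \<Longrightarrow> B \<in> even_nonsingular_forms \<Longrightarrow>
    witt_class A = witt_class B \<longleftrightarrow> (A, B) \<in> witt_rel"
  unfolding witt_class_def by (rule eq_equiv_class_iff[OF equiv_witt_rel])

lemma witt_class_eqI: "(A, B) \<in> witt_rel \<Longrightarrow> witt_class A = witt_class B"
  unfolding witt_class_def by (rule equiv_class_eq[OF equiv_witt_rel])

lemma witt_class_qiso: "A \<cong>\<^sub>q B \<Longrightarrow> A \<in> even_nonsingular_forms \<Longrightarrow> witt_class A = witt_class B"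
  by (rule witt_class_eqI[OF witt_rel_qiso])

lemma in_witt_class: "A \<in> even_nonsingular_forms \<Longrightarrow> A \<in> witt_class A"
  unfolding witt_class_def by (simp add: witt_rel_refl)

lemma witt_carrier: "carrier witt_group = witt_class ` even_nonsingular_forms"
  by (auto simp: witt_group_def quotient_def witt_class_def)

lemma witt_class_closed: "A \<in> even_nonsingular_forms \<Longrightarrow> witt_class A \<in> carrier witt_group"
  by (simp add: witt_carrier)

lemma witt_carrierE:
  assumes "w \<in> carrier witt_group"
  obtains A where "A \<in> even_nonsingular_forms" "w = witt_class A"
  using assms by (auto simp: witt_carrier)

lemma witt_mult:
  assumes "A \<in> even_nonsingular_forms" "B \<in> even_nonsingular_forms"
  shows "witt_class A \<otimes>\<^bsub>witt_group\<^esub> witt_class B = witt_class (A \<bottom>\<^sub>q B)"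
proof -
  have "congruent2 witt_rel witt_rel (\<lambda>A B. witt_class (A \<bottom>\<^sub>q B))"
    by (intro congruent2I' witt_class_eqI witt_rel_cong)
  then show ?thesis
    using UN_equiv_class2[OF equiv_witt_rel equiv_witt_rel _ assms]
    by (simp add: witt_group_def witt_class_def)
qed

lemma zero_form: "0\<^sub>m 0 0 \<in> even_nonsingular_forms"
  using even_nonsingular_hyperbolic[of 0] by simp

lemma witt_one: "\<one>\<^bsub>witt_group\<^esub> = witt_class (0\<^sub>m 0 0)"
  by (simp add: witt_group_def)

lemma witt_class_hyperbolic:
  fixes A :: "'a::field mat"
  assumes "A \<cong>\<^sub>q hyperbolic n"
  shows "witt_class A = \<one>\<^bsub>witt_group\<^esub>"
proof -
  have A: "A \<in> even_nonsingular_forms"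
    by (rule even_nonsingular_qiso[OF qiso_sym[OF assms] even_nonsingular_hyperbolic])
  have "A \<bottom>\<^sub>q hyperbolic 0 = A" "0\<^sub>m 0 0 \<bottom>\<^sub>q hyperbolic n = (hyperbolic n :: 'a mat)"
    using orth_sum_zero_right[OF even_nonsingularD(4)[OF A]] orth_sum_zero_left[OF hyperbolic_carrier] by auto
  then show ?thesis unfolding witt_one
    using assms by (intro witt_class_eqI witt_relI[OF A zero_form, of 0 n]) (simp only:)
qed

lemma witt_class_trivial_if_lagrangian:
  assumes "A \<in> even_nonsingular_forms" "totally_isotropic n A" "qdim A = 2 * n"
  shows "witt_class A = \<one>\<^bsub>witt_group\<^esub>"
  by (rule witt_class_hyperbolic[OF hyperbolic_if_lagrangian[OF _ _ assms(2,3)]])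
    (use even_nonsingularD[OF assms(1)] in auto)

text \<open>\<open>hyperbolic n\<close> has a Lagrangian, of which \<open>m\<close> dimensions are
  lost when the \<open>m\<close> planes next to \<open>A\<close> are cancelled; what is left is half
  of \<open>qdim A\<close>. With the converse above, triviality of a class becomes the existence of
  a Lagrangian.\<close>

lemma lagrangian_if_witt_class_trivial:
  assumes A: "A \<in> even_nonsingular_forms" and 1: "witt_class A = \<one>\<^bsub>witt_group\<^esub>"
  shows "totally_isotropic (qdim A div 2) A"
proof -
  obtain m n where "A \<bottom>\<^sub>q hyperbolic m \<cong>\<^sub>q 0\<^sub>m 0 0 \<bottom>\<^sub>q hyperbolic n"
    using 1 witt_class_eq[OF A zero_form] unfolding witt_one by (metis witt_relE)
  then have iso: "A \<bottom>\<^sub>q hyperbolic m \<cong>\<^sub>q hyperbolic n"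
    by (simp add: orth_sum_zero_left[OF hyperbolic_carrier])
  then have "qdim A + 2 * m = 2 * n" using isometric_qdim[of "A \<bottom>\<^sub>q hyperbolic m"] by (auto simp: qiso_def)
  then have n: "n = m + qdim A div 2" by simp
  have "totally_isotropic n (A \<bottom>\<^sub>q hyperbolic m)"
    by (rule totally_isotropic_qiso[OF qiso_sym[OF iso] totally_isotropic_hyperbolic])
  then show ?thesis unfolding n by (rule totally_isotropic_cancel[OF even_nonsingularD(1)[OF A]])
qed

lemma char_two_add_self: "CHAR('a::field) = 2 \<Longrightarrow> (x::'a) + x = 0"
  using of_nat_CHAR[where 'a='a] by (metis mult_2 mult_zero_left of_nat_numeral)

text \<open>The diagonal is a Lagrangian of \<open>A \<bottom>\<^sub>q A\<close>, as
  \<open>q(x) + q(x) = 0\<close>. Every class is thus its own inverse, and equality of two classes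
  becomes triviality of their sum.\<close>

lemma witt_class_double:
  fixes A :: "'a::field mat"
  assumes "CHAR('a) = 2" and A: "A \<in> even_nonsingular_forms"
  shows "witt_class A \<otimes>\<^bsub>witt_group\<^esub> witt_class A = \<one>\<^bsub>witt_group\<^esub>"
proof -
  note Ac = even_nonsingularD(4)[OF A]
  have "totally_isotropic (qdim A) (A \<bottom>\<^sub>q A)"
  proof (rule totally_isotropicI)
    show "lin (qdim A) (qdim (A \<bottom>\<^sub>q A)) (\<lambda>x. x @\<^sub>v x)" by (simp add: lin_append lin_id)
    fix x :: "'a vec" assume x: "x \<in> carrier_vec (qdim A)"
    show "qeval (A \<bottom>\<^sub>q A) (x @\<^sub>v x) = 0"
      by (simp add: qeval_orth_sum[OF Ac Ac x x] char_two_add_self[OF assms(1)])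
    show "x = 0\<^sub>v (qdim A)" if "x @\<^sub>v x = 0\<^sub>v (qdim (A \<bottom>\<^sub>q A))"
      using append_eq_zero[OF x x] that by simp
  qed
  then show ?thesis unfolding witt_mult[OF A A]
    by (rule witt_class_trivial_if_lagrangian[OF even_nonsingular_orth_sum[OF A A]]) simp
qed

text \<open>The characteristic enters through inverses: each class is inverse to itself.\<close>

lemma witt_comm_group:
  assumes char: "CHAR('a::field) = 2"
  shows "comm_group (witt_group :: 'a mat set monoid)"
proof (rule comm_groupI)
  fix x y z :: "'a mat set"
  assume "x \<in> carrier witt_group" "y \<in> carrier witt_group"
  then obtain A B where A: "A \<in> even_nonsingular_forms" "x = witt_class A"
    and B: "B \<in> even_nonsingular_forms" "y = witt_class B"
    by (metis witt_carrierE)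
  note qf = even_nonsingularD(1)[OF A(1)] even_nonsingularD(1)[OF B(1)]
  show "x \<otimes>\<^bsub>witt_group\<^esub> y \<in> carrier witt_group"
    using A B by (simp add: witt_mult witt_class_closed even_nonsingular_orth_sum)
  show "x \<otimes>\<^bsub>witt_group\<^esub> y = y \<otimes>\<^bsub>witt_group\<^esub> x"
    using A B qiso_commute[OF qf] by (simp add: witt_mult witt_class_qiso even_nonsingular_orth_sum)
  assume "z \<in> carrier witt_group"
  then obtain C where C: "C \<in> even_nonsingular_forms" "z = witt_class C" by (metis witt_carrierE)
  show "x \<otimes>\<^bsub>witt_group\<^esub> y \<otimes>\<^bsub>witt_group\<^esub> z = x \<otimes>\<^bsub>witt_group\<^esub> (y \<otimes>\<^bsub>witt_group\<^esub> z)"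
    using A B C qiso_assoc[OF qf even_nonsingularD(1)[OF C(1)]]
    by (simp add: witt_mult witt_class_qiso even_nonsingular_orth_sum)
next
  fix x :: "'a mat set"
  assume "x \<in> carrier witt_group"
  then obtain A where A: "A \<in> even_nonsingular_forms" "x = witt_class A" by (metis witt_carrierE)
  show "\<one>\<^bsub>witt_group\<^esub> \<otimes>\<^bsub>witt_group\<^esub> x = x"
    using A orth_sum_zero_left[OF even_nonsingularD(4)[OF A(1)]] by (simp add: witt_one witt_mult[OF zero_form])
  show "\<exists>y\<in>carrier witt_group. y \<otimes>\<^bsub>witt_group\<^esub> x = \<one>\<^bsub>witt_group\<^esub>"
    using A witt_class_double[OF char A(1)] witt_class_closed by blast
next
  show "\<one>\<^bsub>witt_group\<^esub> \<in> carrier (witt_group :: 'a mat set monoid)"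
    by (simp add: witt_one witt_class_closed zero_form)
qed

section \<open>Anisotropic representatives have the least dimension in their class\<close>

text \<open>If \<open>qdim A\<close> were larger, a Lagrangian of
  \<open>A \<bottom>\<^sub>q B\<close> would have dimension greater than \<open>qdim B\<close>. It
  would contain a nonzero vector with zero component in \<open>B\<close>, that is, an isotropic
  vector of \<open>A\<close>.\<close>

lemma anisotropic_qdim_le:
  fixes A B :: "'a::field mat"
  assumes char: "CHAR('a) = 2" and A: "A \<in> even_nonsingular_forms" and B: "B \<in> even_nonsingular_forms"
    and eq: "witt_class A = witt_class B" and an: "anisotropic A"
  shows "qdim A \<le> qdim B"
proof (rule ccontr)
  assume lt: "\<not> qdim A \<le> qdim B"
  define k where "k = (qdim A + qdim B) div 2"
  have k: "qdim B < k" "2 * k = qdim A + qdim B"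
    using lt even_nonsingularD(2)[OF A] even_nonsingularD(2)[OF B] by (auto simp: k_def elim!: evenE)
  note AB = even_nonsingular_orth_sum[OF A B]
  have "witt_class (A \<bottom>\<^sub>q B) = \<one>\<^bsub>witt_group\<^esub>"
    using witt_mult[OF A B] witt_class_double[OF char B] eq by simp
  from lagrangian_if_witt_class_trivial[OF AB this] have "totally_isotropic k (A \<bottom>\<^sub>q B)" by (simp add: k_def)
  then obtain f where f: "lin k (qdim A + qdim B) f"
    "\<And>x. x \<in> carrier_vec k \<Longrightarrow> f x = 0\<^sub>v (qdim A + qdim B) \<Longrightarrow> x = 0\<^sub>v k"
    "\<And>x. x \<in> carrier_vec k \<Longrightarrow> qeval (A \<bottom>\<^sub>q B) (f x) = 0"
    unfolding totally_isotropic_def qdim_orth_sum by blast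
  obtain x where x: "x \<in> carrier_vec k" "x \<noteq> 0\<^sub>v k" "vec_last (f x) (qdim B) = 0\<^sub>v (qdim B)"
    by (rule lin_kernel[OF lin_comp[OF f(1) lin_last] k(1)])
  define y where "y = vec_first (f x) (qdim A)"
  have y: "y \<in> carrier_vec (qdim A)" by (simp add: y_def)
  have fx: "f x = y @\<^sub>v 0\<^sub>v (qdim B)"
    using lin_carrier[OF f(1) x(1)] x(3) by (metis vec_first_last_append y_def)
  have "qeval A y = 0"
    using f(3)[OF x(1)] qeval_orth_sum[OF even_nonsingularD(4)[OF A] even_nonsingularD(4)[OF B] y, of "0\<^sub>v (qdim B)"]
      qeval_zero[OF even_nonsingularD(4)[OF B]] by (simp add: fx)
  then have "y = 0\<^sub>v (qdim A)" by (rule anisotropicD[OF an y])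
  then have "f x = 0\<^sub>v (qdim A + qdim B)" using fx append_zero by simp
  then show False using f(2)[OF x(1)] x(2) by blast
qed

lemma witt_class_cancel_plane:
  assumes "A \<cong>\<^sub>q binary_form 0 0 \<bottom>\<^sub>q B" "A \<in> even_nonsingular_forms" "quadratic_form B" "nonsingular B"
  shows "B \<in> even_nonsingular_forms" "witt_class A = witt_class B"
proof -
  let ?H = "binary_form 0 0 :: 'a mat"
  have d: "qdim ?H = 2" using binary_form_carrier[of 0 0] by (metis carrier_matD(1) qdim_def)
  have "qdim A = 2 + qdim B" using assms(1) isometric_qdim d by (fastforce simp: qiso_def)
  then show B: "B \<in> even_nonsingular_forms"
    using even_nonsingularD(2)[OF assms(2)] by (intro even_nonsingularI assms) simp
  have "hyperbolic 1 = ?H" by (simp add: orth_sum_zero_right[of _ 2])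
  then have "?H \<bottom>\<^sub>q B \<cong>\<^sub>q B \<bottom>\<^sub>q hyperbolic 1" using qiso_commute[OF quadratic_form_binary assms(3)] by simp
  then have "A \<cong>\<^sub>q B \<bottom>\<^sub>q hyperbolic 1" using assms(1) qiso_trans by blast
  then have "A \<bottom>\<^sub>q hyperbolic 0 \<cong>\<^sub>q B \<bottom>\<^sub>q hyperbolic 1"
    using orth_sum_zero_right[OF even_nonsingularD(4)[OF assms(2)]] by simp
  then show "witt_class A = witt_class B" by (rule witt_class_eqI[OF witt_relI[OF assms(2) B]])
qed

lemma anisotropic_representative:
  assumes "A \<in> even_nonsingular_forms"
  shows "\<exists>B\<in>even_nonsingular_forms. anisotropic B \<and> witt_class B = witt_class A"
  using assms
proof (induction "qdim A" arbitrary: A rule: less_induct)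
  case less
  show ?case
  proof (cases "anisotropic A")
    case False
    then obtain B where B: "quadratic_form B" "nonsingular B" "qdim A = 2 + qdim B" "A \<cong>\<^sub>q binary_form 0 0 \<bottom>\<^sub>q B"
      using isotropic_splitting[OF even_nonsingularD(1,3)[OF less.prems]] by blast
    then show ?thesis using less.hyps[of B] witt_class_cancel_plane[OF B(4) less.prems B(1,2)] by auto
  qed (use less.prems in blast)
qed

lemma qdim_anisotropic_part_le:
  fixes A :: "'a::field mat"
  assumes char: "CHAR('a) = 2" and A: "A \<in> even_nonsingular_forms"
  shows "qdim (anisotropic_part (witt_class A)) \<le> qdim A"
proof -
  let ?B = "anisotropic_part (witt_class A)"
  have "\<exists>B. B \<in> witt_class A \<and> anisotropic B"
    using anisotropic_representative[OF A] in_witt_class by metis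
  then have B: "?B \<in> witt_class A" "anisotropic ?B"
    unfolding anisotropic_part_def by (metis (mono_tags, lifting) someI_ex)+
  then have "(A, ?B) \<in> witt_rel" by (simp add: witt_class_def)
  then have "?B \<in> even_nonsingular_forms" "witt_class ?B = witt_class A"
    using witt_class_eqI by (auto elim: witt_relE)
  then show ?thesis using anisotropic_qdim_le[OF char _ A _ B(2)] by simp
qed

section \<open>Local operators on spin states\<close>

text \<open>Functions on assignments of a Boolean to every natural number contain all finite tensor
  products of two-dimensional spaces. One type thus hosts the modules of all forms, and two modules
  are tensored by letting them act on different sites.\<close>

type_synonym 'a state = "(nat \<Rightarrow> bool) \<Rightarrow> 'a"

definition smul :: "'a::field \<Rightarrow> 'a state \<Rightarrow> 'a state" where
  "smul c v = (\<lambda>s. c * v s)"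

lemma smul_apply: "smul c v s = c * v s"
  by (simp add: smul_def)

text \<open>As simplification rules, the pointwise laws would also eta-expand states that are not applied.\<close>

declare plus_fun_apply [simp del] zero_fun_apply [simp del]

lemmas pointwise = fun_eq_iff smul_apply plus_fun_apply zero_fun_apply

lemma smul_simps: "smul c (u + v) = smul c u + smul c v" "smul (c + d) v = smul c v + smul d v"
  "smul c (smul d v) = smul (c * d) v" "smul 1 v = v" "smul 0 v = 0" "smul c 0 = 0"
  by (auto simp: pointwise algebra_simps)

lemma smul_eq_0: "smul c v = 0 \<longleftrightarrow> c = 0 \<or> v = 0"
  by (auto simp: pointwise)

text \<open>As a type, the linear operators become an instance of \<open>ring_1\<close>, so that
  Clifford relations are ring equations which simplification can normalize. The field enters through
  the central operators \<open>scal c\<close>.\<close>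

typedef (overloaded) ('a::field) lop =
  "{f :: 'a state \<Rightarrow> 'a state. (\<forall>u v. f (u + v) = f u + f v) \<and> (\<forall>c v. f (smul c v) = smul c (f v))}"
  morphisms app Lop
  by (rule exI[of _ "\<lambda>v. v"]) simp

lemma app_add: "app X (u + v) = app X u + app X v"
  and app_smul: "app X (smul c v) = smul c (app X v)"
  using app[of X] by auto

lemma app_zero: "app X 0 = 0"
  using app_smul[of X 0 0] by (simp add: smul_simps)

lemma app_Lop:
  "(\<And>u v. f (u + v) = f u + f v) \<Longrightarrow> (\<And>c v. f (smul c v) = smul c (f v)) \<Longrightarrow> app (Lop f) = f"
  by (rule Lop_inverse) simp

lemma lop_eqI: "(\<And>v. app X v = app Y v) \<Longrightarrow> X = Y"
  by (metis app_inject ext)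

instantiation lop :: (field) ring_1
begin

definition "0 = Lop (\<lambda>v. 0)"
definition "1 = Lop (\<lambda>v. v)"
definition "X + Y = Lop (\<lambda>v. app X v + app Y v)"
definition "- X = Lop (\<lambda>v. - app X v)"
definition "X - Y = Lop (\<lambda>v. app X v - app Y v)"
definition "X * Y = Lop (\<lambda>v. app X (app Y v))"

lemma app_ring: "app 0 v = 0" "app 1 v = v" "app (X + Y) v = app X v + app Y v"
  "app (- X) v = - app X v" "app (X - Y) v = app X v - app Y v" "app (X * Y) v = app X (app Y v)"
  by (simp_all add: zero_lop_def one_lop_def plus_lop_def uminus_lop_def minus_lop_def times_lop_def
      app_Lop app_add app_smul smul_simps pointwise algebra_simps)

instance
proof
  have "(1 :: 'a state) \<noteq> 0" by (simp add: pointwise)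
  then show "(0 :: 'a lop) \<noteq> 1" by (metis app_ring(1,2))
qed (rule lop_eqI; simp add: app_ring app_add; fail)+

end

definition scal :: "'a::field \<Rightarrow> 'a lop" where
  "scal c = Lop (smul c)"

lemma app_scal: "app (scal c) v = smul c v"
  unfolding scal_def by (subst app_Lop) (auto simp: pointwise algebra_simps)

lemma scal_commute: "X * scal c = scal c * X"
  by (rule lop_eqI) (simp add: app_ring app_scal app_smul)

lemma scal_left_commute: "X * (scal c * Y) = scal c * (X * Y)"
  by (simp add: scal_commute flip: mult.assoc)

lemma scal_ring: "scal 0 = 0" "scal 1 = 1" "scal (c + d) = scal c + scal d" "scal (c * d) = scal c * scal d"
  by (rule lop_eqI, simp add: app_ring app_scal smul_simps)+

text \<open>The matrix with rows \<open>(a, b)\<close> and \<open>(c, d)\<close> acting on tensor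
  factor \<open>p\<close>, whose basis is indexed by \<open>False\<close> and \<open>True\<close> in
  this order.\<close>

definition site :: "nat \<Rightarrow> 'a::field \<Rightarrow> 'a \<Rightarrow> 'a \<Rightarrow> 'a \<Rightarrow> 'a lop" where
  "site p a b c d = Lop (\<lambda>v s. if s p then c * v (s(p := False)) + d * v (s(p := True))
     else a * v (s(p := False)) + b * v (s(p := True)))"

lemma app_site: "app (site p a b c d) v s = (if s p then c * v (s(p := False)) + d * v (s(p := True))
     else a * v (s(p := False)) + b * v (s(p := True)))"
  unfolding site_def by (subst app_Lop) (auto simp: pointwise algebra_simps)

lemma site_mult: "site p a b c d * site p a' b' c' d' =
    site p (a * a' + b * c') (a * b' + b * d') (c * a' + d * c') (c * b' + d * d')"
  by (rule lop_eqI) (auto simp: app_ring app_site pointwise algebra_simps)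

lemma site_add: "site p a b c d + site p a' b' c' d' = site p (a + a') (b + b') (c + c') (d + d')"
  by (rule lop_eqI) (auto simp: app_ring app_site pointwise algebra_simps)

lemma scal_eq_site: "scal c = site p c 0 0 c"
  by (rule lop_eqI) (auto simp: app_scal app_site pointwise fun_upd_idem)

lemma one_eq_site: "1 = site p 1 0 0 1"
  using scal_eq_site[of 1 p] by (simp add: scal_ring)

lemma site_commute:
  assumes "p \<noteq> q"
  shows "site p a b c d * site q a' b' c' d' = site q a' b' c' d' * site p a b c d"
  using assms by (intro lop_eqI) (auto simp: app_ring app_site pointwise fun_upd_twist algebra_simps)

section \<open>Operators supported on a set of sites\<close>

text \<open>Operators with disjoint supports commute, which is what turns orthogonal sums of forms
  into tensor products of modules.\<close>

inductive_set loc :: "nat set \<Rightarrow> 'a::field lop set" for I where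
  loc_scal: "scal c \<in> loc I"
| loc_site: "p \<in> I \<Longrightarrow> site p a b c d \<in> loc I"
| loc_add: "X \<in> loc I \<Longrightarrow> Y \<in> loc I \<Longrightarrow> X + Y \<in> loc I"
| loc_mult: "X \<in> loc I \<Longrightarrow> Y \<in> loc I \<Longrightarrow> X * Y \<in> loc I"

lemma loc_zero: "0 \<in> loc I"
  using loc_scal[of 0 I] by (simp add: scal_ring)

lemma loc_mono: "X \<in> loc I \<Longrightarrow> I \<subseteq> J \<Longrightarrow> X \<in> loc J"
  by (induction rule: loc.induct) (auto intro: loc.intros)

lemma loc_commute:
  assumes "X \<in> loc I" "Y \<in> loc J" "I \<inter> J = {}"
  shows "X * Y = Y * X"
  using assms(1)
proof induction
  case (loc_site p a b c d)
  then have "p \<notin> J" using assms(3) by blast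
  from assms(2) this show ?case
  proof induction
    case (loc_site q a' b' c' d')
    then show ?case by (metis site_commute)
  next
    case (loc_mult X Y)
    then show ?case by (metis mult.assoc)
  qed (auto simp: scal_commute algebra_simps)
next
  case (loc_mult X Z)
  then show ?case by (metis mult.assoc)
qed (auto simp: scal_commute algebra_simps)

text \<open>The finite tensor product over the sites below \<open>n\<close>, embedded as the
  functions that are constant in the remaining sites.\<close>

definition local_states :: "nat \<Rightarrow> 'a::field state set" where
  "local_states n = {v. \<forall>s t. (\<forall>i<n. s i = t i) \<longrightarrow> v s = v t}"

lemma local_states_add: "u \<in> local_states n \<Longrightarrow> v \<in> local_states n \<Longrightarrow> u + v \<in> local_states n"
  unfolding local_states_def mem_Collect_eq plus_fun_apply by metis

lemma local_states_smul: "v \<in> local_states n \<Longrightarrow> smul c v \<in> local_states n"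
  unfolding local_states_def mem_Collect_eq smul_apply by metis

lemma app_local_states:
  assumes "X \<in> loc I" "I \<subseteq> {..<n}" "v \<in> local_states n"
  shows "app X v \<in> local_states n"
  using assms
proof (induction arbitrary: v)
  case (loc_site p a b c d)
  then have p: "p < n" by auto
  show ?case
    unfolding local_states_def mem_Collect_eq
  proof (intro allI impI)
    fix s t :: "nat \<Rightarrow> bool" assume st: "\<forall>i<n. s i = t i"
    have "v (s(p := x)) = v (t(p := x))" for x
      using loc_site.prems(2) st unfolding local_states_def by auto
    moreover have "s p = t p" using p st by auto
    ultimately show "app (site p a b c d) v s = app (site p a b c d) v t" by (simp add: app_site)
  qed
next
  case (loc_scal c)
  then show ?case unfolding app_scal by (intro local_states_smul)
next
  case (loc_add X Y)
  have "app X v \<in> local_states n" "app Y v \<in> local_states n" using loc_add by auto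
  then show ?case unfolding app_ring by (rule local_states_add)
next
  case (loc_mult X Y)
  then show ?case by (simp add: app_ring)
qed

section \<open>Clifford modules\<close>

text \<open>A module over the Clifford algebra of \<open>A\<close>: \<open>\<rho>\<close> is the
  action of vectors and \<open>Z\<close> a degree operator, shifted by 1 when it passes a vector. In
  characteristic 2 an idempotent \<open>Z\<close> (the case \<open>z = 0\<close>) splits the module
  into eigenspaces for 0 and 1 that vectors exchange. The parameter \<open>z\<close> plays the part
  of the Arf invariant: it is \<open>a\<close> for the form \<open>[1,a]\<close> and adds up over
  orthogonal sums.\<close>

definition clif :: "'a::field mat \<Rightarrow> ('a vec \<Rightarrow> 'a lop) \<Rightarrow> 'a lop \<Rightarrow> 'a \<Rightarrow> bool" where
  "clif A \<rho> Z z \<longleftrightarrow>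
     (\<forall>x\<in>carrier_vec (qdim A). \<forall>y\<in>carrier_vec (qdim A). \<rho> (x + y) = \<rho> x + \<rho> y) \<and>
     (\<forall>c. \<forall>x\<in>carrier_vec (qdim A). \<rho> (c \<cdot>\<^sub>v x) = scal c * \<rho> x) \<and>
     (\<forall>x\<in>carrier_vec (qdim A). \<rho> x * \<rho> x = scal (qeval A x) \<and> Z * \<rho> x = \<rho> x * (1 + Z)) \<and>
     Z * Z = Z + scal z"

lemma clifI:
  assumes "\<And>x y. x \<in> carrier_vec (qdim A) \<Longrightarrow> y \<in> carrier_vec (qdim A) \<Longrightarrow> \<rho> (x + y) = \<rho> x + \<rho> y"
    and "\<And>c x. x \<in> carrier_vec (qdim A) \<Longrightarrow> \<rho> (c \<cdot>\<^sub>v x) = scal c * \<rho> x"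
    and "\<And>x. x \<in> carrier_vec (qdim A) \<Longrightarrow> \<rho> x * \<rho> x = scal (qeval A x)"
    and "\<And>x. x \<in> carrier_vec (qdim A) \<Longrightarrow> Z * \<rho> x = \<rho> x * (1 + Z)"
    and "Z * Z = Z + scal z"
  shows "clif A \<rho> Z z"
  using assms unfolding clif_def by blast

lemma clifD:
  assumes "clif A \<rho> Z z"
  shows "x \<in> carrier_vec (qdim A) \<Longrightarrow> y \<in> carrier_vec (qdim A) \<Longrightarrow> \<rho> (x + y) = \<rho> x + \<rho> y"
    and "x \<in> carrier_vec (qdim A) \<Longrightarrow> \<rho> (c \<cdot>\<^sub>v x) = scal c * \<rho> x"
    and "x \<in> carrier_vec (qdim A) \<Longrightarrow> \<rho> x * \<rho> x = scal (qeval A x)"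
    and "x \<in> carrier_vec (qdim A) \<Longrightarrow> Z * \<rho> x = \<rho> x * (1 + Z)"
    and "Z * Z = Z + scal z"
  using assms unfolding clif_def by blast+

lemma clif_polar:
  assumes c: "clif A \<rho> Z z" and x: "x \<in> carrier_vec (qdim A)" and y: "y \<in> carrier_vec (qdim A)"
  shows "\<rho> x * \<rho> y + \<rho> y * \<rho> x = scal (polar A x y)"
proof -
  have xy: "x + y \<in> carrier_vec (qdim A)" using x y by simp
  have "\<rho> x * \<rho> x + \<rho> x * \<rho> y + (\<rho> y * \<rho> x + \<rho> y * \<rho> y) = scal (qeval A (x + y))"
    unfolding clifD(3)[OF c xy, symmetric] clifD(1)[OF c x y] by (simp add: algebra_simps)
  also have "\<dots> = scal (qeval A x) + scal (qeval A y) + scal (polar A x y)"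
    by (simp add: qeval_add scal_ring)
  finally show ?thesis unfolding clifD(3)[OF c x] clifD(3)[OF c y] by (simp add: algebra_simps)
qed

lemma scal_merge: "scal c * scal d = scal (c * d)" "scal c * (scal d * X) = scal (c * d) * X"
  by (simp_all add: scal_ring(4) mult.assoc)

lemma qdim_binary [simp]: "qdim (binary_form a b) = 2"
  using binary_form_carrier[of a b] by (metis carrier_matD(1) qdim_def)

lemma qdim_smult [simp]: "qdim (c \<cdot>\<^sub>m A) = qdim A"
  by (simp add: qdim_def)

lemma qeval_smult:
  "A \<in> carrier_mat n n \<Longrightarrow> x \<in> carrier_vec n \<Longrightarrow> qeval (c \<cdot>\<^sub>m A) x = c * qeval A x"
proof -
  assume A: "A \<in> carrier_mat n n" and x: "x \<in> carrier_vec n"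
  then have "(c \<cdot>\<^sub>m A) *\<^sub>v x = c \<cdot>\<^sub>v (A *\<^sub>v x)" by (intro eq_vecI) auto
  then show ?thesis using A x by (simp add: qeval_def)
qed

lemma clif_pullback:
  assumes c: "clif B \<rho> Z z" and f: "lin (qdim A) (qdim B) f"
    and eq: "\<And>x. x \<in> carrier_vec (qdim A) \<Longrightarrow> qeval B (f x) = qeval A x"
  shows "clif A (\<lambda>x. \<rho> (f x)) Z z"
  by (rule clifI)
    (simp_all add: lin_add[OF f] lin_smult[OF f] clifD(1,2,3,4)[OF c] lin_carrier[OF f] eq clifD(5)[OF c])

lemma clif_summands:
  assumes c: "clif (A \<bottom>\<^sub>q B) \<rho> Z z" and A: "quadratic_form A" and B: "quadratic_form B"
  shows "clif A (\<lambda>x. \<rho> (x @\<^sub>v 0\<^sub>v (qdim B))) Z z" "clif B (\<lambda>x. \<rho> (0\<^sub>v (qdim A) @\<^sub>v x)) Z z"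
proof -
  note Ac = quadratic_form_carrier[OF A] and Bc = quadratic_form_carrier[OF B]
  have l: "lin (qdim A) (qdim (A \<bottom>\<^sub>q B)) (\<lambda>x. x @\<^sub>v 0\<^sub>v (qdim B))" "lin (qdim B) (qdim (A \<bottom>\<^sub>q B)) (\<lambda>x. 0\<^sub>v (qdim A) @\<^sub>v x)"
    unfolding qdim_orth_sum by (intro lin_append lin_id lin_const_zero)+
  show "clif A (\<lambda>x. \<rho> (x @\<^sub>v 0\<^sub>v (qdim B))) Z z"
    by (rule clif_pullback[OF c l(1)]) (simp add: qeval_orth_sum[OF Ac Bc] qeval_zero[OF Bc])
  show "clif B (\<lambda>x. \<rho> (0\<^sub>v (qdim A) @\<^sub>v x)) Z z"
    by (rule clif_pullback[OF c l(2)]) (simp add: qeval_orth_sum[OF Ac Bc] qeval_zero[OF Ac])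
qed

locale char_two =
  fixes ty :: "'a::field itself"
  assumes char: "CHAR('a) = 2"
begin

lemma add_self: "(x::'a) + x = 0"
  by (rule char_two_add_self[OF char])

lemma add_self_left: "(x::'a) + (x + y) = y"
  using add_self[of x] by (simp flip: add.assoc)

lemma minus_eq: "- (x::'a) = x"
  using add_self[of x] by (simp add: minus_unique)

lemma diff_eq: "(x::'a) - y = x + y"
  using minus_eq[of y] by (metis diff_conv_add_uminus)

lemma lop_add_self: "(X::'a lop) + X = 0"
  using add_self by (intro lop_eqI) (simp add: app_ring pointwise)

lemma lop_add_self_left: "(X::'a lop) + (X + Y) = Y"
  using lop_add_self[of X] by (simp flip: add.assoc)

lemma state_add_self: "(v::'a state) + v = 0"
  using add_self by (simp add: pointwise)

lemma state_add_self_left: "(v::'a state) + (v + w) = w"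
  using state_add_self[of v] by (simp flip: add.assoc)

lemma lop_add_eq_0: "(X::'a lop) + Y = 0 \<longleftrightarrow> X = Y"
  unfolding eq_neg_iff_add_eq_0[symmetric] minus_unique[OF lop_add_self[of Y]] ..

lemma state_add_eq_0: "(v::'a state) + w = 0 \<longleftrightarrow> v = w"
  unfolding eq_neg_iff_add_eq_0[symmetric] minus_unique[OF state_add_self[of w]] ..

lemmas char_simps = add_self add_self_left minus_eq diff_eq lop_add_self lop_add_self_left

lemma clif_summands_commute:
  fixes A B :: "'a mat"
  assumes c: "clif (A \<bottom>\<^sub>q B) \<rho> Z z" and A: "quadratic_form A" and B: "quadratic_form B"
    and x: "x \<in> carrier_vec (qdim A)" and y: "y \<in> carrier_vec (qdim B)"
  shows "\<rho> (x @\<^sub>v 0\<^sub>v (qdim B)) * \<rho> (0\<^sub>v (qdim A) @\<^sub>v y) = \<rho> (0\<^sub>v (qdim A) @\<^sub>v y) * \<rho> (x @\<^sub>v 0\<^sub>v (qdim B))"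
proof -
  note Ac = quadratic_form_carrier[OF A] and Bc = quadratic_form_carrier[OF B]
  have "polar B (0\<^sub>v (qdim B)) y = 0" using polar_commute[OF zero_carrier_vec y] polar_zero_right[OF Bc y] by metis
  then have "polar (A \<bottom>\<^sub>q B) (x @\<^sub>v 0\<^sub>v (qdim B)) (0\<^sub>v (qdim A) @\<^sub>v y) = 0"
    by (simp add: polar_orth_sum[OF Ac Bc x _ _ y] polar_zero_right[OF Ac x])
  moreover have "x @\<^sub>v 0\<^sub>v (qdim B) \<in> carrier_vec (qdim (A \<bottom>\<^sub>q B))" "0\<^sub>v (qdim A) @\<^sub>v y \<in> carrier_vec (qdim (A \<bottom>\<^sub>q B))"
    unfolding qdim_orth_sum by (intro append_carrier_vec zero_carrier_vec x y)+
  ultimately show ?thesis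
    using clif_polar[OF c, of "x @\<^sub>v 0\<^sub>v (qdim B)" "0\<^sub>v (qdim A) @\<^sub>v y"] by (simp add: scal_ring lop_add_eq_0)
qed

text \<open>The cross terms of the square are \<open>\<rho> u * \<sigma> v\<close> twice, since the
  two actions commute, and cancel in characteristic 2. Each degree operator is invisible to the
  other action, so the sum of the two shifts by 1 on both.\<close>

lemma clif_orth_sum:
  fixes A B :: "'a mat"
  assumes 1: "clif A \<rho> Z z" and 2: "clif B \<sigma> Y y" and A: "quadratic_form A" and B: "quadratic_form B"
    and comm: "\<And>u v. u \<in> carrier_vec (qdim A) \<Longrightarrow> v \<in> carrier_vec (qdim B) \<Longrightarrow> \<rho> u * \<sigma> v = \<sigma> v * \<rho> u"
      "\<And>v. v \<in> carrier_vec (qdim B) \<Longrightarrow> Z * \<sigma> v = \<sigma> v * Z"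
      "\<And>u. u \<in> carrier_vec (qdim A) \<Longrightarrow> Y * \<rho> u = \<rho> u * Y"
      "Z * Y = Y * Z"
  shows "clif (A \<bottom>\<^sub>q B) (\<lambda>x. \<rho> (vec_first x (qdim A)) + \<sigma> (vec_last x (qdim B))) (Z + Y) (z + y)"
proof (rule clifI, unfold qdim_orth_sum)
  fix x :: "'a vec" assume "x \<in> carrier_vec (qdim A + qdim B)"
  then obtain u v where x: "u \<in> carrier_vec (qdim A)" "v \<in> carrier_vec (qdim B)" "x = u @\<^sub>v v" by (rule append_split)
  have e: "vec_first x (qdim A) = u" "vec_last x (qdim B) = v" using x by (auto simp: vec_first_append vec_last_append)
  show "(\<rho> (vec_first x (qdim A)) + \<sigma> (vec_last x (qdim B))) * (\<rho> (vec_first x (qdim A)) + \<sigma> (vec_last x (qdim B))) = scal (qeval (A \<bottom>\<^sub>q B) x)"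
    unfolding e unfolding x(3) qeval_orth_sum[OF quadratic_form_carrier[OF A] quadratic_form_carrier[OF B] x(1,2)]
    by (simp add: scal_ring comm(1)[OF x(1,2)] clifD(3)[OF 1 x(1), symmetric] clifD(3)[OF 2 x(2), symmetric] algebra_simps char_simps)
  show "(Z + Y) * (\<rho> (vec_first x (qdim A)) + \<sigma> (vec_last x (qdim B))) = (\<rho> (vec_first x (qdim A)) + \<sigma> (vec_last x (qdim B))) * (1 + (Z + Y))"
    unfolding e
    by (simp add: clifD(4)[OF 1 x(1)] clifD(4)[OF 2 x(2)] comm(2)[OF x(2)] comm(3)[OF x(1)] algebra_simps)
  fix c
  show "\<rho> (vec_first (c \<cdot>\<^sub>v x) (qdim A)) + \<sigma> (vec_last (c \<cdot>\<^sub>v x) (qdim B)) =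
      scal c * (\<rho> (vec_first x (qdim A)) + \<sigma> (vec_last x (qdim B)))"
    using \<open>x \<in> _\<close> by (simp add: lin_smult[OF lin_first[of "qdim A" "qdim B"]] lin_smult[OF lin_last[of "qdim A" "qdim B"]] clifD(2)[OF 1] clifD(2)[OF 2] algebra_simps)
next
  fix x x' :: "'a vec" assume x: "x \<in> carrier_vec (qdim A + qdim B)" and x': "x' \<in> carrier_vec (qdim A + qdim B)"
  show "\<rho> (vec_first (x + x') (qdim A)) + \<sigma> (vec_last (x + x') (qdim B)) =
      \<rho> (vec_first x (qdim A)) + \<sigma> (vec_last x (qdim B)) + (\<rho> (vec_first x' (qdim A)) + \<sigma> (vec_last x' (qdim B)))"
    using x x' by (simp add: lin_add[OF lin_first[of "qdim A" "qdim B"]] lin_add[OF lin_last[of "qdim A" "qdim B"]] clifD(1)[OF 1] clifD(1)[OF 2] algebra_simps)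
next
  show "(Z + Y) * (Z + Y) = Z + Y + scal (z + y)"
    by (simp add: clifD(5)[OF 1] clifD(5)[OF 2] comm(4) scal_ring algebra_simps char_simps)
qed

text \<open>\<open>[1,a]\<close> is the norm form of \<open>F[w]\<close>, and \<open>J\<close>
  induces the conjugation \<open>w \<mapsto> w + 1\<close>. Moving \<open>J\<close> past the element
  \<lambda> with coordinates x conjugates it, so \<open>J \<lambda>\<close> squares to
  \<open>J * J\<close> times the norm of \<lambda>.\<close>

lemma clif_binary:
  fixes w J :: "'a lop"
  assumes w: "w * w = w + scal a" and J: "J * J = scal d" and Jw: "J * w = w * J + J"
  shows "clif (d \<cdot>\<^sub>m binary_form 1 a) (\<lambda>x. J * (scal (x $ 0) + scal (x $ 1) * w)) w a"
proof (rule clifI, unfold qdim_smult qdim_binary)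
  have wJ: "w * J = J * w + J" using Jw by (simp add: algebra_simps char_simps)
  have ww: "w * (w * X) = w * X + scal a * X" for X using w by (simp add: algebra_simps flip: mult.assoc)
  have JJ: "J * (J * X) = scal d * X" for X using J by (simp flip: mult.assoc)
  have wJX: "w * (J * X) = J * (w * X) + J * X" for X using wJ by (simp add: algebra_simps flip: mult.assoc)
  note rules = ring_distribs mult.assoc w ww J JJ wJ wJX scal_left_commute[of J] scal_left_commute[of w]
    scal_commute[of J] scal_commute[of w] scal_merge
  fix x :: "'a vec" and c assume x: "x \<in> carrier_vec 2"
  show "J * (scal ((c \<cdot>\<^sub>v x) $ 0) + scal ((c \<cdot>\<^sub>v x) $ 1) * w) = scal c * (J * (scal (x $ 0) + scal (x $ 1) * w))"
    using x by (simp add: rules)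
  show "J * (scal (x $ 0) + scal (x $ 1) * w) * (J * (scal (x $ 0) + scal (x $ 1) * w)) =
      scal (qeval (d \<cdot>\<^sub>m binary_form 1 a) x)"
    unfolding qeval_smult[OF binary_form_carrier x] qeval_binary[OF x]
    by (simp add: rules) (simp add: scal_ring(3) power2_eq_square ac_simps ring_distribs char_simps)
  show "w * (J * (scal (x $ 0) + scal (x $ 1) * w)) = J * (scal (x $ 0) + scal (x $ 1) * w) * (1 + w)"
    by (simp add: rules)
next
  fix x y :: "'a vec" assume "x \<in> carrier_vec 2" "y \<in> carrier_vec 2"
  then show "J * (scal ((x + y) $ 0) + scal ((x + y) $ 1) * w) =
      J * (scal (x $ 0) + scal (x $ 1) * w) + J * (scal (y $ 0) + scal (y $ 1) * w)"
    by (simp add: scal_ring algebra_simps)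
qed (rule w)

end

lemma smult_orth_sum: "c \<cdot>\<^sub>m (A \<bottom>\<^sub>q B) = (c \<cdot>\<^sub>m A) \<bottom>\<^sub>q (c \<cdot>\<^sub>m B)" for c :: "'a::field"
  unfolding orth_sum_def by (rule eq_matI) auto

lemma smult_smult_mat: "c \<cdot>\<^sub>m (d \<cdot>\<^sub>m A) = (c * d) \<cdot>\<^sub>m A" for c :: "'a::field"
  by (rule eq_matI) auto

lemma quadratic_form_smult: "quadratic_form A \<Longrightarrow> quadratic_form (c \<cdot>\<^sub>m A)"
  unfolding quadratic_form_def square_mat.simps upper_triangular_def by auto

section \<open>Explicit models with half as many sites as the dimension\<close>

context char_two
begin

text \<open>The number of sites keeps the module as small as possible, and the last argument 0 of
  \<open>clif\<close> records the trivial Arf invariant. The offset \<open>p\<close> is arbitrary so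
  that a second model can be placed next to the first.\<close>

definition cliffordian :: "'a mat \<Rightarrow> bool" where
  "cliffordian A \<longleftrightarrow> (\<forall>p. \<exists>\<rho> Z. clif A \<rho> Z 0 \<and>
     (\<forall>x\<in>carrier_vec (qdim A). \<rho> x \<in> loc {p..<p + qdim A div 2}) \<and> Z \<in> loc {p..<p + qdim A div 2})"

lemma cliffordian_orth_sum:
  assumes "cliffordian A" "cliffordian B" and A: "quadratic_form A" "even (qdim A)"
    and B: "quadratic_form B" "even (qdim B)"
  shows "cliffordian (A \<bottom>\<^sub>q B)"
  unfolding cliffordian_def qdim_orth_sum
proof
  fix p :: nat
  let ?I = "{p..<p + qdim A div 2}" and ?J = "{p + qdim A div 2..<p + qdim A div 2 + qdim B div 2}"
  let ?K = "{p..<p + (qdim A + qdim B) div 2}"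
  obtain \<rho> Z where 1: "clif A \<rho> Z 0" "\<And>x. x \<in> carrier_vec (qdim A) \<Longrightarrow> \<rho> x \<in> loc ?I" "Z \<in> loc ?I"
    using assms(1) unfolding cliffordian_def by metis
  obtain \<sigma> Y where 2: "clif B \<sigma> Y 0" "\<And>x. x \<in> carrier_vec (qdim B) \<Longrightarrow> \<sigma> x \<in> loc ?J" "Y \<in> loc ?J"
    using assms(2) unfolding cliffordian_def by metis
  have d: "?I \<inter> ?J = {}" "?J \<inter> ?I = {}" by auto
  have s: "?I \<subseteq> ?K" "?J \<subseteq> ?K" using A(2) B(2) by (auto elim!: evenE)
  note comm = loc_commute[OF _ _ d(1)] loc_commute[OF _ _ d(2)]
  have "clif (A \<bottom>\<^sub>q B) (\<lambda>x. \<rho> (vec_first x (qdim A)) + \<sigma> (vec_last x (qdim B))) (Z + Y) (0 + 0)"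
    by (rule clif_orth_sum[OF 1(1) 2(1) A(1) B(1)]) (use 1 2 comm in blast)+
  moreover have "Z + Y \<in> loc ?K"
    by (intro loc_add loc_mono[OF 1(3) s(1)] loc_mono[OF 2(3) s(2)])
  moreover have "\<rho> (vec_first x (qdim A)) + \<sigma> (vec_last x (qdim B)) \<in> loc ?K" for x
    by (intro loc_add loc_mono[OF 1(2) s(1)] loc_mono[OF 2(2) s(2)]) auto
  ultimately show "\<exists>\<rho> Z. clif (A \<bottom>\<^sub>q B) \<rho> Z 0 \<and>
      (\<forall>x\<in>carrier_vec (qdim A + qdim B). \<rho> x \<in> loc ?K) \<and> Z \<in> loc ?K"
    by (intro exI[of _ "\<lambda>x. \<rho> (vec_first x (qdim A)) + \<sigma> (vec_last x (qdim B))"] exI[of _ "Z + Y"]) simp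
qed

lemma cliffordian_plane: "cliffordian (binary_form 0 0)"
  unfolding cliffordian_def
proof
  fix p :: nat
  \<comment> \<open>An off-diagonal matrix with entries \<open>x $ 0\<close> and
    \<open>x $ 1\<close> squares to their product, the value of the plane; \<open>Z\<close> projects
    onto the second basis state.\<close>
  have "clif (binary_form 0 0 :: 'a mat) (\<lambda>x. site p 0 (x $ 0) (x $ 1) 0) (site p 0 0 0 1) 0"
    by (rule clifI)
      (auto simp: site_add site_mult scal_eq_site[of _ p] one_eq_site[of p] qeval_binary char_simps mult.commute)
  moreover have "{p..<p + qdim (binary_form 0 0 :: 'a mat) div 2} = {p}" by auto
  ultimately show "\<exists>\<rho> Z. clif (binary_form 0 0 :: 'a mat) \<rho> Z 0 \<and>
      (\<forall>x\<in>carrier_vec (qdim (binary_form 0 0 :: 'a mat)). \<rho> x \<in> loc {p..<p + qdim (binary_form 0 0 :: 'a mat) div 2}) \<and>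
      Z \<in> loc {p..<p + qdim (binary_form 0 0 :: 'a mat) div 2}"
    by (intro exI[of _ "\<lambda>x. site p 0 (x $ 0) (x $ 1) 0"] exI[of _ "site p 0 0 0 1"]) (simp add: loc_site)
qed

lemma cliffordian_zero: "cliffordian (0\<^sub>m 0 0)"
proof -
  have "clif (0\<^sub>m 0 0) (\<lambda>x. 0) 0 0"
    by (rule clifI) (auto simp: scal_ring qeval_def scalar_prod_def qdim_def)
  then show ?thesis unfolding cliffordian_def using loc_zero by blast
qed

lemma cliffordian_hyperbolic: "cliffordian (hyperbolic n)"
  by (induction n) (auto simp: cliffordian_zero intro!: cliffordian_orth_sum cliffordian_plane qf_intros)

lemma sum_commute:
  fixes X Y U V :: "'b::ring"
  assumes "X * U = U * X" "X * V = V * X" "Y * U = U * Y" "Y * V = V * Y"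
  shows "(X + Y) * (U + V) = (U + V) * (X + Y)"
  by (simp add: ring_distribs assms add_ac)

lemma site_scalar: "site p d 0 0 d = scal d"
  by (rule scal_eq_site[symmetric])

text \<open>The even Clifford algebra of \<open>[1,a]\<close> is \<open>F[w]\<close> with \<open>w\<^sup>2 = w + a\<close>. In the module of
  \<open>\<langle>d1,d2,d3,d4\<rangle> \<otimes> [1,a]\<close> the scalars \<open>w\<close> live on site \<open>p\<close>, the i-th summand acts through
  \<open>w i = w + D i\<close> and a square root \<open>J i\<close> of \<open>d i\<close>. Since \<open>d1 d2 d3 d4\<close> is a square, \<open>J 4\<close> can be chosen as
  a multiple of \<open>J 1 J 2 J 3\<close> twisted by the conjugation \<open>\<sigma>\<close> of \<open>F[w]\<close>, so that no fifth site is needed.\<close>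

lemma cliffordian_pfister:
  fixes a b b' c :: 'a
  assumes nz: "b \<noteq> 0" "b' \<noteq> 0" "c \<noteq> 0"
  shows "cliffordian (c \<cdot>\<^sub>m pfister_form [b, b'] a)"
  unfolding cliffordian_def
proof
  fix p :: nat
  define X where "X = (binary_form 1 a :: 'a mat)"
  let ?A = "c \<cdot>\<^sub>m pfister_form [b, b'] a"
  have eq: "?A = ((c \<cdot>\<^sub>m X) \<bottom>\<^sub>q ((c * b') \<cdot>\<^sub>m X)) \<bottom>\<^sub>q (((c * b) \<cdot>\<^sub>m X) \<bottom>\<^sub>q ((c * b * b') \<cdot>\<^sub>m X))"
    by (simp add: bilinear_tensor_def smult_orth_sum smult_smult_mat X_def mult.assoc)
  have qd: "qdim ?A = 8" unfolding eq by (simp add: X_def)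
  define I where "I = {p..<p + 4}"
  \<comment> \<open>On the basis 1, w of \<open>F[w]\<close>, \<open>W\<close> is multiplication by
    w and \<open>\<sigma>\<close> is conjugation; \<open>D\<close>, \<open>E\<close>,
    \<open>F\<close> are projections on the other three sites.\<close>
  define W D E F \<sigma> where "W = site p 0 a 1 1" and "D = site (p + 1) 0 0 0 (1::'a)"
    and "E = site (p + 2) 0 0 0 (1::'a)" and "F = site (p + 3) 0 0 0 (1::'a)"
    and "\<sigma> = site p 1 1 0 (1::'a)"
  define J K L where "J = site (p + 1) 0 c 1 0" and "K = site (p + 2) 0 (c * b') 1 0"
    and "L = site (p + 3) 0 (c * b) 1 0"
  \<comment> \<open>The product of \<open>J\<close>, \<open>K\<close>, \<open>L\<close> squares to
    \<open>c * c * c * b * b'\<close>, so the factor \<open>1 / c\<close> makes the square of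
    \<open>M\<close> equal to \<open>c * b * b'\<close>. Each of \<open>J\<close>, \<open>K\<close>,
    \<open>L\<close> shifts its own projection by 1 and \<open>\<sigma>\<close> shifts
    \<open>W\<close>; the two shifts cancel in \<open>W + D\<close>, \<open>W + E\<close>,
    \<open>W + F\<close>, so \<open>M\<close> commutes with these.\<close>
  define M where "M = scal (1 / c) * (\<sigma> * (J * (K * L)))"
  note defs = W_def D_def E_def F_def \<sigma>_def J_def K_def L_def
  have WW: "W * W = W + scal a" and DD: "D * D = D" and EE: "E * E = E" and FF: "F * F = F"
    and ss: "\<sigma> * \<sigma> = 1" and sW: "\<sigma> * W = W * \<sigma> + \<sigma>"
    and JJ: "J * J = scal c" and KK: "K * K = scal (c * b')" and LL: "L * L = scal (c * b)"
    and JD: "J * D = D * J + J" and KE: "K * E = E * K + K" and LF: "L * F = F * L + L"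
    unfolding defs
    by (simp_all add: site_mult site_add one_eq_site[of p] site_scalar char_simps add.commute)
      (simp_all add: site_mult site_add scal_eq_site[of _ p] char_simps add.commute)
  have comm: "D * W = W * D" "E * W = W * E" "F * W = W * F" "J * W = W * J" "K * W = W * K" "L * W = W * L"
    "E * D = D * E" "F * D = D * F" "\<sigma> * D = D * \<sigma>" "K * D = D * K" "L * D = D * L"
    "F * E = E * F" "\<sigma> * E = E * \<sigma>" "J * E = E * J" "L * E = E * L"
    "\<sigma> * F = F * \<sigma>" "J * F = F * J" "K * F = F * K"
    "J * \<sigma> = \<sigma> * J" "K * \<sigma> = \<sigma> * K" "L * \<sigma> = \<sigma> * L" "K * J = J * K" "L * J = J * L" "L * K = K * L"
    unfolding defs by (simp_all add: site_commute)
  note base = WW DD EE FF ss sW JJ KK LL JD KE LF comm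
  note sc = scal_commute[of W] scal_commute[of D] scal_commute[of E] scal_commute[of F] scal_commute[of \<sigma>]
    scal_commute[of J] scal_commute[of K] scal_commute[of L]
    scal_left_commute[of W] scal_left_commute[of D] scal_left_commute[of E] scal_left_commute[of F]
    scal_left_commute[of \<sigma>] scal_left_commute[of J] scal_left_commute[of K] scal_left_commute[of L]
  have left: "Y * (Z * T) = U * T" if "Y * Z = U" for Y Z U T :: "'a lop"
    using that by (simp flip: mult.assoc)
  note rules = ring_distribs mult.assoc base base[THEN left] sc scal_merge ac_simps char_simps
  have 1: "clif (c \<cdot>\<^sub>m X) (\<lambda>x. J * (scal (x $ 0) + scal (x $ 1) * (W + D))) (W + D) a"
    unfolding X_def by (rule clif_binary) (simp_all add: rules)
  have 2: "clif ((c * b') \<cdot>\<^sub>m X) (\<lambda>x. K * (scal (x $ 0) + scal (x $ 1) * (W + E))) (W + E) a"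
    unfolding X_def by (rule clif_binary) (simp_all add: rules)
  have 3: "clif ((c * b) \<cdot>\<^sub>m X) (\<lambda>x. L * (scal (x $ 0) + scal (x $ 1) * (W + F))) (W + F) a"
    unfolding X_def by (rule clif_binary) (simp_all add: rules)
  have MM: "M * M = scal (c * b * b')"
    unfolding M_def using nz by (simp add: rules)
  have MW: "M * W = W * M + M" unfolding M_def by (simp add: rules)
  have 4: "clif ((c * b * b') \<cdot>\<^sub>m X) (\<lambda>x. M * (scal (x $ 0) + scal (x $ 1) * W)) W a"
    unfolding X_def by (rule clif_binary[OF WW MM MW])
  define \<rho>1 where "\<rho>1 x = J * (scal (x $ 0) + scal (x $ 1) * (W + D))" for x :: "'a vec"
  define \<rho>2 where "\<rho>2 x = K * (scal (x $ 0) + scal (x $ 1) * (W + E))" for x :: "'a vec"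
  define \<rho>3 where "\<rho>3 x = L * (scal (x $ 0) + scal (x $ 1) * (W + F))" for x :: "'a vec"
  define \<rho>4 where "\<rho>4 x = M * (scal (x $ 0) + scal (x $ 1) * W)" for x :: "'a vec"
  note cl = 1[folded \<rho>1_def] 2[folded \<rho>2_def] 3[folded \<rho>3_def] 4[folded \<rho>4_def]
  have qX: "quadratic_form (d \<cdot>\<^sub>m X)" for d unfolding X_def by (intro quadratic_form_smult quadratic_form_binary)
  have c12: "\<rho>1 x * \<rho>2 y = \<rho>2 y * \<rho>1 x" "\<rho>1 x * \<rho>3 y = \<rho>3 y * \<rho>1 x" "\<rho>2 x * \<rho>3 y = \<rho>3 y * \<rho>2 x"
     for x y :: "'a vec"
    by (simp_all add: \<rho>1_def \<rho>2_def \<rho>3_def rules)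
  have c4: "\<rho>1 x * \<rho>4 y = \<rho>4 y * \<rho>1 x" "\<rho>2 x * \<rho>4 y = \<rho>4 y * \<rho>2 x" "\<rho>3 x * \<rho>4 y = \<rho>4 y * \<rho>3 x"
    for x y :: "'a vec"
    by (simp_all add: \<rho>1_def \<rho>2_def \<rho>3_def \<rho>4_def M_def rules)
  have cw: "(W + D) * \<rho>2 x = \<rho>2 x * (W + D)" "(W + D) * \<rho>3 x = \<rho>3 x * (W + D)" "(W + D) * \<rho>4 x = \<rho>4 x * (W + D)"
    "(W + E) * \<rho>1 x = \<rho>1 x * (W + E)" "(W + E) * \<rho>3 x = \<rho>3 x * (W + E)" "(W + E) * \<rho>4 x = \<rho>4 x * (W + E)"
    "(W + F) * \<rho>1 x = \<rho>1 x * (W + F)" "(W + F) * \<rho>2 x = \<rho>2 x * (W + F)" "(W + F) * \<rho>4 x = \<rho>4 x * (W + F)"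
    "W * \<rho>1 x = \<rho>1 x * W" "W * \<rho>2 x = \<rho>2 x * W" "W * \<rho>3 x = \<rho>3 x * W" for x :: "'a vec"
    by (simp_all add: \<rho>1_def \<rho>2_def \<rho>3_def \<rho>4_def M_def rules)
  have Ws: "(W + D) * (W + E) = (W + E) * (W + D)" "(W + F) * W = W * (W + F)"
    "(W + D + (W + E)) * (W + F + W) = (W + F + W) * (W + D + (W + E))"
    by (simp_all add: rules)
  note cl12 = clif_orth_sum[OF cl(1,2) qX qX c12(1) cw(1) cw(4) Ws(1)]
  note cl34 = clif_orth_sum[OF cl(3,4) qX qX c4(3) cw(9) cw(12) Ws(2)]
  \<comment> \<open>All four summands have Arf parameter \<open>a\<close>, so the parameters cancel
    and the degree operator of the whole form is idempotent.\<close>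
  have "\<exists>\<rho>. clif ?A \<rho> (W + D + (W + E) + (W + F + W)) (a + a + (a + a)) \<and> (\<forall>x. \<rho> x \<in> loc I)"
    unfolding eq
  proof (rule exI, rule conjI, rule clif_orth_sum[OF cl12 cl34])
    have "\<rho>1 x \<in> loc I" "\<rho>2 x \<in> loc I" "\<rho>3 x \<in> loc I" "\<rho>4 x \<in> loc I" for x
      unfolding \<rho>1_def \<rho>2_def \<rho>3_def \<rho>4_def M_def defs by (intro loc.intros; simp add: I_def)+
    then show "\<forall>x. \<rho>1 (vec_first (vec_first x (qdim (c \<cdot>\<^sub>m X \<bottom>\<^sub>q (c * b') \<cdot>\<^sub>m X))) (qdim (c \<cdot>\<^sub>m X))) +
           \<rho>2 (vec_last (vec_first x (qdim (c \<cdot>\<^sub>m X \<bottom>\<^sub>q (c * b') \<cdot>\<^sub>m X))) (qdim ((c * b') \<cdot>\<^sub>m X))) +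
           (\<rho>3 (vec_first (vec_last x (qdim ((c * b) \<cdot>\<^sub>m X \<bottom>\<^sub>q (c * b * b') \<cdot>\<^sub>m X))) (qdim ((c * b) \<cdot>\<^sub>m X))) +
            \<rho>4 (vec_last (vec_last x (qdim ((c * b) \<cdot>\<^sub>m X \<bottom>\<^sub>q (c * b * b') \<cdot>\<^sub>m X))) (qdim ((c * b * b') \<cdot>\<^sub>m X))))
           \<in> loc I"
      by (intro allI loc_add) auto
  qed (rule Ws(3) c12 c4 cw sum_commute quadratic_form_orth_sum qX)+
  moreover have "W + D + (W + E) + (W + F + W) \<in> loc I"
    unfolding defs by (intro loc.intros; simp add: I_def)
  moreover have z: "a + a + (a + a) = 0" by (simp only: add_self add_0)
  moreover have I: "{p..<p + qdim ?A div 2} = I" unfolding qd by (simp add: I_def)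
  ultimately show "\<exists>\<rho> Z. clif ?A \<rho> Z 0 \<and> (\<forall>x\<in>carrier_vec (qdim ?A). \<rho> x \<in> loc {p..<p + qdim ?A div 2}) \<and>
      Z \<in> loc {p..<p + qdim ?A div 2}"
    unfolding I z by blast
qed

end

section \<open>Dimension bounds for subspaces of states\<close>

lemma sum_state_apply: "(\<Sum>i\<in>I. f i) s = (\<Sum>i\<in>I. f i s)" for f :: "'b \<Rightarrow> 'a::field state"
  by (induction I rule: infinite_finite_induct) (auto simp: pointwise)

lemma app_sum: "app X (\<Sum>i\<in>I. f i) = (\<Sum>i\<in>I. app X (f i))"
  by (induction I rule: infinite_finite_induct) (auto simp: app_zero app_add)

definition state_subspace :: "'a::field state set \<Rightarrow> bool" where
  "state_subspace V \<longleftrightarrow> 0 \<in> V \<and> (\<forall>u\<in>V. \<forall>v\<in>V. u + v \<in> V) \<and> (\<forall>c. \<forall>v\<in>V. smul c v \<in> V)"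

lemma state_subspaceD:
  assumes "state_subspace V"
  shows "0 \<in> V" "u \<in> V \<Longrightarrow> v \<in> V \<Longrightarrow> u + v \<in> V" "v \<in> V \<Longrightarrow> smul c v \<in> V"
  using assms unfolding state_subspace_def by auto

lemma state_subspace_sum:
  assumes "state_subspace V" "\<And>i. i \<in> I \<Longrightarrow> f i \<in> V"
  shows "(\<Sum>i\<in>I. smul (c i) (f i)) \<in> V"
  using assms(2)
  by (induction I rule: infinite_finite_induct) (auto simp: state_subspaceD[OF assms(1)])

text \<open>A bound stated through dependence alone passes to eigenspaces and kernels without a
  choice of bases. The index range \<open>i \<le> d\<close> makes it \<open>d + 1\<close>
  vectors.\<close>

definition dim_le :: "'a::field state set \<Rightarrow> nat \<Rightarrow> bool" where
  "dim_le V d \<longleftrightarrow> (\<forall>u. (\<forall>i\<le>d. u i \<in> V) \<longrightarrow> (\<exists>c. (\<exists>i\<le>d. c i \<noteq> 0) \<and> (\<Sum>i\<le>d. smul (c i) (u i)) = 0))"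

lemma dim_leE:
  assumes "dim_le V d" "\<And>i. i \<le> d \<Longrightarrow> u i \<in> V"
  obtains c where "\<exists>i\<le>d. c i \<noteq> 0" "(\<Sum>i\<le>d. smul (c i) (u i)) = 0"
  using assms unfolding dim_le_def by blast

lemma local_states_subspace: "state_subspace (local_states n)"
  unfolding state_subspace_def
  by (auto intro: local_states_add local_states_smul) (simp add: local_states_def pointwise)

lemma mult_mat_vec_index:
  "M \<in> carrier_mat n m \<Longrightarrow> x \<in> carrier_vec m \<Longrightarrow> i < n \<Longrightarrow> (M *\<^sub>v x) $ i = (\<Sum>j<m. M $$ (i, j) * x $ j)"
  by (auto simp: scalar_prod_def atLeast0LessThan intro!: sum.cong)

text \<open>A state that ignores the sites from \<open>n\<close> on is determined by its values at
  the \<open>2 ^ n\<close> assignments that are \<open>False\<close> there. The matrix of these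
  values for \<open>2 ^ n + 1\<close> states has one column more than rows.\<close>

lemma dim_le_local_states: "dim_le (local_states n :: 'a::field state set) (2 ^ n)"
  unfolding dim_le_def
proof (intro allI impI)
  fix u :: "nat \<Rightarrow> 'a state" assume u: "\<forall>i\<le>2 ^ n. u i \<in> local_states n"
  have "card (Pow {..<n}) = 2 ^ n" by (simp add: card_Pow)
  then obtain e where e: "bij_betw e {..<2 ^ n :: nat} (Pow {..<n})"
    using ex_bij_betw_nat_finite[of "Pow {..<n}"] by (auto simp: atLeast0LessThan)
  define M where "M = mat (2 ^ n) (Suc (2 ^ n)) (\<lambda>(i,j). u j (\<lambda>k. k \<in> e i))"
  have M: "M \<in> carrier_mat (2 ^ n) (Suc (2 ^ n))" by (simp add: M_def)
  obtain x where x: "x \<in> carrier_vec (Suc (2 ^ n))" "x \<noteq> 0\<^sub>v (Suc (2 ^ n))" "M *\<^sub>v x = 0\<^sub>v (2 ^ n)"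
    using wide_mat_kernel[OF M] by blast
  have "(\<Sum>i\<le>2 ^ n. smul (x $ i) (u i)) s = 0" for s
  proof -
    have "{k. k < n \<and> s k} \<in> Pow {..<n}" by auto
    then have "{k. k < n \<and> s k} \<in> e ` {..<2 ^ n}" using bij_betw_imp_surj_on[OF e] by simp
    then obtain i where i: "i < 2 ^ n" "e i = {k. k < n \<and> s k}" by (elim imageE) simp
    have us: "u j s = M $$ (i, j)" if "j \<le> 2 ^ n" for j
    proof -
      have "u j \<in> local_states n" using u that by blast
      then have "u j s = u j (\<lambda>k. k \<in> e i)"
        unfolding local_states_def using i by auto
      then show ?thesis using that i by (simp add: M_def)
    qed
    have "(\<Sum>j\<le>2 ^ n. smul (x $ j) (u j)) s = (\<Sum>j\<le>2 ^ n. M $$ (i, j) * x $ j)"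
      unfolding sum_state_apply by (intro sum.cong) (auto simp: us smul_apply)
    also have "\<dots> = (M *\<^sub>v x) $ i"
      unfolding mult_mat_vec_index[OF M x(1) i(1)] lessThan_Suc_atMost ..
    finally show ?thesis unfolding x(3) using i(1) by simp
  qed
  then have "(\<Sum>i\<le>2 ^ n. smul (x $ i) (u i)) = 0" by (intro ext) (simp only: zero_fun_apply)
  moreover have "\<exists>i\<le>2 ^ n. x $ i \<noteq> 0"
  proof (rule ccontr)
    assume "\<not> ?thesis"
    then have "x = 0\<^sub>v (Suc (2 ^ n))" using x(1) by (intro eq_vecI) auto
    then show False using x(2) by blast
  qed
  ultimately show "\<exists>c. (\<exists>i\<le>2 ^ n. c i \<noteq> 0) \<and> (\<Sum>i\<le>2 ^ n. smul (c i) (u i)) = 0"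
    by blast
qed

text \<open>\<open>X\<close> is injective on \<open>W\<close>, and the image meets \<open>W\<close>
  only in 0, so \<open>V\<close> has room for two copies of \<open>W\<close>. In the applications
  \<open>X\<close> is the action of a vector that takes a kernel, or an eigenspace of a grading,
  away from itself.\<close>

lemma dim_le_half:
  assumes V: "dim_le V (2 * d)" and W: "state_subspace W" "W \<subseteq> V"
    and X: "\<And>v. v \<in> W \<Longrightarrow> app X v \<in> V" "\<And>v. v \<in> W \<Longrightarrow> app X v \<in> W \<Longrightarrow> v = 0"
  shows "dim_le W d"
  unfolding dim_le_def
proof (intro allI impI)
  fix u assume u: "\<forall>i\<le>d. u i \<in> W"
  \<comment> \<open>The \<open>d + 1\<close> vectors are followed by the images of the first
    \<open>d\<close> of them: together the \<open>2 * d + 1\<close> vectors that a bound of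
    \<open>2 * d\<close> calls for.\<close>
  define w where "w i = (if i \<le> d then u i else app X (u (i - Suc d)))" for i
  have wV: "w i \<in> V" if "i \<le> 2 * d" for i
  proof (cases "i \<le> d")
    case False
    then have "i - Suc d \<le> d" using that by simp
    then show ?thesis using False u X(1) by (simp add: w_def)
  qed (use u W(2) in \<open>auto simp: w_def\<close>)
  obtain c where c: "\<exists>i\<le>2 * d. c i \<noteq> 0" "(\<Sum>i\<le>2 * d. smul (c i) (w i)) = 0"
    by (rule dim_leE[OF V wV])
  define a where "a = (\<Sum>i\<le>d. smul (c i) (u i))"
  define b where "b = (\<Sum>j<d. smul (c (Suc d + j)) (u j))"
  have split: "{..2 * d} = {..d} \<union> (\<lambda>j. Suc d + j) ` {..<d}"
  proof (intro equalityI subsetI)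
    fix i assume i: "i \<in> {..2 * d}"
    show "i \<in> {..d} \<union> (\<lambda>j. Suc d + j) ` {..<d}"
    proof (cases "i \<le> d")
      case False
      then have "i = Suc d + (i - Suc d)" "i - Suc d < d" using i by auto
      then show ?thesis by blast
    qed simp
  qed auto
  have "(\<Sum>i\<le>2 * d. smul (c i) (w i)) = (\<Sum>i\<le>d. smul (c i) (w i)) + (\<Sum>i\<in>(\<lambda>j. Suc d + j) ` {..<d}. smul (c i) (w i))"
    unfolding split by (rule sum.union_disjoint) auto
  also have "(\<Sum>i\<le>d. smul (c i) (w i)) = a" unfolding a_def by (intro sum.cong) (auto simp: w_def)
  also have "(\<Sum>i\<in>(\<lambda>j. Suc d + j) ` {..<d}. smul (c i) (w i)) = app X b"
    unfolding b_def app_sum app_smul by (subst sum.reindex) (auto simp: w_def inj_on_def)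
  finally have ab: "a + app X b = 0" using c(2) by simp
  have aW: "a \<in> W" unfolding a_def using u by (intro state_subspace_sum[OF W(1)]) auto
  have bW: "b \<in> W" unfolding b_def using u by (intro state_subspace_sum[OF W(1)]) auto
  \<comment> \<open>The relation puts \<open>X b\<close> into \<open>W\<close>, so \<open>b\<close>
    and then \<open>a\<close> vanish separately. Whichever half has a nonzero coefficient is the
    desired dependence.\<close>
  have "app X b = smul (- 1) a"
    using ab by (simp add: pointwise) (metis add.commute add_eq_0_iff minus_unique)
  then have "app X b \<in> W" using state_subspaceD(3)[OF W(1) aW] by simp
  then have b0: "b = 0" using X(2) bW by blast
  then have a0: "a = 0" using ab by (simp add: app_zero)
  show "\<exists>c. (\<exists>i\<le>d. c i \<noteq> 0) \<and> (\<Sum>i\<le>d. smul (c i) (u i)) = 0"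
  proof (cases "\<exists>i\<le>d. c i \<noteq> 0")
    case True
    then show ?thesis using a0 unfolding a_def by blast
  next
    case False
    then obtain i where i: "i \<le> 2 * d" "\<not> i \<le> d" "c i \<noteq> 0" using c(1) by blast
    then have j: "i - Suc d < d" "Suc d + (i - Suc d) = i" by auto
    define c' where "c' j = (if j < d then c (Suc d + j) else 0)" for j
    have "(\<Sum>j\<le>d. smul (c' j) (u j)) = (\<Sum>j<d. smul (c' j) (u j))"
      by (rule sum.mono_neutral_right) (auto simp: c'_def smul_simps)
    also have "\<dots> = b" unfolding b_def by (intro sum.cong) (auto simp: c'_def)
    finally have "(\<Sum>j\<le>d. smul (c' j) (u j)) = 0" using b0 by simp
    moreover have "c' (i - Suc d) \<noteq> 0" using i j by (simp add: c'_def)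
    ultimately show ?thesis using j(1) less_imp_le by blast
  qed
qed

text \<open>A dependence among the images of the first \<open>d + 1\<close> unit vectors is a kernel
  vector.\<close>

lemma dim_le_kernel:
  assumes V: "dim_le V d" and dn: "d < n"
    and L: "\<And>x. x \<in> carrier_vec n \<Longrightarrow> L x \<in> V"
      "\<And>x y. x \<in> carrier_vec n \<Longrightarrow> y \<in> carrier_vec n \<Longrightarrow> L (x + y) = L x + L y"
      "\<And>c x. x \<in> carrier_vec n \<Longrightarrow> L (c \<cdot>\<^sub>v x) = smul c (L x)"
  obtains x where "x \<in> carrier_vec n" "x \<noteq> 0\<^sub>v n" "L x = 0"
proof -
  have "L (unit_vec n i) \<in> V" for i by (rule L(1)) simp
  then obtain c where c: "\<exists>i\<le>d. c i \<noteq> 0" "(\<Sum>i\<le>d. smul (c i) (L (unit_vec n i))) = 0"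
    using dim_leE[OF V, of "\<lambda>i. L (unit_vec n i)"] by blast
  have L0: "L (0\<^sub>v n) = 0"
    using L(3)[of "0\<^sub>v n" 0] by (simp add: smul_simps smult_zero_vec[OF zero_carrier_vec])
  have part: "k \<le> n \<Longrightarrow> L (vec n (\<lambda>i. if i < k then c i else 0)) = (\<Sum>i<k. smul (c i) (L (unit_vec n i)))" for k
  proof (induction k)
    case 0
    have "vec n (\<lambda>i. if i < 0 then c i else 0) = 0\<^sub>v n" by auto
    then show ?case using L0 by simp
  next
    case (Suc k)
    have "vec n (\<lambda>i. if i < Suc k then c i else 0) =
        vec n (\<lambda>i. if i < k then c i else 0) + c k \<cdot>\<^sub>v unit_vec n k"
      using Suc.prems by (intro eq_vecI) (auto simp: unit_vec_def less_Suc_eq)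
    then show ?case using Suc by (simp add: L(2,3))
  qed
  let ?x = "vec n (\<lambda>i. if i < Suc d then c i else 0)"
  have "L ?x = 0" using part[of "Suc d"] dn c(2) by (simp add: lessThan_Suc_atMost)
  moreover obtain i where i: "i \<le> d" "c i \<noteq> 0" using c(1) by blast
  then have "?x $ i \<noteq> 0\<^sub>v n $ i" using dn by simp
  then have "?x \<noteq> 0\<^sub>v n" by metis
  ultimately show ?thesis by (intro that[of ?x]) auto
qed

section \<open>Small modules force isotropic vectors\<close>

context char_two
begin

text \<open>Compared with \<open>cliffordian\<close>, the space is an arbitrary invariant subspace
  of states: the kernels that arise on cancelling planes are no longer tensor products over sites.
  An upper bound on the dimension and one nonzero vector are enough for the counting
  arguments.\<close>

definition has_module :: "'a mat \<Rightarrow> bool" where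
  "has_module A \<longleftrightarrow> (\<exists>\<rho> Z V. clif A \<rho> Z 0 \<and> state_subspace V \<and>
     (\<forall>x\<in>carrier_vec (qdim A). \<forall>v\<in>V. app (\<rho> x) v \<in> V) \<and> (\<forall>v\<in>V. app Z v \<in> V) \<and>
     (\<exists>v\<in>V. v \<noteq> 0) \<and> dim_le V (2 ^ (qdim A div 2)))"

lemma has_module_cliffordian:
  assumes "cliffordian A"
  shows "has_module A"
proof -
  obtain \<rho> Z where 1: "clif A \<rho> Z 0" "\<And>x. x \<in> carrier_vec (qdim A) \<Longrightarrow> \<rho> x \<in> loc {0..<0 + qdim A div 2}"
    "Z \<in> loc {0..<0 + qdim A div 2}"
    using assms unfolding cliffordian_def by blast
  let ?V = "local_states (qdim A div 2) :: 'a state set"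
  have sub: "{0..<0 + qdim A div 2} \<subseteq> {..<qdim A div 2}" by auto
  have "(\<lambda>s. 1) \<in> ?V" "(\<lambda>s. 1 :: 'a) \<noteq> (0 :: 'a state)" by (auto simp: local_states_def pointwise)
  then have "\<exists>v\<in>?V. v \<noteq> 0" by blast
  then show ?thesis unfolding has_module_def
    using 1(1) local_states_subspace dim_le_local_states app_local_states[OF 1(2) sub] app_local_states[OF 1(3) sub]
    by (intro exI[of _ \<rho>] exI[of _ Z] exI[of _ ?V] conjI) auto
qed

lemma has_module_qiso:
  assumes "A \<cong>\<^sub>q B" "has_module A"
  shows "has_module B"
proof -
  obtain \<rho> Z V v where 1: "clif A \<rho> Z 0" "state_subspace V"
    "\<And>x v. x \<in> carrier_vec (qdim A) \<Longrightarrow> v \<in> V \<Longrightarrow> app (\<rho> x) v \<in> V" "\<And>v. v \<in> V \<Longrightarrow> app Z v \<in> V"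
    "v \<in> V" "v \<noteq> 0" "dim_le V (2 ^ (qdim A div 2))" using assms(2) unfolding has_module_def by blast
  have qf: "quadratic_form A" and iso: "A \<simeq>\<^sub>q B" using assms(1) by (auto simp: qiso_def)
  have d: "qdim B = qdim A" using isometric_qdim[OF iso] by simp
  obtain g where g: "lin (qdim A) (qdim A) g" "\<And>x. x \<in> carrier_vec (qdim A) \<Longrightarrow> qeval A (g x) = qeval B x"
    using isometricE[OF iso quadratic_form_carrier[OF qf]] by metis
  have "clif B (\<lambda>x. \<rho> (g x)) Z 0"
    by (rule clif_pullback[OF 1(1)]) (simp_all only: d g)
  then show ?thesis unfolding has_module_def d
    using 1 lin_carrier[OF g(1)] by blast
qed

text \<open>By \<open>e * f + f * e = 1\<close>, the operator \<open>f\<close> takes the kernel of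
  \<open>e\<close> away from itself, so the kernel has at most half the dimension. It is invariant
  because \<open>e\<close> commutes with the action of \<open>B\<close> and passes \<open>Z\<close>
  up to adding \<open>e\<close>. It is nonzero because of \<open>e * e = 0\<close>: if
  \<open>e\<close> does not kill a vector, it kills the image.\<close>

lemma has_module_cancel_plane:
  assumes B: "quadratic_form B" and m: "has_module (binary_form 0 0 \<bottom>\<^sub>q B)"
  shows "has_module B"
proof -
  let ?H = "binary_form 0 0 :: 'a mat" and ?n = "qdim B"
  obtain \<rho> Z V v where 1: "clif (?H \<bottom>\<^sub>q B) \<rho> Z 0" "state_subspace V"
    "\<And>x v. x \<in> carrier_vec (2 + ?n) \<Longrightarrow> v \<in> V \<Longrightarrow> app (\<rho> x) v \<in> V" "\<And>v. v \<in> V \<Longrightarrow> app Z v \<in> V"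
    "v \<in> V" "v \<noteq> 0" "dim_le V (2 ^ ((2 + ?n) div 2))"
    using m unfolding has_module_def qdim_orth_sum qdim_binary by blast
  note sub = state_subspaceD[OF 1(2)]
  note Bc = quadratic_form_carrier[OF B]
  have dim: "dim_le V (2 * 2 ^ (?n div 2))" using 1(7) by simp
  define e f where "e = \<rho> (unit_vec 2 0 @\<^sub>v 0\<^sub>v ?n)" and "f = \<rho> (unit_vec 2 1 @\<^sub>v 0\<^sub>v ?n)"
  define \<sigma> where "\<sigma> x = \<rho> (0\<^sub>v 2 @\<^sub>v x)" for x
  have u: "unit_vec 2 0 @\<^sub>v 0\<^sub>v ?n \<in> carrier_vec (2 + ?n)" "unit_vec 2 1 @\<^sub>v 0\<^sub>v ?n \<in> carrier_vec (2 + ?n)"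
    by (intro append_carrier_vec unit_vec_carrier zero_carrier_vec)+
  have w: "0\<^sub>v 2 @\<^sub>v x \<in> carrier_vec (2 + ?n)" if "x \<in> carrier_vec ?n" for x :: "'a vec"
    using that by (intro append_carrier_vec zero_carrier_vec)
  have ee: "e * e = 0"
    using clifD(3)[OF 1(1), of "unit_vec 2 0 @\<^sub>v 0\<^sub>v ?n"] u
    by (simp add: e_def qeval_orth_sum[OF binary_form_carrier Bc] qeval_zero[OF Bc] qeval_binary scal_ring)
  have ef: "e * f + f * e = 1"
    using clif_polar[OF 1(1), of "unit_vec 2 0 @\<^sub>v 0\<^sub>v ?n" "unit_vec 2 1 @\<^sub>v 0\<^sub>v ?n"] u
    by (simp add: e_def f_def polar_orth_sum[OF binary_form_carrier Bc] polar_zero_right[OF Bc] polar_binary scal_ring)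
  have es: "e * \<sigma> x = \<sigma> x * e" if "x \<in> carrier_vec ?n" for x
    using clif_summands_commute[OF 1(1) quadratic_form_binary B _ that, of "unit_vec 2 0"] by (simp add: e_def \<sigma>_def)
  have "Z * e = e * (1 + Z)" using clifD(4)[OF 1(1), of "unit_vec 2 0 @\<^sub>v 0\<^sub>v ?n"] u by (simp add: e_def)
  then have Ze: "e * Z = Z * e + e"
    by (simp add: ring_distribs lop_add_self_left ac_simps)
  define W where "W = {v \<in> V. app e v = 0}"
  have Ws: "state_subspace W"
    unfolding state_subspace_def W_def using sub by (auto simp: app_zero app_add app_smul smul_simps)
  have "app (\<sigma> x) v \<in> W" if "x \<in> carrier_vec ?n" "v \<in> W" for x v
    using that 1(3)[OF w[OF that(1)]] es[OF that(1)]
    by (simp add: W_def \<sigma>_def flip: app_ring(6)) (simp add: app_ring app_zero)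
  moreover have "app Z v \<in> W" if "v \<in> W" for v
    using that 1(4) by (simp add: W_def Ze flip: app_ring(6)) (simp add: app_ring app_zero)
  moreover have "\<exists>v\<in>W. v \<noteq> 0"
  proof (cases "app e v = 0")
    case False
    have "app e (app e v) = 0" by (simp add: ee app_ring(1) flip: app_ring(6))
    moreover have "app e v \<in> V" unfolding e_def using 1(3)[OF u(1)] 1(5) by simp
    ultimately show ?thesis using False unfolding W_def by blast
  qed (use 1 W_def in blast)
  moreover have "dim_le W (2 ^ (?n div 2))"
  proof (rule dim_le_half[OF dim Ws])
    show "W \<subseteq> V" by (auto simp: W_def)
    show "app f v \<in> V" if "v \<in> W" for v using that 1(3)[OF u(2)] by (simp add: W_def f_def)
    fix v assume v: "v \<in> W" "app f v \<in> W"
    have "v = app (e * f + f * e) v" by (simp add: ef app_ring)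
    also have "\<dots> = 0" using v by (simp add: app_ring W_def app_zero)
    finally show "v = 0" .
  qed
  moreover have "clif B \<sigma> Z 0"
    using clif_summands(2)[OF 1(1) quadratic_form_binary B] unfolding \<sigma>_def by simp
  ultimately show ?thesis unfolding has_module_def using Ws by blast
qed

lemma has_module_cancel:
  assumes B: "quadratic_form B" and "has_module (B \<bottom>\<^sub>q hyperbolic m)"
  shows "has_module B"
proof -
  have "has_module (hyperbolic m \<bottom>\<^sub>q B)"
    by (rule has_module_qiso[OF qiso_commute[OF B quadratic_form_hyperbolic] assms(2)])
  then show ?thesis
  proof (induction m)
    case 0
    then show ?case by (simp add: orth_sum_zero_left[OF quadratic_form_carrier[OF B]])
  next
    case (Suc m)
    have "has_module (binary_form 0 0 \<bottom>\<^sub>q (hyperbolic m \<bottom>\<^sub>q B))"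
      by (rule has_module_qiso[OF qiso_assoc]) (use Suc.prems in \<open>auto simp: B qf_intros\<close>)
    then show ?case by (intro Suc.IH has_module_cancel_plane[of "hyperbolic m \<bottom>\<^sub>q B"] qf_intros B)
  qed
qed

text \<open>The even part of the module has dimension at most \<open>2 ^ (n - 1)\<close> for a form of dimension \<open>2 * n\<close>,
  which is less than \<open>2 * n\<close> for \<open>n \<le> 3\<close>; so \<open>x \<mapsto> \<rho> x v\<close> has a kernel for each \<open>v\<close>.\<close>

lemma isotropic_if_module:
  assumes m: "has_module A" and A: "quadratic_form A" "even (qdim A)" "0 < qdim A" "qdim A \<le> 6"
  shows "\<not> anisotropic A"
proof
  assume an: "anisotropic A"
  obtain \<rho> Z V v0 where 1: "clif A \<rho> Z 0" "state_subspace V"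
    "\<And>x v. x \<in> carrier_vec (qdim A) \<Longrightarrow> v \<in> V \<Longrightarrow> app (\<rho> x) v \<in> V" "\<And>v. v \<in> V \<Longrightarrow> app Z v \<in> V"
    "v0 \<in> V" "v0 \<noteq> 0" "dim_le V (2 ^ (qdim A div 2))" using m unfolding has_module_def by blast
  note sub = state_subspaceD[OF 1(2)]
  define k where "k = qdim A div 2 - 1"
  have k: "qdim A = 2 * Suc k" "k \<le> 2" using A(2-4) by (auto simp: k_def elim!: evenE)
  have dim: "dim_le V (2 * 2 ^ k)" using 1(7) k(1) by simp
  let ?u = "unit_vec (qdim A) 0 :: 'a vec"
  have u: "?u \<in> carrier_vec (qdim A)" by simp
  have qu: "qeval A ?u \<noteq> 0" using anisotropicD[OF an u] A(3) unit_vec_nonzero by blast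
  define e where "e = \<rho> ?u"
  have ee: "app e (app e v) = smul (qeval A ?u) v" for v
    using clifD(3)[OF 1(1) u] by (metis app_ring(6) app_scal e_def)
  have Zr: "app Z (app (\<rho> x) v) = app (\<rho> x) (v + app Z v)" if "x \<in> carrier_vec (qdim A)" for x v
    using clifD(4)[OF 1(1) that] by (metis app_ring(2,3,6))
  have ZZ: "app Z (app Z v) = app Z v" for v
    using clifD(5)[OF 1(1)] by (metis add_0_right app_ring(6) scal_ring(1))
  have e0: "v = 0" if "app e v = 0" for v
    using ee[of v] qu that by (simp add: app_zero smul_eq_0)
  \<comment> \<open>The eigenspace of \<open>Z\<close> for 1. A vector of nonzero value acts
    invertibly and moves it to the eigenspace for 0, so the first unit vector halves the
    dimension.\<close>
  define W where "W = {v \<in> V. app Z v = v}"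
  have Ws: "state_subspace W"
    unfolding state_subspace_def W_def using sub by (auto simp: app_zero app_add app_smul)
  have dimW: "dim_le W (2 ^ k)"
  proof (rule dim_le_half[OF dim Ws])
    show "W \<subseteq> V" by (auto simp: W_def)
    show "app e v \<in> V" if "v \<in> W" for v using that 1(3)[OF u] by (simp add: W_def e_def)
    fix v assume v: "v \<in> W" "app e v \<in> W"
    then have "app e v = 0" using Zr[OF u, of v] by (simp add: W_def e_def state_add_self app_zero)
    then show "v = 0" by (rule e0)
  qed
  obtain v where v: "v \<in> W" "v \<noteq> 0"
  proof (cases "app Z v0 = 0")
    case False
    then show ?thesis using that[of "app Z v0"] 1(4,5) ZZ by (simp add: W_def)
  next
    case True
    then have "app e v0 \<in> W" using Zr[OF u, of v0] 1(3)[OF u 1(5)] by (simp add: W_def e_def)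
    then show ?thesis using that e0 1(6) by blast
  qed
  \<comment> \<open>The inequalities are 1 < 2, 2 < 4 and 4 < 6. The next one, 8 < 8, fails, in
    accordance with anisotropic 3-fold Pfister forms.\<close>
  have small: "2 ^ k < qdim A"
  proof -
    have "k = 0 \<or> k = 1 \<or> k = 2" using k(2) by auto
    then show ?thesis unfolding k(1) by auto
  qed
  \<comment> \<open>A single vector leads out of \<open>W\<close>; the invertible factor
    \<open>e\<close> brings the result back, so that the linear map has the small space as its
    target.\<close>
  obtain x where x: "x \<in> carrier_vec (qdim A)" "x \<noteq> 0\<^sub>v (qdim A)" "app e (app (\<rho> x) v) = 0"
  proof (rule dim_le_kernel[OF dimW small, of "\<lambda>x. app e (app (\<rho> x) v)"])
    fix x y :: "'a vec" and c assume x: "x \<in> carrier_vec (qdim A)"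
    have "app Z (app (\<rho> x) v) = 0" using Zr[OF x, of v] v(1) by (simp add: W_def state_add_self app_zero)
    then show "app e (app (\<rho> x) v) \<in> W"
      using Zr[OF u, of "app (\<rho> x) v"] v(1) 1(3)[OF u 1(3)[OF x]] by (simp add: W_def e_def)
    show "app e (app (\<rho> (c \<cdot>\<^sub>v x)) v) = smul c (app e (app (\<rho> x) v))"
      by (simp add: clifD(2)[OF 1(1) x] app_ring app_scal app_smul)
    assume "y \<in> carrier_vec (qdim A)"
    then show "app e (app (\<rho> (x + y)) v) = app e (app (\<rho> x) v) + app e (app (\<rho> y) v)"
      by (simp add: clifD(1)[OF 1(1) x] app_ring app_add)
  qed
  have "app (\<rho> x) v = 0" by (rule e0[OF x(3)])
  then have "smul (qeval A x) v = 0" using clifD(3)[OF 1(1) x(1)] by (metis app_ring(6) app_scal app_zero)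
  then have "qeval A x = 0" using v(2) by (simp add: smul_eq_0)
  then show False using anisotropicD[OF an x(1)] x(2) by blast
qed

lemma witt_class_trivial_if_module:
  assumes "has_module A" "A \<in> even_nonsingular_forms" "qdim A \<le> 6"
  shows "witt_class A = \<one>\<^bsub>witt_group\<^esub>"
  using assms
proof (induction "qdim A" arbitrary: A rule: less_induct)
  case less
  note A = even_nonsingularD[OF less.prems(2)]
  show ?case
  proof (cases "qdim A = 0")
    case True
    then have "A = 0\<^sub>m 0 0" using A(4) by (intro eq_matI) auto
    then show ?thesis by (simp add: witt_one)
  next
    case False
    then obtain B where B: "quadratic_form B" "nonsingular B" "qdim A = 2 + qdim B" "A \<cong>\<^sub>q binary_form 0 0 \<bottom>\<^sub>q B"
      using isotropic_splitting[OF A(1,3)] isotropic_if_module[OF less.prems(1) A(1,2) _ less.prems(3)] by blast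
    have "has_module B" by (rule has_module_cancel_plane[OF B(1) has_module_qiso[OF B(4) less.prems(1)]])
    then show ?thesis
      using less.hyps[of B] witt_class_cancel_plane[OF B(4) less.prems(2) B(1,2)] B(3) less.prems(3) by simp
  qed
qed

end

section \<open>A six-dimensional form next to a multiple of a 2-fold Pfister form\<close>

lemma qeval_pfister1:
  assumes z: "z \<in> carrier_vec 4"
  shows "qeval (d \<cdot>\<^sub>m pfister_form [b] a) z =
    d * ((z $ 0)\<^sup>2 + z $ 0 * z $ 1 + a * (z $ 1)\<^sup>2 + b * ((z $ 2)\<^sup>2 + z $ 2 * z $ 3 + a * (z $ 3)\<^sup>2))"
proof -
  obtain x y where xy: "x \<in> carrier_vec 2" "y \<in> carrier_vec 2" "z = x @\<^sub>v y"
    using append_split[of z 2 2] z by auto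
  have i: "z $ 0 = x $ 0" "z $ 1 = x $ 1" "z $ 2 = y $ 0" "z $ 3 = y $ 1" using xy by auto
  have B: "b \<cdot>\<^sub>m binary_form 1 a \<in> carrier_mat 2 2" by simp
  have "pfister_form [b] a \<in> carrier_mat 4 4"
    using orth_sum_carrier[OF binary_form_carrier B, of 1 a] by (simp add: bilinear_tensor_def)
  then have "qeval (d \<cdot>\<^sub>m pfister_form [b] a) z = d * qeval (pfister_form [b] a) z" using z by (rule qeval_smult)
  then show ?thesis unfolding i
    using xy qeval_orth_sum[OF binary_form_carrier B xy(1,2), of 1 a]
    by (simp add: bilinear_tensor_def qeval_smult[OF binary_form_carrier] qeval_binary)
qed

lemma quadratic_form_pfister: "quadratic_form (pfister_form bs a)"
  by (induction bs) (auto simp: bilinear_tensor_def intro!: quadratic_form_orth_sum quadratic_form_smult quadratic_form_binary)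

context char_two
begin

text \<open>The idempotent \<open>\<zeta>\<close> generating the centre of the even Clifford algebra of a multiple of a 2-fold
  Pfister form; it exists over the base field because the Arf invariant of the form vanishes.\<close>

lemma polar_pfister1:
  fixes a b d :: 'a
  assumes "y \<in> carrier_vec 4" "z \<in> carrier_vec 4"
  shows "polar (d \<cdot>\<^sub>m pfister_form [b] a) y z =
    d * (y $ 0 * z $ 1 + y $ 1 * z $ 0 + b * (y $ 2 * z $ 3 + y $ 3 * z $ 2))"
proof -
  have *: "(r + s)\<^sup>2 = r\<^sup>2 + s\<^sup>2" for r s :: 'a
    using add_self[of "r * s"] by (simp add: power2_eq_square algebra_simps)
  show ?thesis
    using assms unfolding polar_def
    by (simp add: qeval_pfister1 * del: pfister_form.simps) (simp add: algebra_simps char_simps)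
qed

lemma pfister_grading:
  fixes a b d :: 'a
  defines "\<psi> \<equiv> d \<cdot>\<^sub>m pfister_form [b] a"
  assumes nz: "b \<noteq> 0" "d \<noteq> 0" and cl: "clif \<psi> \<sigma> Z z"
  obtains \<zeta> where "clif \<psi> \<sigma> \<zeta> 0" "Z * \<zeta> = \<zeta> * Z"
    "\<And>X. (\<And>y. y \<in> carrier_vec 4 \<Longrightarrow> X * \<sigma> y = \<sigma> y * X) \<Longrightarrow> X * \<zeta> = \<zeta> * X"
    "\<And>W v. (\<And>y v. y \<in> carrier_vec 4 \<Longrightarrow> v \<in> W \<Longrightarrow> app (\<sigma> y) v \<in> W) \<Longrightarrow> state_subspace W \<Longrightarrow>
       v \<in> W \<Longrightarrow> app \<zeta> v \<in> W"
proof -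
  have qd: "qdim \<psi> = 4" by (simp add: \<psi>_def bilinear_tensor_def)
  note D = clifD[OF cl, unfolded qd]
  define e f g h where "e = \<sigma> (unit_vec 4 0)" and "f = \<sigma> (unit_vec 4 1)"
    and "g = \<sigma> (unit_vec 4 2)" and "h = \<sigma> (unit_vec 4 3)"
  note E = e_def f_def g_def h_def
  have sq: "e * e = scal d" "f * f = scal (d * a)" "g * g = scal (d * b)" "h * h = scal (d * (b * a))"
    unfolding E by (simp_all add: D(3) \<psi>_def qeval_pfister1 del: pfister_form.simps)
  have "f * e + e * f = scal d" "h * g + g * h = scal (d * b)" "g * e + e * g = scal 0" "h * e + e * h = scal 0"
    "g * f + f * g = scal 0" "h * f + f * h = scal 0"
    unfolding E
    by (simp_all add: clif_polar[OF cl, unfolded qd]) (simp_all add: \<psi>_def polar_pfister1 del: pfister_form.simps)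
  then have "f * e = e * f + scal d" "h * g = g * h + scal (d * b)" "g * e = e * g" "h * e = e * h"
    "g * f = f * g" "h * f = f * h"
    unfolding scal_ring(1) lop_add_eq_0 by (metis add.commute add.right_neutral add.assoc lop_add_self)+
  note base = sq this
  have left: "Y * (Z * T) = U * T" if "Y * Z = U" for Y Z U T :: "'a lop"
    using that by (simp flip: mult.assoc)
  note sc = scal_commute[of e] scal_commute[of f] scal_commute[of g] scal_commute[of h]
    scal_left_commute[of e] scal_left_commute[of f] scal_left_commute[of g] scal_left_commute[of h]
  note rules = ring_distribs mult.assoc base base[THEN left] sc scal_merge ac_simps char_simps
  \<comment> \<open>Each symplectic pair contributes its product divided by its polar value, and
    each contribution satisfies \<open>t * t = t + scal a\<close>. The two constants cancel, which
    is the vanishing of the Arf invariant. Being even, \<open>\<zeta>\<close> commutes with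
    \<open>Z\<close>.\<close>
  define \<zeta> where "\<zeta> = scal (1 / d) * (e * f) + scal (1 / (d * b)) * (g * h)"
  have expand: "\<sigma> y = scal (y $ 0) * e + (scal (y $ 1) * f + (scal (y $ 2) * g + scal (y $ 3) * h))"
    if y: "y \<in> carrier_vec 4" for y
  proof -
    have "y = (y $ 0) \<cdot>\<^sub>v unit_vec 4 0 + ((y $ 1) \<cdot>\<^sub>v unit_vec 4 1 + ((y $ 2) \<cdot>\<^sub>v unit_vec 4 2 + (y $ 3) \<cdot>\<^sub>v unit_vec 4 3))"
    proof (rule eq_vecI)
      fix i assume "i < dim_vec ((y $ 0) \<cdot>\<^sub>v unit_vec 4 0 + ((y $ 1) \<cdot>\<^sub>v unit_vec 4 1 + ((y $ 2) \<cdot>\<^sub>v unit_vec 4 2 + (y $ 3) \<cdot>\<^sub>v unit_vec 4 3)))"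
      then have "i = 0 \<or> i = 1 \<or> i = 2 \<or> i = 3" by auto
      then show "y $ i = ((y $ 0) \<cdot>\<^sub>v unit_vec 4 0 + ((y $ 1) \<cdot>\<^sub>v unit_vec 4 1 + ((y $ 2) \<cdot>\<^sub>v unit_vec 4 2 + (y $ 3) \<cdot>\<^sub>v unit_vec 4 3))) $ i"
        by (elim disjE) simp_all
    qed (use y in simp)
    then have "\<sigma> y = \<sigma> ((y $ 0) \<cdot>\<^sub>v unit_vec 4 0 + ((y $ 1) \<cdot>\<^sub>v unit_vec 4 1 + ((y $ 2) \<cdot>\<^sub>v unit_vec 4 2 + (y $ 3) \<cdot>\<^sub>v unit_vec 4 3)))"
      by (rule arg_cong)
    then show ?thesis by (simp only: D(1,2) E smult_carrier_vec unit_vec_carrier add_carrier_vec)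
  qed
  have \<zeta>E: "\<zeta> * e = e + e * \<zeta>" "\<zeta> * f = f + f * \<zeta>" "\<zeta> * g = g + g * \<zeta>" "\<zeta> * h = h + h * \<zeta>"
    unfolding \<zeta>_def using nz by (simp_all add: rules scal_ring(2))
  have 1: "clif \<psi> \<sigma> \<zeta> 0"
  proof (rule clifI, unfold qd)
    fix y :: "'a vec" assume y: "y \<in> carrier_vec 4"
    show "\<zeta> * \<sigma> y = \<sigma> y * (1 + \<zeta>)"
      unfolding expand[OF y] by (simp add: ring_distribs scal_left_commute[of \<zeta>] \<zeta>E mult.assoc ac_simps)
  next
    show "\<zeta> * \<zeta> = \<zeta> + scal 0"
      unfolding \<zeta>_def scal_ring(1) using nz by (simp add: rules)
  qed (use D in auto)
  have Zr: "Z * e = e * (1 + Z)" "Z * f = f * (1 + Z)" "Z * g = g * (1 + Z)" "Z * h = h * (1 + Z)"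
    unfolding E by (simp_all add: D(4))
  have 2: "Z * \<zeta> = \<zeta> * Z"
    unfolding \<zeta>_def by (simp add: ring_distribs scal_left_commute[of Z] mult.assoc Zr Zr[THEN left] ac_simps char_simps)
  have 3: "X * \<zeta> = \<zeta> * X" if "\<And>y. y \<in> carrier_vec 4 \<Longrightarrow> X * \<sigma> y = \<sigma> y * X" for X
  proof -
    have X: "X * e = e * X" "X * f = f * X" "X * g = g * X" "X * h = h * X" unfolding E by (simp_all add: that)
    show ?thesis
      unfolding \<zeta>_def by (simp add: ring_distribs scal_left_commute[of X] mult.assoc X X[THEN left])
  qed
  have 4: "app \<zeta> v \<in> W" if W: "\<And>y v. y \<in> carrier_vec 4 \<Longrightarrow> v \<in> W \<Longrightarrow> app (\<sigma> y) v \<in> W" "state_subspace W" "v \<in> W" for W v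
    unfolding \<zeta>_def E app_ring app_scal
    by (intro state_subspaceD[OF W(2)] W(1,3) unit_vec_carrier)
  show ?thesis by (rule that[OF 1 2 3 4])
qed

lemma smult_vec_eq_zero: "x \<in> carrier_vec n \<Longrightarrow> c \<cdot>\<^sub>v x = 0\<^sub>v n \<Longrightarrow> c = 0 \<or> x = 0\<^sub>v n" for c :: "'b::field"
proof -
  assume x: "x \<in> carrier_vec n" and 0: "c \<cdot>\<^sub>v x = 0\<^sub>v n"
  have "c * x $ i = 0" if "i < n" for i using arg_cong[OF 0, of "\<lambda>y. y $ i"] x that by simp
  then show "c = 0 \<or> x = 0\<^sub>v n" using x by (auto intro!: eq_vecI)
qed

text \<open>The two gradings split the module into four isomorphic pieces, of dimension at most 8. A vector \<open>v\<close> of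
  one piece is sent to the same piece by \<open>\<rho> e \<rho> x\<close> for \<open>x\<close> in the 6-dimensional form and by
  \<open>\<rho> f \<rho> z\<close> for \<open>z\<close> in the 4-dimensional one. As \<open>6 + 4 > 8 + 1\<close>, some pair \<open>(x, z)\<close> independent of
  \<open>(e, f)\<close> satisfies \<open>\<rho> e \<rho> x v = \<rho> f \<rho> z v\<close>.\<close>

lemma common_plane:
  fixes a b d :: 'a
  defines "\<psi> \<equiv> d \<cdot>\<^sub>m pfister_form [b] a"
  assumes nz: "b \<noteq> 0" "d \<noteq> 0" and A: "quadratic_form A" "qdim A = 6"
    and m: "has_module (A \<bottom>\<^sub>q \<psi>)" and an: "anisotropic \<psi>" "anisotropic A"
    and u: "u \<in> carrier_vec 6" "qeval A u = d"
  shows "totally_isotropic 2 (A \<bottom>\<^sub>q \<psi>)"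
proof -
  have q\<psi>: "quadratic_form \<psi>" unfolding \<psi>_def by (intro quadratic_form_smult quadratic_form_pfister)
  have qd: "qdim \<psi> = 4" by (simp add: \<psi>_def bilinear_tensor_def)
  note Ac = quadratic_form_carrier[OF A(1), unfolded A(2)] and \<psi>c = quadratic_form_carrier[OF q\<psi>, unfolded qd]
  obtain \<rho> Z V v0 where 1: "clif (A \<bottom>\<^sub>q \<psi>) \<rho> Z 0" "state_subspace V"
    "\<And>x v. x \<in> carrier_vec (6 + 4) \<Longrightarrow> v \<in> V \<Longrightarrow> app (\<rho> x) v \<in> V" "\<And>v. v \<in> V \<Longrightarrow> app Z v \<in> V"
    "v0 \<in> V" "v0 \<noteq> 0" "dim_le V (2 ^ ((6 + 4) div 2))"
    using m unfolding has_module_def qdim_orth_sum qd A(2) by blast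
  note sub = state_subspaceD[OF 1(2)]
  define \<alpha> where "\<alpha> x = \<rho> (x @\<^sub>v 0\<^sub>v 4)" for x
  define \<sigma> where "\<sigma> x = \<rho> (0\<^sub>v 6 @\<^sub>v x)" for x
  have cA: "clif A \<alpha> Z 0" and cp: "clif \<psi> \<sigma> Z 0"
    using clif_summands[OF 1(1) A(1) q\<psi>] unfolding \<alpha>_def \<sigma>_def A(2) qd by auto
  have comm: "\<alpha> x * \<sigma> y = \<sigma> y * \<alpha> x" if "x \<in> carrier_vec 6" "y \<in> carrier_vec 4" for x y
    using clif_summands_commute[OF 1(1) A(1) q\<psi>] that unfolding \<alpha>_def \<sigma>_def A(2) qd by simp
  have \<alpha>V: "app (\<alpha> x) v \<in> V" if "x \<in> carrier_vec 6" "v \<in> V" for x v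
    unfolding \<alpha>_def by (intro 1(3) append_carrier_vec zero_carrier_vec that)
  have \<sigma>V: "app (\<sigma> x) v \<in> V" if "x \<in> carrier_vec 4" "v \<in> V" for x v
    unfolding \<sigma>_def by (intro 1(3) append_carrier_vec zero_carrier_vec that)
  obtain \<zeta> where z: "clif \<psi> \<sigma> \<zeta> 0" "Z * \<zeta> = \<zeta> * Z"
    "\<And>X. (\<And>y. y \<in> carrier_vec 4 \<Longrightarrow> X * \<sigma> y = \<sigma> y * X) \<Longrightarrow> X * \<zeta> = \<zeta> * X"
    "\<And>W v. (\<And>y v. y \<in> carrier_vec 4 \<Longrightarrow> v \<in> W \<Longrightarrow> app (\<sigma> y) v \<in> W) \<Longrightarrow> state_subspace W \<Longrightarrow>
       v \<in> W \<Longrightarrow> app \<zeta> v \<in> W"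
    using pfister_grading[OF nz cp[unfolded \<psi>_def]] unfolding \<psi>_def by metis
  \<comment> \<open>A Pfister form represents 1 at the first basis vector, so \<open>\<psi>\<close>
    represents \<open>d\<close> at \<open>f\<close>, as \<open>A\<close> does at \<open>u\<close>.
    The pair \<open>(u, f)\<close> is the first isotropic direction.\<close>
  define f where "f = (unit_vec 4 0 :: 'a vec)"
  have f: "f \<in> carrier_vec 4" "qeval \<psi> f = d" "f \<noteq> 0\<^sub>v 4" "f $ 0 = 1"
    unfolding f_def \<psi>_def by (simp_all add: qeval_pfister1 del: pfister_form.simps)
  note DA = clifD[OF cA, unfolded A(2)] and Dp = clifD[OF cp, unfolded qd] and Dz = clifD[OF z(1), unfolded qd]
  have \<alpha>sq: "app (\<alpha> x) (app (\<alpha> x) v) = smul (qeval A x) v" if "x \<in> carrier_vec 6" for x v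
    using DA(3)[OF that] by (metis app_ring(6) app_scal)
  have \<sigma>sq: "app (\<sigma> x) (app (\<sigma> x) v) = smul (qeval \<psi> x) v" if "x \<in> carrier_vec 4" for x v
    using Dp(3)[OF that] by (metis app_ring(6) app_scal)
  have \<alpha>Z: "app Z (app (\<alpha> x) v) = app (\<alpha> x) (v + app Z v)" if "x \<in> carrier_vec 6" for x v
    using DA(4)[OF that] by (metis app_ring(2,3,6))
  have \<sigma>Z: "app Z (app (\<sigma> x) v) = app (\<sigma> x) (v + app Z v)" if "x \<in> carrier_vec 4" for x v
    using Dp(4)[OF that] by (metis app_ring(2,3,6))
  have \<sigma>z: "app \<zeta> (app (\<sigma> x) v) = app (\<sigma> x) (v + app \<zeta> v)" if "x \<in> carrier_vec 4" for x v
    using Dz(4)[OF that] by (metis app_ring(2,3,6))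
  have \<alpha>z: "app \<zeta> (app (\<alpha> x) v) = app (\<alpha> x) (app \<zeta> v)" if "x \<in> carrier_vec 6" for x v
    using z(3)[of "\<alpha> x"] comm[OF that] by (metis app_ring(6))
  have ZZ: "app Z (app Z v) = app Z v" for v
    using DA(5) by (metis add_0_right app_ring(6) scal_ring(1))
  have zz: "app \<zeta> (app \<zeta> v) = app \<zeta> v" for v
    using Dz(5) by (metis add_0_right app_ring(6) scal_ring(1))
  have Zz: "app Z (app \<zeta> v) = app \<zeta> (app Z v)" for v
    using z(2) by (metis app_ring(6))
  have u0: "v = 0" if "app (\<alpha> u) v = 0" for v
    using \<alpha>sq[OF u(1), of v] that nz(2) by (simp add: u(2) app_zero smul_eq_0)
  have f0: "v = 0" if "app (\<sigma> f) v = 0" for v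
    using \<sigma>sq[OF f(1), of v] that nz(2) by (simp add: f(2) app_zero smul_eq_0)
  define V1 where "V1 = {v \<in> V. app \<zeta> v = v}"
  \<comment> \<open>The bounds are 32, 16, 8: \<open>\<sigma> f\<close> flips
    \<open>\<zeta>\<close>, while \<open>\<alpha> u\<close> flips \<open>Z\<close> and keeps
    \<open>\<zeta>\<close>, which is built from the other summand.\<close>
  define V2 where "V2 = {v \<in> V1. app Z v = v}"
  have V1s: "state_subspace V1" and V2s: "state_subspace V2"
    unfolding state_subspace_def V1_def V2_def using sub by (auto simp: app_zero app_add app_smul)
  have "dim_le V (2 * 16)" using 1(7) by simp
  then have d1: "dim_le V1 16"
  proof (rule dim_le_half[OF _ V1s])
    show "V1 \<subseteq> V" by (auto simp: V1_def)
    show "app (\<sigma> f) v \<in> V" if "v \<in> V1" for v using that \<sigma>V[OF f(1)] by (simp add: V1_def)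
    fix v assume v: "v \<in> V1" "app (\<sigma> f) v \<in> V1"
    then have "app (\<sigma> f) v = 0" using \<sigma>z[OF f(1), of v] by (simp add: V1_def state_add_self app_zero)
    then show "v = 0" by (rule f0)
  qed
  have "dim_le V1 (2 * 8)" using d1 by simp
  then have d2: "dim_le V2 8"
  proof (rule dim_le_half[OF _ V2s])
    show "V2 \<subseteq> V1" by (auto simp: V2_def)
    show "app (\<alpha> u) v \<in> V1" if "v \<in> V2" for v
      using that \<alpha>V[OF u(1)] \<alpha>z[OF u(1)] by (simp add: V1_def V2_def)
    fix v assume v: "v \<in> V2" "app (\<alpha> u) v \<in> V2"
    then have "app (\<alpha> u) v = 0" using \<alpha>Z[OF u(1), of v] by (simp add: V2_def state_add_self app_zero)
    then show "v = 0" by (rule u0)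
  qed
  obtain v1 where v1: "v1 \<in> V1" "v1 \<noteq> 0"
  proof (cases "app \<zeta> v0 = 0")
    case False
    then show ?thesis using that[of "app \<zeta> v0"] z(4)[OF \<sigma>V 1(2) 1(5)] zz by (simp add: V1_def)
  next
    case True
    then have "app (\<sigma> f) v0 \<in> V1" using \<sigma>z[OF f(1), of v0] \<sigma>V[OF f(1) 1(5)] by (simp add: V1_def)
    then show ?thesis using that f0 1(6) by blast
  qed
  obtain v where v: "v \<in> V2" "v \<noteq> 0"
  proof (cases "app Z v1 = 0")
    case False
    then show ?thesis using that[of "app Z v1"] 1(4) v1(1) ZZ Zz[of v1] by (simp add: V1_def V2_def)
  next
    case True
    then have "app (\<alpha> u) v1 \<in> V2"
      using \<alpha>Z[OF u(1), of v1] \<alpha>V[OF u(1)] \<alpha>z[OF u(1), of v1] v1(1) by (simp add: V1_def V2_def)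
    then show ?thesis using that u0 v1(2) by blast
  qed
  have v': "v \<in> V" "app \<zeta> v = v" "app Z v = v" using v(1) by (auto simp: V1_def V2_def)
  define P where "P x = app (\<alpha> u) (app (\<alpha> x) v)" for x
  define Q where "Q y = app (\<sigma> f) (app (\<sigma> y) v)" for y
  have PV: "P x \<in> V2" if x: "x \<in> carrier_vec 6" for x
  proof -
    have "app Z (app (\<alpha> x) v) = 0" using \<alpha>Z[OF x, of v] by (simp add: v' state_add_self app_zero)
    then show ?thesis
      using \<alpha>Z[OF u(1), of "app (\<alpha> x) v"] \<alpha>z[OF u(1)] \<alpha>z[OF x] \<alpha>V[OF u(1) \<alpha>V[OF x v'(1)]]
      by (simp add: P_def V1_def V2_def v')
  qed
  have QV: "Q y \<in> V2" if y: "y \<in> carrier_vec 4" for y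
  proof -
    have "app Z (app (\<sigma> y) v) = 0" "app \<zeta> (app (\<sigma> y) v) = 0"
      using \<sigma>Z[OF y, of v] \<sigma>z[OF y, of v] by (simp_all add: v' state_add_self app_zero)
    then show ?thesis
      using \<sigma>Z[OF f(1), of "app (\<sigma> y) v"] \<sigma>z[OF f(1), of "app (\<sigma> y) v"] \<sigma>V[OF f(1) \<sigma>V[OF y v'(1)]]
      by (simp add: Q_def V1_def V2_def)
  qed
  have Pl: "P (x + x') = P x + P x'" "P (c \<cdot>\<^sub>v x) = smul c (P x)" if "x \<in> carrier_vec 6" "x' \<in> carrier_vec 6" for x x' c
    using that by (simp_all add: P_def DA(1,2) app_ring app_add app_scal app_smul)
  have Ql: "Q (x + x') = Q x + Q x'" "Q (c \<cdot>\<^sub>v x) = smul c (Q x)" if "x \<in> carrier_vec 4" "x' \<in> carrier_vec 4" for x x' c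
    using that by (simp_all add: Q_def Dp(1,2) app_ring app_add app_scal app_smul)
  \<comment> \<open>Coordinate 6 of a pair is the entry of its second component at \<open>f\<close>.
    Setting it to 0 keeps nonzero pairs independent of \<open>(u, f)\<close> and leaves 9 parameters
    against a space of dimension 8.\<close>
  have "lin (Suc 9) 1 (\<lambda>x :: 'a vec. vec 1 (\<lambda>_. x $ 6))"
    by (rule linI) auto
  then obtain T where T: "lin 9 (Suc 9) T" "\<And>y. y \<in> carrier_vec 9 \<Longrightarrow> T y = 0\<^sub>v (Suc 9) \<Longrightarrow> y = 0\<^sub>v 9"
    "\<And>y. y \<in> carrier_vec 9 \<Longrightarrow> T y $ 6 = (0 :: 'a)"
    by (rule lin_functional_kernel) metis
  have T': "lin 9 (6 + 4) T" using T(1) by simp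
  define L where "L y = P (vec_first (T y) 6) + Q (vec_last (T y) 4)" for y
  note l1 = lin_comp[OF T' lin_first] and l2 = lin_comp[OF T' lin_last]
  obtain y where y: "y \<in> carrier_vec 9" "y \<noteq> 0\<^sub>v 9" "L y = 0"
  proof (rule dim_le_kernel[OF d2, of 9 L])
    fix x y :: "'a vec" and c assume x: "x \<in> carrier_vec 9"
    show "L x \<in> V2" unfolding L_def by (intro state_subspaceD(2)[OF V2s] PV QV vec_first_carrier vec_last_carrier)
    show "L (c \<cdot>\<^sub>v x) = smul c (L x)"
      unfolding L_def lin_smult[OF l1 x] lin_smult[OF l2 x] by (simp add: Pl(2)[OF vec_first_carrier vec_first_carrier]
          Ql(2)[OF vec_last_carrier vec_last_carrier] smul_simps)
    assume y: "y \<in> carrier_vec 9"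
    show "L (x + y) = L x + L y"
      unfolding L_def lin_add[OF l1 x y] lin_add[OF l2 x y] by (simp add: Pl(1) Ql(1) algebra_simps)
  qed simp
  define x w where "x = vec_first (T y) 6" and "w = vec_last (T y) 4"
  have x: "x \<in> carrier_vec 6" and w: "w \<in> carrier_vec 4" by (simp_all add: x_def w_def)
  have Ty: "T y = x @\<^sub>v w" unfolding x_def w_def using lin_carrier[OF T' y(1)] by simp
  have xw0: "x @\<^sub>v w \<noteq> 0\<^sub>v (6 + 4)" using T(2)[OF y(1)] y(2) by (auto simp: Ty[symmetric])
  have w0: "w $ 0 = 0" using T(3)[OF y(1)] x w by (simp add: Ty)
  have PQ: "P x = Q w" using y(3) unfolding L_def x_def[symmetric] w_def[symmetric] state_add_eq_0 .
  \<comment> \<open>\<open>s + t\<close> is the polar value of the directions \<open>(u, f)\<close>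
    and \<open>(x, w)\<close>. It has to vanish, and so does the value at
    \<open>(x, w)\<close>.\<close>
  define s t where "s = polar A u x" and "t = polar \<psi> f w"
  have "\<alpha> x * \<alpha> u = \<alpha> u * \<alpha> x + scal s"
    using clif_polar[OF cA, unfolded A(2), OF u(1) x] unfolding s_def by (metis add.commute lop_add_self_left)
  then have Px: "app (\<alpha> x) (app (\<alpha> u) r) = app (\<alpha> u) (app (\<alpha> x) r) + smul s r" for r
    by (metis app_ring(3,6) app_scal)
  have "\<sigma> w * \<sigma> f = \<sigma> f * \<sigma> w + scal t"
    using clif_polar[OF cp, unfolded qd, OF f(1) w] unfolding t_def by (metis add.commute lop_add_self_left)
  then have Qx: "app (\<sigma> w) (app (\<sigma> f) r) = app (\<sigma> f) (app (\<sigma> w) r) + smul t r" for r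
    by (metis app_ring(3,6) app_scal)
  have cm: "app (\<alpha> p) (app (\<sigma> q) r) = app (\<sigma> q) (app (\<alpha> p) r)" if "p \<in> carrier_vec 6" "q \<in> carrier_vec 4" for p q r
    using comm[OF that] by (metis app_ring(6))
  \<comment> \<open>The operators \<open>\<alpha> u * \<alpha> x\<close> and
    \<open>\<sigma> f * \<sigma> w\<close> commute and agree on \<open>v\<close>, so they also agree
    when applied to \<open>v\<close> twice. Expanding both sides compares the values of the two
    forms.\<close>
  have "app (\<alpha> u) (app (\<alpha> x) (P x)) = smul (d * qeval A x) v + smul s (P x)"
    unfolding P_def Px by (simp add: app_add app_smul \<alpha>sq[OF x] \<alpha>sq[OF u(1)] u(2) smul_simps mult.commute)
  moreover have "app (\<sigma> f) (app (\<sigma> w) (Q w)) = smul (d * qeval \<psi> w) v + smul t (Q w)"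
    unfolding Q_def Qx by (simp add: app_add app_smul \<sigma>sq[OF w] \<sigma>sq[OF f(1)] f(2) smul_simps mult.commute)
  moreover have "app (\<alpha> u) (app (\<alpha> x) (Q w)) = app (\<sigma> f) (app (\<sigma> w) (P x))"
    unfolding P_def Q_def by (simp only: cm[OF x w] cm[OF x f(1)] cm[OF u(1) w] cm[OF u(1) f(1)])
  ultimately have *: "smul (d * qeval A x) v + smul s (P x) = smul (d * qeval \<psi> w) v + smul t (P x)"
    unfolding PQ by simp
  have key: "smul (s + t) (P x) = smul (d * (qeval A x + qeval \<psi> w)) v"
  proof -
    have "smul s (P x) + smul t (P x) = smul (d * qeval A x) v + smul (d * qeval \<psi> w) v"
      using arg_cong[OF *, of "\<lambda>r. smul (d * qeval A x) v + (r + smul t (P x))"]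
      by (simp add: add.assoc state_add_self state_add_self_left)
    then show ?thesis by (simp add: smul_simps ring_distribs)
  qed
  \<comment> \<open>Otherwise \<open>P x\<close> is a multiple \<open>c\<close> of \<open>v\<close>,
    so that \<open>w + (c / d) \<cdot>\<^sub>v f\<close> annihilates \<open>v\<close> and vanishes
    by anisotropy. Its first entry is \<open>c / d\<close>, hence \<open>c = 0\<close>; then
    \<open>w\<close> and \<open>x\<close> annihilate \<open>v\<close> as well and are zero.\<close>
  have st: "s = t"
  proof (rule ccontr)
    assume ne: "s \<noteq> t"
    then have st0: "s + t \<noteq> 0" by (metis add_self add_left_cancel)
    define c where "c = d * (qeval A x + qeval \<psi> w) / (s + t)"
    have "Q w = smul (1 / (s + t)) (smul (s + t) (P x))" using st0 by (simp add: smul_simps(3,4) PQ)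
    then have Qc: "Q w = smul c v" unfolding key by (simp add: smul_simps c_def)
    have "app (\<sigma> f) (app (\<sigma> w) v + smul (c / d) (app (\<sigma> f) v)) = 0"
      unfolding app_add app_smul \<sigma>sq[OF f(1)] f(2) Qc[unfolded Q_def]
      using nz(2) by (simp add: smul_simps state_add_self)
    then have "app (\<sigma> w) v + smul (c / d) (app (\<sigma> f) v) = 0" by (rule f0)
    then have "app (\<sigma> (w + (c / d) \<cdot>\<^sub>v f)) v = 0"
      using w f(1) by (simp add: Dp(1,2) app_ring app_scal)
    then have "smul (qeval \<psi> (w + (c / d) \<cdot>\<^sub>v f)) v = 0"
      using \<sigma>sq[of "w + (c / d) \<cdot>\<^sub>v f" v] w f(1) by (simp add: app_zero)
    then have "w + (c / d) \<cdot>\<^sub>v f = 0\<^sub>v 4"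
      using anisotropicD[OF an(1), unfolded qd, of "w + (c / d) \<cdot>\<^sub>v f"] v(2) w f(1) by (simp add: smul_eq_0)
    then have "(w + (c / d) \<cdot>\<^sub>v f) $ 0 = 0" by simp
    then have "c = 0" using w f(1,4) w0 nz(2) by simp
    then have "Q w = 0" using Qc by (simp add: smul_simps)
    have "app (\<sigma> w) v = 0" using \<open>Q w = 0\<close> unfolding Q_def by (rule f0)
    moreover have "app (\<alpha> x) v = 0" using \<open>Q w = 0\<close> unfolding PQ[symmetric] P_def by (rule u0)
    ultimately have "qeval \<psi> w = 0" "qeval A x = 0"
      using \<sigma>sq[OF w, of v] \<alpha>sq[OF x, of v] v(2) by (auto simp: app_zero smul_eq_0)
    then have "w = 0\<^sub>v 4" "x = 0\<^sub>v 6"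
      using anisotropicD[OF an(1), unfolded qd, OF w] anisotropicD[OF an(2), unfolded A(2), OF x] by auto
    then show False using xw0 append_zero by metis
  qed
  have "smul (d * (qeval A x + qeval \<psi> w)) v = 0" using key unfolding st add_self by (simp add: smul_simps)
  then have qq: "qeval A x + qeval \<psi> w = 0" using v(2) nz(2) by (simp add: smul_eq_0)
  have xw: "x @\<^sub>v w \<in> carrier_vec (6 + 4)" and uf: "u @\<^sub>v f \<in> carrier_vec (6 + 4)"
    by (intro append_carrier_vec x w u f)+
  have Bc: "A \<bottom>\<^sub>q \<psi> \<in> carrier_mat (6 + 4) (6 + 4)" by (rule orth_sum_carrier[OF Ac \<psi>c])
  show ?thesis
  proof (rule totally_isotropicI, unfold qdim_orth_sum A(2) qd)
    show "lin 2 (6 + 4) (\<lambda>r. (r $ 0) \<cdot>\<^sub>v (u @\<^sub>v f) + (r $ 1) \<cdot>\<^sub>v (x @\<^sub>v w))"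
      by (intro lin_sum lin_coord uf xw) auto
    fix r :: "'a vec" assume r: "r \<in> carrier_vec 2"
    have q1: "qeval (A \<bottom>\<^sub>q \<psi>) (u @\<^sub>v f) = 0" using qeval_orth_sum[OF Ac \<psi>c u(1) f(1)] by (simp add: u(2) f(2) add_self)
    have q2: "qeval (A \<bottom>\<^sub>q \<psi>) (x @\<^sub>v w) = 0" using qeval_orth_sum[OF Ac \<psi>c x w] qq by simp
    have q3: "polar (A \<bottom>\<^sub>q \<psi>) (u @\<^sub>v f) (x @\<^sub>v w) = 0"
      using polar_orth_sum[OF Ac \<psi>c u(1) f(1) x w] st by (simp add: s_def t_def add_self)
    show "qeval (A \<bottom>\<^sub>q \<psi>) ((r $ 0) \<cdot>\<^sub>v (u @\<^sub>v f) + (r $ 1) \<cdot>\<^sub>v (x @\<^sub>v w)) = 0"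
      unfolding qeval_add qeval_smult_vec[OF Bc uf] qeval_smult_vec[OF Bc xw] q1 q2
        polar_smult_right[OF Bc smult_carrier_vec[THEN iffD2, OF uf] xw] polar_smult_left[OF Bc xw uf] q3 by simp
    assume 0: "(r $ 0) \<cdot>\<^sub>v (u @\<^sub>v f) + (r $ 1) \<cdot>\<^sub>v (x @\<^sub>v w) = 0\<^sub>v (6 + 4)"
    \<comment> \<open>At coordinate 6 the first direction has entry 1 and the second has entry
      0.\<close>
    then have "((r $ 0) \<cdot>\<^sub>v (u @\<^sub>v f) + (r $ 1) \<cdot>\<^sub>v (x @\<^sub>v w)) $ 6 = 0" by simp
    then have r0: "r $ 0 = 0" using u(1) f x w w0 by simp
    then have "(r $ 1) \<cdot>\<^sub>v (x @\<^sub>v w) = 0\<^sub>v (6 + 4)"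
      using 0 xw by (simp add: smult_zero_vec[OF uf])
    then have "r $ 1 = 0" using xw0 xw by (metis smult_vec_eq_zero)
    then show "r = 0\<^sub>v 2" using r r0 by (intro eq_vecI) (auto simp: less_2_cases_iff)
  qed
qed

end

section \<open>The filtration of the Witt group\<close>

lemma polar_smult_mat:
  assumes "A \<in> carrier_mat n n" "x \<in> carrier_vec n" "y \<in> carrier_vec n"
  shows "polar (c \<cdot>\<^sub>m A) x y = c * polar A x y"
  using assms by (simp add: polar_def qeval_smult algebra_simps)

lemma even_nonsingular_smult:
  assumes c: "c \<noteq> 0" and A: "A \<in> even_nonsingular_forms"
  shows "c \<cdot>\<^sub>m A \<in> even_nonsingular_forms"
proof (rule even_nonsingularI)
  note Ac = even_nonsingularD(4)[OF A]
  show "nonsingular (c \<cdot>\<^sub>m A)"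
  proof (rule nonsingularI)
    fix x assume x: "x \<in> carrier_vec (qdim A)" and 0: "\<And>y. y \<in> carrier_vec (qdim A) \<Longrightarrow> polar (c \<cdot>\<^sub>m A) x y = 0"
    show "x = 0\<^sub>v (qdim A)"
      by (rule nonsingular_zeroD[OF even_nonsingularD(3)[OF A] Ac x]) (use 0 c polar_smult_mat[OF Ac x] in auto)
  qed (use Ac in simp)
qed (use even_nonsingularD[OF A] in \<open>auto simp: quadratic_form_smult\<close>)

lemma qiso_smult:
  assumes "A \<cong>\<^sub>q B"
  shows "c \<cdot>\<^sub>m A \<cong>\<^sub>q c \<cdot>\<^sub>m B"
proof -
  have A: "quadratic_form A" and B: "quadratic_form B" and iso: "A \<simeq>\<^sub>q B" using assms by (auto simp: qiso_def)
  have d: "qdim B = qdim A" using isometric_qdim[OF iso] by simp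
  note Ac = quadratic_form_carrier[OF A] and Bc = quadratic_form_carrier[OF B, unfolded d]
  obtain f g where f: "lin (qdim A) (qdim A) f" "lin (qdim A) (qdim A) g"
    "\<And>x. x \<in> carrier_vec (qdim A) \<Longrightarrow> qeval B (f x) = qeval A x" "\<And>x. x \<in> carrier_vec (qdim A) \<Longrightarrow> g (f x) = x"
    using isometricE[OF iso Ac] by metis
  have "c \<cdot>\<^sub>m A \<simeq>\<^sub>q c \<cdot>\<^sub>m B"
  proof (rule isometricI[OF _ _ f(1)])
    fix x :: "'a vec" assume x: "x \<in> carrier_vec (qdim A)"
    show "qeval (c \<cdot>\<^sub>m B) (f x) = qeval (c \<cdot>\<^sub>m A) x"
      using qeval_smult[OF Bc lin_carrier[OF f(1) x]] qeval_smult[OF Ac x] f(3)[OF x] by simp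
    show "x = 0\<^sub>v (qdim A)" if "f x = 0\<^sub>v (qdim A)" using f(4)[OF x] that lin_zero[OF f(2)] by simp
  qed (use Ac Bc in auto)
  then show ?thesis using A B by (simp add: qiso_def quadratic_form_smult)
qed

text \<open>A form without nonzero values has zero polar form. The value supplied here becomes the
  scalar \<open>d\<close> of the similarity.\<close>

lemma nonsingular_value:
  fixes A :: "'a::field mat"
  assumes A: "quadratic_form A" "nonsingular A" "0 < qdim A"
  shows "\<exists>x\<in>carrier_vec (qdim A). qeval A x \<noteq> 0"
proof (rule ccontr)
  assume "\<not> ?thesis"
  then have "(unit_vec (qdim A) 0 :: 'a vec) = 0\<^sub>v (qdim A)"
    by (intro nonsingular_zeroD[OF A(2) quadratic_form_carrier[OF A(1)]]) (simp_all add: polar_def)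
  then show False using A(3) unit_vec_nonzero by blast
qed

context char_two
begin

sublocale witt: comm_group "witt_group :: 'a mat set monoid"
  by (rule witt_comm_group[OF char])

lemma witt_double: "w \<in> carrier witt_group \<Longrightarrow> w \<otimes>\<^bsub>witt_group\<^esub> w = \<one>\<^bsub>witt_group\<^esub>" for w :: "'a mat set"
  using witt_class_double[OF char] by (metis witt_carrierE)

lemma witt_inv: "w \<in> carrier witt_group \<Longrightarrow> inv\<^bsub>witt_group\<^esub> w = w" for w :: "'a mat set"
  using witt_double witt.inv_unique' by metis

lemma witt_eq_iff:
  fixes v w :: "'a mat set"
  assumes "v \<in> carrier witt_group" "w \<in> carrier witt_group"
  shows "v \<otimes>\<^bsub>witt_group\<^esub> w = \<one>\<^bsub>witt_group\<^esub> \<longleftrightarrow> v = w"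
  using witt_double assms by (metis witt.inv_equality witt_inv)

lemma pfister_even_nonsingular:
  "0 \<notin> set bs \<Longrightarrow> pfister_form bs (a :: 'a) \<in> even_nonsingular_forms"
proof (induction bs)
  case Nil
  have "nonsingular (binary_form 1 a)"
  proof (rule nonsingularI)
    fix x :: "'a vec" assume x: "x \<in> carrier_vec 2"
      and 0: "\<And>y. y \<in> carrier_vec 2 \<Longrightarrow> polar (binary_form 1 a) x y = 0"
    have two: "(2 :: 'a) = 0" using add_self[of 1] by simp
    have "x $ 0 = 0" "x $ 1 = 0"
      using 0[of "unit_vec 2 1"] 0[of "unit_vec 2 0"] x by (simp_all add: polar_binary two)
    then show "x = 0\<^sub>v 2" using x by (intro eq_vecI) (auto simp: less_2_cases_iff)
  qed simp
  then show ?case by (simp add: even_nonsingularI quadratic_form_binary)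
next
  case (Cons b bs)
  then show ?case
    by (auto simp: bilinear_tensor_def intro!: even_nonsingular_orth_sum even_nonsingular_smult)
qed

lemma is_pfisterE:
  assumes "is_pfister n (A :: 'a mat)"
  obtains bs a where "Suc (length bs) = n" "0 \<notin> set bs" "A \<cong>\<^sub>q pfister_form bs a" "A \<in> even_nonsingular_forms"
    "witt_class A = witt_class (pfister_form bs a)"
proof -
  obtain bs a where *: "Suc (length bs) = n" "0 \<notin> set bs" "A \<simeq>\<^sub>q pfister_form bs a" "quadratic_form A"
    using assms unfolding is_pfister_def by blast
  then have iso: "A \<cong>\<^sub>q pfister_form bs a" by (simp add: qiso_def quadratic_form_pfister)
  have "A \<in> even_nonsingular_forms"
    by (rule even_nonsingular_qiso[OF qiso_sym[OF iso] pfister_even_nonsingular[OF *(2)]])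
  then show ?thesis using that[OF *(1,2) iso] witt_class_qiso[OF iso] by blast
qed

lemma is_pfister_pfister_form: "0 \<notin> set bs \<Longrightarrow> Suc (length bs) = n \<Longrightarrow> is_pfister n (pfister_form bs (a :: 'a))"
  unfolding is_pfister_def using qiso_refl[OF quadratic_form_pfister] by (auto simp: qiso_def)

section \<open>Classes in the third power and their modules\<close>

lemma Iq_generators: "{witt_class (c \<cdot>\<^sub>m A) | c A. c \<noteq> 0 \<and> is_pfister n A} \<subseteq> carrier (witt_group :: 'a mat set monoid)"
  by (auto elim!: is_pfisterE intro!: witt_class_closed even_nonsingular_smult)

lemma Iq_subgroup: "subgroup (Iq n) (witt_group :: 'a mat set monoid)"
  unfolding Iq_def by (rule witt.generate_is_subgroup[OF Iq_generators])

lemma Iq_carrier: "w \<in> Iq n \<Longrightarrow> w \<in> carrier witt_group" for w :: "'a mat set"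
  using subgroup.mem_carrier[OF Iq_subgroup] .

lemma Iq_mult: "v \<in> Iq n \<Longrightarrow> w \<in> Iq n \<Longrightarrow> v \<otimes>\<^bsub>witt_group\<^esub> w \<in> Iq n" for w :: "'a mat set"
  using subgroup.m_closed[OF Iq_subgroup] .

lemma Iq_pfister: "is_pfister n A \<Longrightarrow> c \<noteq> 0 \<Longrightarrow> witt_class (c \<cdot>\<^sub>m A) \<in> Iq n" for A :: "'a mat"
  unfolding Iq_def by (rule generate.incl) blast

lemma one_smult_mat: "(1 :: 'a) \<cdot>\<^sub>m A = A"
  by (rule eq_matI) auto

lemma Iq_pfister_1: "is_pfister n A \<Longrightarrow> witt_class A \<in> Iq n" for A :: "'a mat"
  using Iq_pfister[of n A 1] by (simp add: one_smult_mat)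

text \<open>Expanding the first slot \<open>b\<close> writes a multiple of a 3-fold Pfister form as
  the sum of two multiples of a 2-fold one.\<close>

lemma Iq_3_subset: "Iq 3 \<subseteq> (Iq 2 :: 'a mat set set)"
  unfolding Iq_def[of 3]
proof (rule witt.generate_subgroup_incl[OF _ Iq_subgroup], safe)
  fix c :: 'a and A :: "'a mat" assume c: "c \<noteq> 0" and "is_pfister 3 A"
  then obtain bs a where A: "Suc (length bs) = 3" "0 \<notin> set bs" "A \<cong>\<^sub>q pfister_form bs a" "A \<in> even_nonsingular_forms"
    by (elim is_pfisterE)
  then obtain b b' where bs: "bs = [b, b']" by (cases bs; cases "tl bs") auto
  have nz: "b \<noteq> 0" "b' \<noteq> 0" using A(2) by (auto simp: bs)
  let ?P = "pfister_form [b'] a"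
  have P: "is_pfister 2 ?P" by (rule is_pfister_pfister_form) (use nz in auto)
  then have Pe: "?P \<in> even_nonsingular_forms" by (elim is_pfisterE)
  have "c \<cdot>\<^sub>m pfister_form bs a = (c \<cdot>\<^sub>m ?P) \<bottom>\<^sub>q ((c * b) \<cdot>\<^sub>m ?P)"
    unfolding bs by (simp add: bilinear_tensor_def smult_orth_sum smult_smult_mat mult.assoc)
  moreover have "witt_class (c \<cdot>\<^sub>m A) = witt_class (c \<cdot>\<^sub>m pfister_form bs a)"
    by (rule witt_class_qiso[OF qiso_smult[OF A(3)] even_nonsingular_smult[OF c A(4)]])
  moreover have "witt_class (c \<cdot>\<^sub>m ?P) \<otimes>\<^bsub>witt_group\<^esub> witt_class ((c * b) \<cdot>\<^sub>m ?P) \<in> Iq 2"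
    using c nz by (intro Iq_mult Iq_pfister P) auto
  ultimately show "witt_class (c \<cdot>\<^sub>m A) \<in> Iq 2"
    using witt_mult[OF even_nonsingular_smult[OF c Pe] even_nonsingular_smult[OF _ Pe, of "c * b"]] c nz by simp
qed

lemma cliffordian_generator:
  fixes A :: "'a mat"
  assumes c: "c \<noteq> 0" and "is_pfister 3 A"
  shows "\<exists>B. B \<in> even_nonsingular_forms \<and> witt_class B = witt_class (c \<cdot>\<^sub>m A) \<and> cliffordian B"
proof -
  obtain bs a where A: "Suc (length bs) = 3" "0 \<notin> set bs" "A \<cong>\<^sub>q pfister_form bs a" "A \<in> even_nonsingular_forms"
    using assms(2) by (elim is_pfisterE)
  then obtain b b' where bs: "bs = [b, b']" by (cases bs; cases "tl bs") auto
  have "cliffordian (c \<cdot>\<^sub>m pfister_form bs a)" unfolding bs by (rule cliffordian_pfister) (use A(2) c bs in auto)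
  moreover have "witt_class (c \<cdot>\<^sub>m A) = witt_class (c \<cdot>\<^sub>m pfister_form bs a)"
    by (rule witt_class_qiso[OF qiso_smult[OF A(3)] even_nonsingular_smult[OF c A(4)]])
  ultimately show ?thesis using even_nonsingular_smult[OF c pfister_even_nonsingular[OF A(2)]] by metis
qed

text \<open>Sums of generators are formed on explicit models, and inverses add nothing as classes
  are their own inverses. The model obtained agrees with \<open>A\<close> only up to planes: planes
  are added on the side of the model, which keeps it a model, and are removed next to
  \<open>A\<close> at the level of modules.\<close>

lemma has_module_if_Iq_3:
  fixes A :: "'a mat"
  assumes A: "A \<in> even_nonsingular_forms" and w: "witt_class A \<in> Iq 3"
  shows "has_module A"
proof -
  have "\<exists>B. B \<in> even_nonsingular_forms \<and> witt_class B = w \<and> cliffordian B" if "w \<in> Iq 3" for w :: "'a mat set"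
    using that unfolding Iq_def
  proof (induction rule: generate.induct)
    case one
    then show ?case using zero_form witt_one cliffordian_zero by metis
  next
    case (incl h)
    then show ?case using cliffordian_generator by blast
  next
    case (inv h)
    then have "h \<in> carrier witt_group" using Iq_generators by blast
    then have "inv\<^bsub>witt_group\<^esub> h = h" by (rule witt_inv)
    then show ?case using cliffordian_generator inv by auto
  next
    case (eng h1 h2)
    then obtain B C where "B \<in> even_nonsingular_forms" "witt_class B = h1" "cliffordian B"
      "C \<in> even_nonsingular_forms" "witt_class C = h2" "cliffordian C" by blast
    then show ?case
      using witt_mult[of B C] cliffordian_orth_sum[of B C] even_nonsingular_orth_sum[of B C] even_nonsingularD(1,2)
      by metis
  qed
  then obtain B where B: "B \<in> even_nonsingular_forms" "witt_class B = witt_class A" "cliffordian B" using w by blast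
  then have "(B, A) \<in> witt_rel" using witt_class_eq[OF B(1) A] by simp
  then obtain m n where iso: "B \<bottom>\<^sub>q hyperbolic m \<cong>\<^sub>q A \<bottom>\<^sub>q hyperbolic n" by (elim witt_relE)
  have "cliffordian (B \<bottom>\<^sub>q hyperbolic m)"
    by (intro cliffordian_orth_sum cliffordian_hyperbolic quadratic_form_hyperbolic B(3) even_nonsingularD(1,2)[OF B(1)]) simp
  then have "has_module (A \<bottom>\<^sub>q hyperbolic n)" by (intro has_module_qiso[OF iso] has_module_cliffordian)
  then show ?thesis by (rule has_module_cancel[OF even_nonsingularD(1)[OF A]])
qed

text \<open>This is the case of the Hauptsatz saying that nonzero anisotropic forms in
  \<open>I_q^3\<close> have dimension at least 8.\<close>

lemma small_Iq_3_trivial: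
  fixes A :: "'a mat"
  assumes "A \<in> even_nonsingular_forms" "witt_class A \<in> Iq 3" "qdim A \<le> 6"
  shows "witt_class A = \<one>\<^bsub>witt_group\<^esub>"
  using witt_class_trivial_if_module[OF has_module_if_Iq_3[OF assms(1,2)] assms(1,3)] .

lemma isotropic_Iq_3_trivial:
  fixes A :: "'a mat"
  assumes A: "A \<in> even_nonsingular_forms" and "witt_class A \<in> Iq 3" "qdim A \<le> 8" "\<not> anisotropic A"
  shows "witt_class A = \<one>\<^bsub>witt_group\<^esub>"
proof -
  obtain B where B: "quadratic_form B" "nonsingular B" "qdim A = 2 + qdim B" "A \<cong>\<^sub>q binary_form 0 0 \<bottom>\<^sub>q B"
    using isotropic_splitting[OF even_nonsingularD(1,3)[OF A] assms(4)] .
  show ?thesis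
    using small_Iq_3_trivial[of B] witt_class_cancel_plane[OF B(4) A B(1,2)] B(3) assms(2,3) by simp
qed

text \<open>With \<open>N\<close> the norm form \<open>[1,a]\<close> of \<open>F[w]\<close>, the form is \<open>N \<bottom> b N\<close>. If \<open>N\<close> is anisotropic, the multiples
  of an isotropic vector by \<open>F[w]\<close> form a Lagrangian.\<close>

lemma isotropic_pfister_trivial:
  fixes a b d :: 'a
  defines "\<psi> \<equiv> d \<cdot>\<^sub>m pfister_form [b] a"
  assumes nz: "b \<noteq> 0" "d \<noteq> 0" and iso: "\<not> anisotropic \<psi>"
  shows "witt_class \<psi> = \<one>\<^bsub>witt_group\<^esub>"
proof -
  have qd: "qdim \<psi> = 4" by (simp add: \<psi>_def bilinear_tensor_def)
  have ens: "\<psi> \<in> even_nonsingular_forms"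
    unfolding \<psi>_def by (rule even_nonsingular_smult[OF nz(2) pfister_even_nonsingular]) (use nz in simp)
  define N where "N r s = r\<^sup>2 + r * s + a * s\<^sup>2" for r s :: 'a
  have q: "qeval \<psi> z = d * (N (z $ 0) (z $ 1) + b * N (z $ 2) (z $ 3))" if "z \<in> carrier_vec 4" for z
    unfolding \<psi>_def qeval_pfister1[OF that] N_def ..
  obtain z where z: "z \<in> carrier_vec 4" "z \<noteq> 0\<^sub>v 4" "qeval \<psi> z = 0"
    using iso unfolding anisotropic_def qd by blast
  have qz: "N (z $ 0) (z $ 1) + b * N (z $ 2) (z $ 3) = 0" using z(3) q[OF z(1)] nz(2) by simp
  have "totally_isotropic 2 \<psi>"
  proof (cases "\<exists>r s. (r \<noteq> 0 \<or> s \<noteq> 0) \<and> N r s = 0")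
    case True
    then obtain r s where rs: "r \<noteq> 0 \<or> s \<noteq> 0" "N r s = 0" by blast
    \<comment> \<open>An isotropic vector of the norm form, placed in each of the two copies, spans
      a Lagrangian.\<close>
    define m n where "m = vec 4 (\<lambda>i. if i = 0 then r else if i = 1 then s else 0)"
      and "n = vec 4 (\<lambda>i. if i = 2 then r else if i = 3 then s else 0)"
    have mn: "m \<in> carrier_vec 4" "n \<in> carrier_vec 4" by (simp_all add: m_def n_def)
    have scale: "N (t * r) (t * s) = 0" for t
    proof -
      have "N (t * r) (t * s) = t\<^sup>2 * N r s" by (simp add: N_def power2_eq_square algebra_simps)
      then show ?thesis by (simp add: rs(2))
    qed
    show ?thesis
    proof (rule totally_isotropicI, unfold qd)
      show "lin 2 4 (\<lambda>t. (t $ 0) \<cdot>\<^sub>v m + (t $ 1) \<cdot>\<^sub>v n)" by (intro lin_sum lin_coord mn) auto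
      fix t :: "'a vec" assume t: "t \<in> carrier_vec 2"
      have i: "((t $ 0) \<cdot>\<^sub>v m + (t $ 1) \<cdot>\<^sub>v n) $ 0 = t $ 0 * r" "((t $ 0) \<cdot>\<^sub>v m + (t $ 1) \<cdot>\<^sub>v n) $ 1 = t $ 0 * s"
        "((t $ 0) \<cdot>\<^sub>v m + (t $ 1) \<cdot>\<^sub>v n) $ 2 = t $ 1 * r" "((t $ 0) \<cdot>\<^sub>v m + (t $ 1) \<cdot>\<^sub>v n) $ 3 = t $ 1 * s"
        by (simp_all add: m_def n_def)
      have "(t $ 0) \<cdot>\<^sub>v m + (t $ 1) \<cdot>\<^sub>v n \<in> carrier_vec 4" using mn by simp
      then show "qeval \<psi> ((t $ 0) \<cdot>\<^sub>v m + (t $ 1) \<cdot>\<^sub>v n) = 0"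
        by (subst q) (simp_all only: i scale mult_zero_right add_0)
      assume 0: "(t $ 0) \<cdot>\<^sub>v m + (t $ 1) \<cdot>\<^sub>v n = 0\<^sub>v 4"
      have "t $ 0 * r = 0" "t $ 0 * s = 0" "t $ 1 * r = 0" "t $ 1 * s = 0" using i unfolding 0 by simp_all
      then have "t $ 0 = 0" "t $ 1 = 0" using rs(1) by auto
      then show "t = 0\<^sub>v 2" using t by (intro eq_vecI) (auto simp: less_2_cases_iff)
    qed
  next
    case False
    \<comment> \<open>\<open>z'\<close> is the multiple \<open>w z\<close>, where a pair of
      coordinates \<open>(x, y)\<close> stands for \<open>x + y w\<close> and
      \<open>w\<^sup>2 = w + a\<close>.\<close>
    define z' where "z' = vec 4 (\<lambda>i. if i = 0 then a * z $ 1 else if i = 1 then z $ 0 + z $ 1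
      else if i = 2 then a * z $ 3 else z $ 2 + z $ 3)"
    have z': "z' \<in> carrier_vec 4" by (simp add: z'_def)
    \<comment> \<open>Multiplicativity of the norm of \<open>F[w]\<close>.\<close>
    have mult: "N (t * x + u * (a * y)) (t * y + u * (x + y)) = N t u * N x y" for t u x y
      by (simp add: N_def power2_eq_square algebra_simps char_simps)
    show ?thesis
    proof (rule totally_isotropicI, unfold qd)
      show "lin 2 4 (\<lambda>t. (t $ 0) \<cdot>\<^sub>v z + (t $ 1) \<cdot>\<^sub>v z')" by (intro lin_sum lin_coord z z') auto
      fix t :: "'a vec" assume t: "t \<in> carrier_vec 2"
      let ?x = "(t $ 0) \<cdot>\<^sub>v z + (t $ 1) \<cdot>\<^sub>v z'"
      have i: "?x $ 0 = t $ 0 * z $ 0 + t $ 1 * (a * z $ 1)" "?x $ 1 = t $ 0 * z $ 1 + t $ 1 * (z $ 0 + z $ 1)"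
        "?x $ 2 = t $ 0 * z $ 2 + t $ 1 * (a * z $ 3)" "?x $ 3 = t $ 0 * z $ 3 + t $ 1 * (z $ 2 + z $ 3)"
        using z(1) by (simp_all add: z'_def)
      have "?x \<in> carrier_vec 4" using z(1) z' by simp
      then have "qeval \<psi> ?x = d * (N (?x $ 0) (?x $ 1) + b * N (?x $ 2) (?x $ 3))" by (rule q)
      also have "\<dots> = d * (N (t $ 0) (t $ 1) * N (z $ 0) (z $ 1) + b * (N (t $ 0) (t $ 1) * N (z $ 2) (z $ 3)))"
        unfolding i mult ..
      also have "\<dots> = d * (N (t $ 0) (t $ 1) * (N (z $ 0) (z $ 1) + b * N (z $ 2) (z $ 3)))"
        by (simp only: ring_distribs mult_ac)
      finally have "qeval \<psi> ?x = d * (N (t $ 0) (t $ 1) * (N (z $ 0) (z $ 1) + b * N (z $ 2) (z $ 3)))" .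
      then show "qeval \<psi> ?x = 0" unfolding qz by simp
      assume 0: "?x = 0\<^sub>v 4"
      have "N (t $ 0) (t $ 1) * N (z $ 0) (z $ 1) = N 0 0" "N (t $ 0) (t $ 1) * N (z $ 2) (z $ 3) = N 0 0"
        unfolding mult[symmetric] i[symmetric] unfolding 0 by simp_all
      then have "N (t $ 0) (t $ 1) = 0 \<or> (N (z $ 0) (z $ 1) = 0 \<and> N (z $ 2) (z $ 3) = 0)" by (auto simp: N_def)
      moreover have "\<not> (N (z $ 0) (z $ 1) = 0 \<and> N (z $ 2) (z $ 3) = 0)"
      proof
        assume "N (z $ 0) (z $ 1) = 0 \<and> N (z $ 2) (z $ 3) = 0"
        then have "z $ 0 = 0" "z $ 1 = 0" "z $ 2 = 0" "z $ 3 = 0" using False by blast+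
        moreover have "i = 0 \<or> i = 1 \<or> i = 2 \<or> i = 3" if "i < 4" for i :: nat using that by auto
        ultimately have "z $ i = 0" if "i < 4" for i using that by metis
        then have "z = 0\<^sub>v 4" using z(1) by (intro eq_vecI) auto
        then show False using z(2) by simp
      qed
      ultimately have "t $ 0 = 0" "t $ 1 = 0" using False by blast+
      then show "t = 0\<^sub>v 2" using t by (intro eq_vecI) (auto simp: less_2_cases_iff)
    qed
  qed
  then show ?thesis by (rule witt_class_trivial_if_lagrangian[OF ens]) (simp add: qd)
qed

lemma witt_rearrange:
  fixes x y z :: "'a mat set"
  assumes "x \<in> carrier witt_group" "y \<in> carrier witt_group" "z \<in> carrier witt_group"
  shows "(x \<otimes>\<^bsub>witt_group\<^esub> y) \<otimes>\<^bsub>witt_group\<^esub> (y \<otimes>\<^bsub>witt_group\<^esub> z) = x \<otimes>\<^bsub>witt_group\<^esub> z"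
proof -
  have "(x \<otimes>\<^bsub>witt_group\<^esub> y) \<otimes>\<^bsub>witt_group\<^esub> (y \<otimes>\<^bsub>witt_group\<^esub> z)
      = x \<otimes>\<^bsub>witt_group\<^esub> ((y \<otimes>\<^bsub>witt_group\<^esub> y) \<otimes>\<^bsub>witt_group\<^esub> z)"
    using assms by (simp add: witt.m_assoc)
  then show ?thesis using assms by (simp add: witt_double)
qed

text \<open>The orthogonal sum of a Pfister form and its multiple by \<open>d\<close> is the Pfister
  form with \<open>d\<close> as a new slot. Modulo \<open>Iq 3\<close> scaling is therefore
  invisible, and \<open>d\<close> can be chosen to create a common value.\<close>

lemma pfister_similar_difference:
  fixes a b d :: 'a
  assumes nz: "b \<noteq> 0" "d \<noteq> 0"
  shows "witt_class (pfister_form [b] a) \<otimes>\<^bsub>witt_group\<^esub> witt_class (d \<cdot>\<^sub>m pfister_form [b] a) \<in> Iq 3"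
proof -
  have P: "pfister_form [b] a \<in> even_nonsingular_forms" by (rule pfister_even_nonsingular) (use nz in simp)
  have "is_pfister 3 (pfister_form [d, b] a)" by (rule is_pfister_pfister_form) (use nz in auto)
  then have "witt_class (pfister_form [d, b] a) \<in> Iq 3" by (rule Iq_pfister_1)
  moreover have "pfister_form [d, b] a = pfister_form [b] a \<bottom>\<^sub>q (d \<cdot>\<^sub>m pfister_form [b] a)"
    by (simp add: bilinear_tensor_def)
  ultimately show ?thesis unfolding witt_mult[OF P even_nonsingular_smult[OF nz(2) P]] by simp
qed

text \<open>The analogue for \<open>I_q^3\<close> of the theorem of Albert on biquaternion algebras.\<close>

lemma similar_to_pfister:
  fixes a b :: 'a and A :: "'a mat"
  assumes A: "A \<in> even_nonsingular_forms" "qdim A = 6" and b: "b \<noteq> 0"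
    and Iq: "witt_class A \<otimes>\<^bsub>witt_group\<^esub> witt_class (pfister_form [b] a) \<in> Iq 3"
  shows "\<exists>d. d \<noteq> 0 \<and> witt_class A = witt_class (d \<cdot>\<^sub>m pfister_form [b] a)"
proof -
  let ?P = "pfister_form [b] a"
  have P: "?P \<in> even_nonsingular_forms" by (rule pfister_even_nonsingular) (use b in simp)
  have dP: "d \<cdot>\<^sub>m ?P \<in> even_nonsingular_forms" if "d \<noteq> 0" for d by (rule even_nonsingular_smult[OF that P])
  have qP: "qdim (d \<cdot>\<^sub>m ?P) = 4" for d by (simp add: bilinear_tensor_def)
  have unit: "qeval (d \<cdot>\<^sub>m ?P) (unit_vec 4 0) = d" for d by (simp add: qeval_pfister1 del: pfister_form.simps)
  note cl = witt_class_closed[OF A(1)] witt_class_closed[OF P] witt_class_closed[OF dP]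
  have Iqd: "witt_class A \<otimes>\<^bsub>witt_group\<^esub> witt_class (d \<cdot>\<^sub>m ?P) \<in> Iq 3" if "d \<noteq> 0" for d
    using Iq_mult[OF Iq pfister_similar_difference[OF b that, of a]]
      witt_rearrange[OF cl(1,2) witt_class_closed[OF dP[OF that]]] by simp
  show ?thesis
  proof (cases "anisotropic A")
    case False
    then obtain B where B: "quadratic_form B" "nonsingular B" "qdim A = 2 + qdim B" "A \<cong>\<^sub>q binary_form 0 0 \<bottom>\<^sub>q B"
      using isotropic_splitting[OF even_nonsingularD(1,3)[OF A(1)]] by blast
    note Be = witt_class_cancel_plane[OF B(4) A(1) B(1,2)]
    have qB: "qdim B = 4" using B(3) A(2) by simp
    \<comment> \<open>With \<open>d\<close> a value of \<open>B\<close>, the 8-dimensional sum is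
      isotropic and falls under the 6-dimensional case once a plane is removed.\<close>
    obtain x where x: "x \<in> carrier_vec 4" "qeval B x \<noteq> 0" using nonsingular_value[OF B(1,2)] qB by auto
    define d where "d = qeval B x"
    have d: "d \<noteq> 0" using x by (simp add: d_def)
    let ?C = "B \<bottom>\<^sub>q (d \<cdot>\<^sub>m ?P)"
    have C: "?C \<in> even_nonsingular_forms" by (rule even_nonsingular_orth_sum[OF Be(1) dP[OF d]])
    have wC: "witt_class ?C = witt_class A \<otimes>\<^bsub>witt_group\<^esub> witt_class (d \<cdot>\<^sub>m ?P)"
      using witt_mult[OF Be(1) dP[OF d]] Be(2) by simp
    have "qeval ?C (x @\<^sub>v unit_vec 4 0) = 0"
      by (simp add: qeval_orth_sum[OF even_nonsingularD(4)[OF Be(1), unfolded qB]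
            even_nonsingularD(4)[OF dP[OF d], unfolded qP] x(1) unit_vec_carrier]
          unit d_def[symmetric] add_self del: pfister_form.simps)
    moreover have "x @\<^sub>v unit_vec 4 0 \<noteq> 0\<^sub>v (4 + 4)"
    proof
      assume 0: "x @\<^sub>v unit_vec 4 0 = 0\<^sub>v (4 + 4)"
      show False using append_eq_zero(2)[OF x(1) unit_vec_carrier 0] unit_vec_nonzero[of 0 4] by simp
    qed
    moreover have "x @\<^sub>v unit_vec 4 0 \<in> carrier_vec (4 + 4)" by (intro append_carrier_vec x unit_vec_carrier)
    ultimately have "\<not> anisotropic ?C" using anisotropicD[of ?C] unfolding qdim_orth_sum qB qP by blast
    then have "witt_class ?C = \<one>\<^bsub>witt_group\<^esub>"
      by (intro isotropic_Iq_3_trivial[OF C]) (use Iqd[OF d] wC qB qP in auto)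
    then have "witt_class A = witt_class (d \<cdot>\<^sub>m ?P)" unfolding wC witt_eq_iff[OF cl(1) cl(3)[OF d]] .
    then show ?thesis using d by blast
  next
    case True
    obtain u where u: "u \<in> carrier_vec 6" "qeval A u \<noteq> 0"
      using nonsingular_value[OF even_nonsingularD(1,3)[OF A(1)]] A(2) by auto
    define d where "d = qeval A u"
    have d: "d \<noteq> 0" using u by (simp add: d_def)
    show ?thesis
    proof (cases "anisotropic (d \<cdot>\<^sub>m ?P)")
      case False
      \<comment> \<open>Here both classes turn out to be trivial, so the same \<open>d\<close>
        serves.\<close>
      then have 1: "witt_class (d \<cdot>\<^sub>m ?P) = \<one>\<^bsub>witt_group\<^esub>" by (rule isotropic_pfister_trivial[OF b d])
      then have "witt_class A \<in> Iq 3" using Iqd[OF d] cl(1) by simp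
      then have "witt_class A = \<one>\<^bsub>witt_group\<^esub>" by (rule small_Iq_3_trivial[OF A(1)]) (simp add: A(2))
      then show ?thesis using 1 d by metis
    next
      case an: True
      let ?C = "A \<bottom>\<^sub>q (d \<cdot>\<^sub>m ?P)"
      have C: "?C \<in> even_nonsingular_forms" by (rule even_nonsingular_orth_sum[OF A(1) dP[OF d]])
      have wC: "witt_class ?C = witt_class A \<otimes>\<^bsub>witt_group\<^esub> witt_class (d \<cdot>\<^sub>m ?P)"
        using witt_mult[OF A(1) dP[OF d]] by simp
      \<comment> \<open>The totally isotropic plane allows two hyperbolic planes to be split off,
        which takes dimension 10 down to 6.\<close>
      have "totally_isotropic 2 ?C"
        by (rule common_plane[OF b d even_nonsingularD(1)[OF A(1)] A(2) _ an True u(1) d_def[symmetric]])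
          (rule has_module_if_Iq_3[OF C], use Iqd[OF d] wC in simp)
      then have "totally_isotropic (Suc (Suc 0)) ?C" by (simp add: numeral_2_eq_2)
      then obtain B where B: "quadratic_form B" "nonsingular B" "qdim ?C = 2 + qdim B" "?C \<cong>\<^sub>q binary_form 0 0 \<bottom>\<^sub>q B"
        "totally_isotropic (Suc 0) B"
        using totally_isotropic_splitting[OF even_nonsingularD(1,3)[OF C]] by blast
      note Be = witt_class_cancel_plane[OF B(4) C B(1,2)]
      obtain B' where B': "quadratic_form B'" "nonsingular B'" "qdim B = 2 + qdim B'" "B \<cong>\<^sub>q binary_form 0 0 \<bottom>\<^sub>q B'"
        using totally_isotropic_splitting[OF B(1,2,5)] by blast
      note Be' = witt_class_cancel_plane[OF B'(4) Be(1) B'(1,2)]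
      have "qdim B' \<le> 6" using B(3) B'(3) A(2) qP[of d] by simp
      then have "witt_class ?C = \<one>\<^bsub>witt_group\<^esub>"
        using small_Iq_3_trivial[OF Be'(1)] Be(2) Be'(2) wC Iqd[OF d] by simp
      then have "witt_class A = witt_class (d \<cdot>\<^sub>m ?P)" unfolding wC witt_eq_iff[OF cl(1) cl(3)[OF d]] .
      then show ?thesis using d by blast
    qed
  qed
qed

text \<open>Both forms represent 1, and 1 + 1 = 0, so their 8-dimensional sum is isotropic. Removing
  one plane leaves the Albert form of the pair.\<close>

lemma pfister_pair:
  fixes A B :: "'a mat"
  assumes "is_pfister 2 A" "is_pfister 2 B"
  shows "\<exists>C\<in>even_nonsingular_forms. qdim C = 6 \<and> witt_class A \<otimes>\<^bsub>witt_group\<^esub> witt_class B = witt_class C"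
proof -
  have two: "\<exists>b a. bs = [b] \<and> b \<noteq> 0" if "Suc (length bs) = 2" "0 \<notin> set bs" for bs :: "'a list"
    using that by (cases bs) auto
  obtain b a b' a' where nz: "b \<noteq> 0" "b' \<noteq> 0"
    and w: "witt_class A = witt_class (pfister_form [b] a)" "witt_class B = witt_class (pfister_form [b'] a')"
    using is_pfisterE[OF assms(1)] is_pfisterE[OF assms(2)] two by metis
  let ?P = "pfister_form [b] a" and ?Q = "pfister_form [b'] a'"
  have P: "?P \<in> even_nonsingular_forms" and Q: "?Q \<in> even_nonsingular_forms"
    by (rule pfister_even_nonsingular, use nz in simp)+
  have q: "qdim ?P = 4" "qdim ?Q = 4" by (simp_all add: bilinear_tensor_def)
  have unit: "qeval (pfister_form [c] e) (unit_vec 4 0) = 1" for c e :: 'a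
    using qeval_pfister1[of "unit_vec 4 0" 1 c e] by (simp add: one_smult_mat del: pfister_form.simps)
  let ?u = "unit_vec 4 0 @\<^sub>v unit_vec 4 0 :: 'a vec"
  note PQ = even_nonsingular_orth_sum[OF P Q]
  have "qeval (?P \<bottom>\<^sub>q ?Q) ?u = 0"
    using qeval_orth_sum[OF even_nonsingularD(4)[OF P, unfolded q] even_nonsingularD(4)[OF Q, unfolded q] unit_vec_carrier unit_vec_carrier]
    by (simp only: unit add_self)
  moreover have "?u \<noteq> 0\<^sub>v (4 + 4)"
  proof
    assume 0: "?u = 0\<^sub>v (4 + 4)"
    show False using append_eq_zero(2)[OF unit_vec_carrier unit_vec_carrier 0] unit_vec_nonzero[of 0 4] by simp
  qed
  moreover have "?u \<in> carrier_vec (4 + 4)" by (intro append_carrier_vec unit_vec_carrier)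
  ultimately have "\<not> anisotropic (?P \<bottom>\<^sub>q ?Q)" using anisotropicD[of "?P \<bottom>\<^sub>q ?Q"] unfolding qdim_orth_sum q by blast
  then obtain C where C: "quadratic_form C" "nonsingular C" "qdim (?P \<bottom>\<^sub>q ?Q) = 2 + qdim C"
    "?P \<bottom>\<^sub>q ?Q \<cong>\<^sub>q binary_form 0 0 \<bottom>\<^sub>q C"
    using isotropic_splitting[OF even_nonsingularD(1,3)[OF PQ]] by blast
  have "qdim C = 6" using C(3) q by simp
  then show ?thesis
    using witt_class_cancel_plane[OF C(4) PQ C(1,2)] witt_mult[OF P Q] w by metis
qed

lemma is_pfister_2E:
  assumes "is_pfister 2 (A :: 'a mat)"
  obtains b a where "b \<noteq> 0" "witt_class A = witt_class (pfister_form [b] a)"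
proof -
  obtain bs a where bs: "Suc (length bs) = 2" "0 \<notin> set bs" "witt_class A = witt_class (pfister_form bs a)"
    using is_pfisterE[OF assms] by metis
  then obtain b where "bs = [b]" by (cases bs) auto
  then show ?thesis using that[of b a] bs by auto
qed

lemma pfister_class_closed: "is_pfister n A \<Longrightarrow> witt_class A \<in> carrier witt_group" for A :: "'a mat"
  using Iq_carrier[OF Iq_pfister_1] .

text \<open>The Albert form of the pair has dimension 6 and class in \<open>Iq 3\<close>, so its
  class is trivial. This makes the definite description in \<open>pfister_rep\<close>
  meaningful.\<close>

lemma pfister_unique:
  fixes A B :: "'a mat"
  assumes "is_pfister 2 A" "is_pfister 2 B" "witt_class A \<otimes>\<^bsub>witt_group\<^esub> witt_class B \<in> Iq 3"
  shows "witt_class A = witt_class B"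
proof -
  obtain C where C: "C \<in> even_nonsingular_forms" "qdim C = 6"
    "witt_class A \<otimes>\<^bsub>witt_group\<^esub> witt_class B = witt_class C" using pfister_pair[OF assms(1,2)] by blast
  then have "witt_class A \<otimes>\<^bsub>witt_group\<^esub> witt_class B = \<one>\<^bsub>witt_group\<^esub>"
    using small_Iq_3_trivial[OF C(1)] assms(3) by simp
  then show ?thesis unfolding witt_eq_iff[OF pfister_class_closed[OF assms(1)] pfister_class_closed[OF assms(2)]] .
qed

text \<open>The Albert form of \<open>A\<close> and \<open>B\<close> is congruent to
  \<open>C\<close> modulo \<open>Iq 3\<close>, so it is Witt equivalent to a multiple of a Pfister
  form of dimension 4.\<close>

lemma pfister_sum_dim_4:
  fixes A B C :: "'a mat"
  assumes "is_pfister 2 A" "is_pfister 2 B" "is_pfister 2 C"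
    and "(witt_class A \<otimes>\<^bsub>witt_group\<^esub> witt_class B) \<otimes>\<^bsub>witt_group\<^esub> witt_class C \<in> Iq 3"
  shows "\<exists>D\<in>even_nonsingular_forms. qdim D = 4 \<and> witt_class A \<otimes>\<^bsub>witt_group\<^esub> witt_class B = witt_class D"
proof -
  obtain E where E: "E \<in> even_nonsingular_forms" "qdim E = 6"
    "witt_class A \<otimes>\<^bsub>witt_group\<^esub> witt_class B = witt_class E" using pfister_pair[OF assms(1,2)] by blast
  obtain b a where P: "b \<noteq> 0" "witt_class C = witt_class (pfister_form [b] a)"
    by (rule is_pfister_2E[OF assms(3)])
  obtain d where d: "d \<noteq> 0" "witt_class E = witt_class (d \<cdot>\<^sub>m pfister_form [b] a)"
    using similar_to_pfister[OF E(1,2) P(1)] assms(4) unfolding E(3) P(2) by blast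
  have "d \<cdot>\<^sub>m pfister_form [b] a \<in> even_nonsingular_forms"
    by (rule even_nonsingular_smult[OF d(1) pfister_even_nonsingular]) (use P(1) in simp)
  moreover have "qdim (d \<cdot>\<^sub>m pfister_form [b] a) = 4" by (simp add: bilinear_tensor_def)
  ultimately show ?thesis using E(3) d(2) by metis
qed

section \<open>The quotient of \<open>Iq 2\<close> by \<open>Iq 3\<close>\<close>

abbreviation "I2 \<equiv> (Iq_group 2 :: 'a mat set monoid)"

lemma I2_simps: "carrier I2 = Iq 2" "x \<otimes>\<^bsub>I2\<^esub> y = x \<otimes>\<^bsub>witt_group\<^esub> y" "\<one>\<^bsub>I2\<^esub> = \<one>\<^bsub>witt_group\<^esub>"
  by (simp_all add: Iq_group_def)

lemma I2_comm_group: "comm_group I2"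
  unfolding Iq_group_def
  by (rule group.group_comm_groupI[OF witt.subgroup_imp_group[OF Iq_subgroup]]) (simp add: Iq_carrier witt.m_comm)

lemma Iq_3_subgroup: "subgroup (Iq 3) I2"
  unfolding Iq_group_def by (rule witt.subgroup_incl[OF Iq_subgroup Iq_subgroup Iq_3_subset])

lemma Iq_3_normal: "Iq 3 \<lhd> I2"
  by (rule comm_group.subgroup_imp_normal[OF I2_comm_group Iq_3_subgroup])

sublocale quot: group "Iq_quot 2 :: 'a mat set set monoid"
  using normal.factorgroup_is_group[OF Iq_3_normal] by (simp add: Iq_quot_def numeral_3_eq_3)

lemma proj_def: "Iq_proj 2 w = Iq 3 #>\<^bsub>I2\<^esub> (w :: 'a mat set)"
  by (simp add: Iq_proj_def numeral_3_eq_3)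

lemma proj_closed: "w \<in> Iq 2 \<Longrightarrow> Iq_proj 2 w \<in> carrier (Iq_quot 2 :: 'a mat set set monoid)"
  by (auto simp: Iq_quot_def FactGroup_def RCOSETS_def proj_def I2_simps numeral_3_eq_3)

lemma proj_mult:
  fixes v w :: "'a mat set"
  assumes "v \<in> Iq 2" "w \<in> Iq 2"
  shows "Iq_proj 2 v \<otimes>\<^bsub>Iq_quot 2\<^esub> Iq_proj 2 w = Iq_proj 2 (v \<otimes>\<^bsub>witt_group\<^esub> w)"
  using normal.rcos_sum[OF Iq_3_normal, of v w] assms
  by (simp add: Iq_quot_def FactGroup_def proj_def I2_simps numeral_3_eq_3)

lemma proj_trivial_iff:
  fixes w :: "'a mat set"
  assumes "w \<in> Iq 2"
  shows "Iq_proj 2 w = \<one>\<^bsub>Iq_quot 2\<^esub> \<longleftrightarrow> w \<in> Iq 3"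
proof -
  interpret I2: comm_group I2 by (rule I2_comm_group)
  have one: "\<one>\<^bsub>Iq_quot 2\<^esub> = (Iq 3 :: 'a mat set set)" by (simp add: Iq_quot_def FactGroup_def numeral_3_eq_3)
  show ?thesis unfolding one proj_def
    using I2.coset_join1[OF _ _ Iq_3_subgroup, of w] I2.coset_join2[OF _ Iq_3_subgroup, of w] assms
    by (auto simp: I2_simps)
qed

lemma proj_square:
  fixes w :: "'a mat set"
  assumes "w \<in> Iq 2"
  shows "Iq_proj 2 w \<otimes>\<^bsub>Iq_quot 2\<^esub> Iq_proj 2 w = \<one>\<^bsub>Iq_quot 2\<^esub>"
  using proj_mult[OF assms assms] proj_trivial_iff[OF Iq_mult[OF assms assms]]
    witt_double[OF Iq_carrier[OF assms]] subgroup.one_closed[OF Iq_subgroup[of 3]] by simp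

lemma proj_eqD:
  fixes v w :: "'a mat set"
  assumes "v \<in> Iq 2" "w \<in> Iq 2" "Iq_proj 2 v = Iq_proj 2 w"
  shows "v \<otimes>\<^bsub>witt_group\<^esub> w \<in> Iq 3"
  using proj_mult[OF assms(1,2)] proj_square[OF assms(2)] proj_trivial_iff[OF Iq_mult[OF assms(1,2)]] assms(3)
  by simp

section \<open>Pairing the elements of the subgroup generated by a tight set\<close>

context
  fixes S :: "'a mat set" and r :: "'a mat set set \<Rightarrow> 'a mat set" and G :: "'a mat set set set"
  defines "G \<equiv> image_subgroup 2 S" and "r \<equiv> pfister_rep 2"
  assumes tight: "tight 2 S"
begin

lemma G_subgroup: "subgroup G (Iq_quot 2)"
  unfolding G_def image_subgroup_def
proof (rule quot.generate_is_subgroup, safe)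
  fix A assume "A \<in> S"
  then have "is_pfister 2 A" using tight by (simp add: tight_def)
  then show "Iq_proj 2 (witt_class A) \<in> carrier (Iq_quot 2)" by (intro proj_closed Iq_pfister_1)
qed

text \<open>Tightness gives existence and \<open>pfister_unique\<close> gives uniqueness, so the
  description denotes a Witt class with the required properties.\<close>

lemma r_pfister:
  assumes "X \<in> G"
  shows "\<exists>A. is_pfister 2 A \<and> r X = witt_class A \<and> Iq_proj 2 (r X) = X"
proof -
  obtain A where A: "is_pfister 2 A" "Iq_proj 2 (witt_class A) = X"
    using tight assms by (auto simp: tight_def G_def)
  have "\<exists>!w. \<exists>A. is_pfister 2 A \<and> w = witt_class A \<and> Iq_proj 2 w = X"
  proof (rule ex1I[of _ "witt_class A"])
    show "\<exists>B. is_pfister 2 B \<and> witt_class A = witt_class B \<and> Iq_proj 2 (witt_class A) = X" using A by blast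
    fix w assume "\<exists>B. is_pfister 2 B \<and> w = witt_class B \<and> Iq_proj 2 w = X"
    then obtain B where B: "is_pfister 2 B" "w = witt_class B" "Iq_proj 2 w = X" by blast
    have "w \<otimes>\<^bsub>witt_group\<^esub> witt_class A \<in> Iq 3"
      using B A by (intro proj_eqD) (auto intro: Iq_pfister_1)
    then show "w = witt_class A" using pfister_unique[OF B(1) A(1)] B(2) by simp
  qed
  from theI'[OF this] show ?thesis unfolding r_def pfister_rep_def by blast
qed

lemma r_closed: "X \<in> G \<Longrightarrow> r X \<in> Iq 2"
  using r_pfister Iq_pfister_1 by metis

text \<open>The representatives of \<open>X\<close>, of \<open>g\<close> and of their product add up
  to a class in \<open>Iq 3\<close>, because classes are their own inverses. The representative of
  \<open>g\<close> is the third form, to a multiple of which the sum reduces.\<close>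

lemma pair_dim_4:
  assumes "X \<in> G" "g \<in> G"
  shows "\<exists>D\<in>even_nonsingular_forms. qdim D = 4 \<and> r X \<otimes>\<^bsub>witt_group\<^esub> r (X \<otimes>\<^bsub>Iq_quot 2\<^esub> g) = witt_class D"
proof -
  have Xg: "X \<otimes>\<^bsub>Iq_quot 2\<^esub> g \<in> G" by (rule subgroup.m_closed[OF G_subgroup assms])
  obtain A B C where A: "is_pfister 2 A" "r X = witt_class A" "Iq_proj 2 (r X) = X"
    and B: "is_pfister 2 B" "r (X \<otimes>\<^bsub>Iq_quot 2\<^esub> g) = witt_class B"
      "Iq_proj 2 (r (X \<otimes>\<^bsub>Iq_quot 2\<^esub> g)) = X \<otimes>\<^bsub>Iq_quot 2\<^esub> g"
    and C: "is_pfister 2 C" "r g = witt_class C" "Iq_proj 2 (r g) = g"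
    using r_pfister[OF assms(1)] r_pfister[OF Xg] r_pfister[OF assms(2)] by blast
  have "Iq_proj 2 (r X \<otimes>\<^bsub>witt_group\<^esub> r g) = Iq_proj 2 (r (X \<otimes>\<^bsub>Iq_quot 2\<^esub> g))"
    using proj_mult[OF r_closed[OF assms(1)] r_closed[OF assms(2)]] A(3) B(3) C(3) by simp
  then have "(r X \<otimes>\<^bsub>witt_group\<^esub> r g) \<otimes>\<^bsub>witt_group\<^esub> r (X \<otimes>\<^bsub>Iq_quot 2\<^esub> g) \<in> Iq 3"
    by (intro proj_eqD Iq_mult r_closed assms Xg)
  moreover have "(r X \<otimes>\<^bsub>witt_group\<^esub> r g) \<otimes>\<^bsub>witt_group\<^esub> r (X \<otimes>\<^bsub>Iq_quot 2\<^esub> g) = (r X \<otimes>\<^bsub>witt_group\<^esub> r (X \<otimes>\<^bsub>Iq_quot 2\<^esub> g)) \<otimes>\<^bsub>witt_group\<^esub> r g"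
    using Iq_carrier[OF r_closed[OF assms(1)]] Iq_carrier[OF r_closed[OF assms(2)]] Iq_carrier[OF r_closed[OF Xg]]
    by (simp add: witt.m_assoc witt.m_comm[of "r g"])
  ultimately show ?thesis
    using pfister_sum_dim_4[OF A(1) B(1) C(1)] unfolding A(2) B(2) C(2) by simp
qed

text \<open>The induction runs over sets stable under translation by \<open>g\<close> and removes
  one orbit at a time, in place of choosing coset representatives. An orbit has two elements because
  \<open>g\<close> is a nontrivial involution, and it contributes dimension 4, whence the factor
  2.\<close>

lemma finprod_dim:
  assumes g: "g \<in> G" "g \<noteq> \<one>\<^bsub>Iq_quot 2\<^esub>"
    and T: "finite T" "T \<subseteq> G" "\<And>X. X \<in> T \<Longrightarrow> X \<otimes>\<^bsub>Iq_quot 2\<^esub> g \<in> T"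
  shows "\<exists>D\<in>even_nonsingular_forms. qdim D \<le> 2 * card T \<and> finprod I2 r T = witt_class D"
  using T
proof (induction "card T" arbitrary: T rule: less_induct)
  case less
  interpret I2: comm_group I2 by (rule I2_comm_group)
  show ?case
  proof (cases "T = {}")
    case True
    then show ?thesis using zero_form by (intro bexI[of _ "0\<^sub>m 0 0"]) (auto simp: I2_simps witt_one qdim_def)
  next
    case False
    then obtain X where X: "X \<in> T" by blast
    define Y where "Y = X \<otimes>\<^bsub>Iq_quot 2\<^esub> g"
    have in_carrier: "Z \<in> carrier (Iq_quot 2)" if "Z \<in> G" for Z using subgroup.mem_carrier[OF G_subgroup that] .
    have gc: "g \<in> carrier (Iq_quot 2)" by (rule in_carrier[OF g(1)])
    have Xc: "X \<in> carrier (Iq_quot 2)" using X less.prems(2) in_carrier by blast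
    have gg: "g \<otimes>\<^bsub>Iq_quot 2\<^esub> g = \<one>\<^bsub>Iq_quot 2\<^esub>"
      using proj_square[OF r_closed[OF g(1)]] r_pfister[OF g(1)] by auto
    have invol: "(Z \<otimes>\<^bsub>Iq_quot 2\<^esub> g) \<otimes>\<^bsub>Iq_quot 2\<^esub> g = Z" if "Z \<in> carrier (Iq_quot 2)" for Z
      using that gc gg by (simp add: quot.m_assoc)
    have Y: "Y \<in> T" using less.prems(3)[OF X] by (simp add: Y_def)
    have XY: "X \<noteq> Y"
    proof
      assume "X = Y"
      then have "X \<otimes>\<^bsub>Iq_quot 2\<^esub> g = X" by (simp add: Y_def)
      then have "g = \<one>\<^bsub>Iq_quot 2\<^esub>" using quot.l_cancel_one[OF Xc gc] by blast
      then show False using g(2) by blast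
    qed
    define T' where "T' = T - {X, Y}"
    have T': "T = insert X (insert Y T')" "X \<notin> insert Y T'" "Y \<notin> T'" "finite T'"
      using X Y XY less.prems(1) by (auto simp: T'_def)
    have card: "card T = Suc (Suc (card T'))" unfolding T'(1) using T'(2-4) by simp
    have closed: "Z \<otimes>\<^bsub>Iq_quot 2\<^esub> g \<in> T'" if Z: "Z \<in> T'" for Z
    proof -
      have Zc: "Z \<in> carrier (Iq_quot 2)" using Z less.prems(2) in_carrier T'_def by blast
      have "Z \<otimes>\<^bsub>Iq_quot 2\<^esub> g \<in> T" using less.prems(3) Z by (simp add: T'_def)
      moreover have "Z \<otimes>\<^bsub>Iq_quot 2\<^esub> g \<noteq> X" using invol[OF Zc] Z by (auto simp: T'_def Y_def)
      moreover have "Z \<otimes>\<^bsub>Iq_quot 2\<^esub> g \<noteq> Y"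
      proof
        assume e: "Z \<otimes>\<^bsub>Iq_quot 2\<^esub> g = Y"
        have "Z = X" using invol[OF Zc] unfolding e unfolding Y_def invol[OF Xc] by (rule sym)
        then show False using Z by (simp add: T'_def)
      qed
      ultimately show ?thesis by (simp add: T'_def)
    qed
    obtain D where D: "D \<in> even_nonsingular_forms" "qdim D \<le> 2 * card T'" "finprod I2 r T' = witt_class D"
      using less.hyps[of T'] card T'(4) closed less.prems(2) T'_def by auto
    obtain E where E: "E \<in> even_nonsingular_forms" "qdim E = 4" "r X \<otimes>\<^bsub>witt_group\<^esub> r Y = witt_class E"
      using pair_dim_4[of X g] X less.prems(2) g(1) unfolding Y_def by blast
    have rc: "r \<in> T \<rightarrow> carrier I2" using r_closed less.prems(2) by (auto simp: I2_simps)
    then have "finprod I2 r T = r X \<otimes>\<^bsub>I2\<^esub> (r Y \<otimes>\<^bsub>I2\<^esub> finprod I2 r T')"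
      unfolding T'(1) using T'(2-4) by (simp add: Pi_iff)
    also have "\<dots> = (r X \<otimes>\<^bsub>witt_group\<^esub> r Y) \<otimes>\<^bsub>witt_group\<^esub> witt_class D"
      using Iq_carrier[of "r X" 2] Iq_carrier[of "r Y" 2] rc X Y D(1)
      by (simp add: I2_simps D(3) witt.m_assoc Pi_iff witt_class_closed)
    also have "\<dots> = witt_class (E \<bottom>\<^sub>q D)" unfolding E(3) by (rule witt_mult[OF E(1) D(1)])
    finally show ?thesis
      using even_nonsingular_orth_sum[OF E(1) D(1)] E(2) D(2) card by (intro bexI[of _ "E \<bottom>\<^sub>q D"]) auto
  qed
qed

end

end

theorem proposition8p7:
  fixes S :: "'a::field mat set" and s :: nat
  assumes "CHAR('a) = 2"
    and "s \<ge> 2"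
    and "card S = s"
    and "tight 2 S"
    and "card (image_subgroup 2 S) = 2 ^ s"
  shows "qdim (anisotropic_part (Sigma_sum 2 S)) \<le> 2 ^ (s + 1)"
proof -
  interpret char_two "TYPE('a)" by unfold_locales (rule assms(1))
  let ?G = "image_subgroup 2 S"
  have fin: "finite ?G" using assms(5) by (metis card.infinite power_not_zero zero_neq_numeral)
  \<comment> \<open>A subgroup with more than one element contains the nontrivial \<open>g\<close>
    that drives the pairing.\<close>
  have "1 < card ?G" using assms(2,5) by (metis one_less_numeral_iff one_less_power semiring_norm(76) less_le_trans pos2)
  then have "\<not> ?G \<subseteq> {\<one>\<^bsub>Iq_quot 2\<^esub>}" using card_mono[of "{\<one>\<^bsub>Iq_quot 2\<^esub>}" ?G] by auto
  then obtain g where g: "g \<in> ?G" "g \<noteq> \<one>\<^bsub>Iq_quot 2\<^esub>" by blast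
  have "\<exists>D\<in>even_nonsingular_forms. qdim D \<le> 2 * card ?G \<and> finprod (Iq_group 2) (pfister_rep 2) ?G = witt_class D"
    by (rule finprod_dim[OF assms(4) g fin order_refl])
      (rule subgroup.m_closed[OF G_subgroup[OF assms(4)] _ g(1)])
  then obtain D where D: "D \<in> even_nonsingular_forms" "qdim D \<le> 2 * card ?G" "Sigma_sum 2 S = witt_class D"
    unfolding Sigma_sum_def by blast
  have "qdim (anisotropic_part (Sigma_sum 2 S)) \<le> qdim D"
    unfolding D(3) by (rule qdim_anisotropic_part_le[OF assms(1) D(1)])
  also have "\<dots> \<le> 2 ^ (s + 1)" using D(2) assms(5) by simp
  finally show ?thesis .
qed

end
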